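(* Let $K$ be a number field, $E$ an elliptic curve over $K$ given by a Weierstrass equation, and $p\geq 5$ a prime. Let $P_1=(x_1,y_1)$, $P_2=(x_2,y_2)$ be a $\mathbb{Z}/p\mathbb{Z}$-basis of $E[p]$ such that, with respect to this basis, every element of $\mathrm{Gal}(K(E[p])/K)$ acts on $E[p]$ by a matrix of the form $\begin{pmatrix}a&0\\0&c\end{pmatrix}$ or $\begin{pmatrix}0&a\\c&0\end{pmatrix}$ with $ac\neq 0$ (i.e., the Galois group is contained in a Cartan subgroup or in the normalizer of a Cartan subgroup, written in this form). Let $\zeta_p$ be a primitive $p$-th root of unity and $K_p:=K(E[p])$. Then $K_p=K(x_1,\zeta_p)$ or $K_p=K(x_1,y_1,\zeta_p)$. Moreover: (1) if $p\not\equiv 1\pmod 3$, then $K_p=K(\zeta_p,y_2)$; (2) if $p\equiv 1\pmod 3$, then $[K_p:K(\zeta_p,y_2)]$ is $1$ or $3$.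
   Context: $E[p]$ is the $p$-torsion subgroup of $E(\overline{K})$; $K(E[p])$ is the field obtained from $K$ by adjoining the coordinates of all points of $E[p]$. *)

theory Defs
  imports "HOL-Algebra.Generated_Fields" "HOL-Algebra.Algebraic_Closure_Type" "HOL-Number_Theory.Cong"
begin

definition number_field :: "'k::field_char_0 itself \<Rightarrow> bool"
  where "number_field _ \<longleftrightarrow>
    ring.finite_dimension (ring_of_type_algebra :: 'k ring) \<rat> UNIV"

text \<open>Coefficients of a general Weierstrass equation
  \<open>y\<^sup>2 + a\<^sub>1 x y + a\<^sub>3 y = x\<^sup>3 + a\<^sub>2 x\<^sup>2 + a\<^sub>4 x + a\<^sub>6\<close>.\<close>

datatype 'a weierstrass =
  Weierstrass (coef1: 'a) (coef2: 'a) (coef3: 'a) (coef4: 'a) (coef6: 'a)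

fun weierstrass_disc :: "'a::comm_ring_1 weierstrass \<Rightarrow> 'a"
  where "weierstrass_disc (Weierstrass a1 a2 a3 a4 a6) =
    (let b2 = a1^2 + 4 * a2;
         b4 = 2 * a4 + a1 * a3;
         b6 = a3^2 + 4 * a6;
         b8 = a1^2 * a6 + 4 * a2 * a6 - a1 * a3 * a4 + a2 * a3^2 - a4^2
     in - (b2^2 * b8) - 8 * b4^3 - 27 * b6^2 + 9 * b2 * b4 * b6)"

definition elliptic_curve :: "'a::comm_ring_1 weierstrass \<Rightarrow> bool"
  where "elliptic_curve W \<longleftrightarrow> weierstrass_disc W \<noteq> 0"

datatype 'a point = Infinity | Affine 'a 'a

fun on_curve :: "'a::field weierstrass \<Rightarrow> 'a point \<Rightarrow> bool"
  where
    "on_curve W Infinity \<longleftrightarrow> True"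
  | "on_curve (Weierstrass a1 a2 a3 a4 a6) (Affine x y) \<longleftrightarrow>
       y^2 + a1 * x * y + a3 * y = x^3 + a2 * x^2 + a4 * x + a6"

text \<open>The chord-and-tangent law: \<open>l\<close> is the slope of the line through the two points (the tangent
  if they coincide), and the third intersection point is reflected by
  \<open>(x, y) \<mapsto> (x, - y - a\<^sub>1 x - a\<^sub>3)\<close>.\<close>

fun point_add :: "'a::field weierstrass \<Rightarrow> 'a point \<Rightarrow> 'a point \<Rightarrow> 'a point"
  where
    "point_add W Infinity Q = Q"
  | "point_add W P Infinity = P"
  | "point_add (Weierstrass a1 a2 a3 a4 a6) (Affine x1 y1) (Affine x2 y2) =
      (if x1 = x2 \<and> y1 + y2 + a1 * x2 + a3 = 0 then Infinity
       else
         let l = (if x1 = x2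
                  then (3 * x1^2 + 2 * a2 * x1 + a4 - a1 * y1) / (2 * y1 + a1 * x1 + a3)
                  else (y2 - y1) / (x2 - x1));
             x3 = l^2 + a1 * l - a2 - x1 - x2;
             y3 = - (l + a1) * x3 - (y1 - l * x1) - a3
         in Affine x3 y3)"

text \<open>The group of points over the field \<open>'a\<close>, in the multiplicative notation of the library:
  \<open>P [^] n\<close> is the multiple \<open>n P\<close>.\<close>

definition curve_group :: "'a::field weierstrass \<Rightarrow> 'a point monoid"
  where "curve_group W = \<lparr>carrier = {P. on_curve W P}, monoid.mult = point_add W, one = Infinity\<rparr>"

definition base_change_ac :: "'k::field weierstrass \<Rightarrow> 'k alg_closure weierstrass"
  where "base_change_ac W = map_weierstrass to_ac W"

abbreviation geom_group :: "'k::field weierstrass \<Rightarrow> 'k alg_closure point monoid"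
  where "geom_group W \<equiv> curve_group (base_change_ac W)"

definition torsion :: "'k::field weierstrass \<Rightarrow> nat \<Rightarrow> 'k alg_closure point set"
  where "torsion W n =
    {P \<in> carrier (geom_group W). P [^]\<^bsub>geom_group W\<^esub> n = \<one>\<^bsub>geom_group W\<^esub>}"

definition torsion_basis ::
  "'k::field weierstrass \<Rightarrow> nat \<Rightarrow> 'k alg_closure point \<Rightarrow> 'k alg_closure point \<Rightarrow> bool"
  where "torsion_basis W p P1 P2 \<longleftrightarrow>
    P1 \<in> torsion W p \<and> P2 \<in> torsion W p \<and>
    (\<forall>Q \<in> torsion W p. \<exists>!(m, n). m < p \<and> n < p \<and>
       Q = P1 [^]\<^bsub>geom_group W\<^esub> (m::nat) \<otimes>\<^bsub>geom_group W\<^esub> P2 [^]\<^bsub>geom_group W\<^esub> (n::nat))"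

abbreviation ac_ring :: "'k::field alg_closure ring"
  where "ac_ring \<equiv> ring_of_type_algebra"

definition adjoin :: "'k::field alg_closure set \<Rightarrow> 'k alg_closure set"
  where "adjoin S = generate_field ac_ring (range to_ac \<union> S)"

definition torsion_field :: "'k::field weierstrass \<Rightarrow> nat \<Rightarrow> 'k alg_closure set"
  where "torsion_field W n = adjoin (\<Union>P \<in> torsion W n. set_point P)"

text \<open>The automorphisms over \<open>'k\<close> of an intermediate field \<open>L\<close>. They are total functions on the
  algebraic closure, of which only the restriction to \<open>L\<close> is constrained.\<close>

definition galois_group :: "'k::field alg_closure set \<Rightarrow> ('k alg_closure \<Rightarrow> 'k alg_closure) set"
  where "galois_group L =
    {\<sigma> \<in> ring_iso (ac_ring\<lparr>carrier := L\<rparr>) (ac_ring\<lparr>carrier := L\<rparr>).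
       \<forall>x. \<sigma> (to_ac x) = to_ac x}"

text \<open>With respect to \<open>P1, P2\<close>, the automorphism \<open>\<sigma>\<close> acts by the matrix with rows
  \<open>(m11, m12)\<close> and \<open>(m21, m22)\<close>; the columns are the images of the basis vectors.
  Entries modulo \<open>p\<close> are given by arbitrary natural representatives.\<close>

definition acts_by_matrix ::
  "'k::field weierstrass \<Rightarrow> 'k alg_closure point \<Rightarrow> 'k alg_closure point \<Rightarrow>
   ('k alg_closure \<Rightarrow> 'k alg_closure) \<Rightarrow> nat \<Rightarrow> nat \<Rightarrow> nat \<Rightarrow> nat \<Rightarrow> bool"
  where "acts_by_matrix W P1 P2 \<sigma> m11 m12 m21 m22 \<longleftrightarrow>
    map_point \<sigma> P1 =
      P1 [^]\<^bsub>geom_group W\<^esub> m11 \<otimes>\<^bsub>geom_group W\<^esub> P2 [^]\<^bsub>geom_group W\<^esub> m21 \<and>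
    map_point \<sigma> P2 =
      P1 [^]\<^bsub>geom_group W\<^esub> m12 \<otimes>\<^bsub>geom_group W\<^esub> P2 [^]\<^bsub>geom_group W\<^esub> m22"

definition primitive_root_of_unity :: "nat \<Rightarrow> 'a::comm_ring_1 \<Rightarrow> bool"
  where "primitive_root_of_unity n z \<longleftrightarrow> z ^ n = 1 \<and> (\<forall>k. 0 < k \<and> k < n \<longrightarrow> z ^ k \<noteq> 1)"

end

theory Submission
  imports Defs "HOL-Computational_Algebra.Formal_Laurent_Series" "HOL-Library.Groups_Big_Fun"
    "HOL-Number_Theory.Residues"
begin

text \<open>
  An automorphism fixing \<open>\<zeta>\<close> has determinant \<open>1\<close> on the torsion, because of the Weil pairing. If it
  fixes \<open>P\<^sub>1\<close>, then being diagonal or antidiagonal it is the identity, so \<open>K\<^sub>p = K(x\<^sub>1, y\<^sub>1, \<zeta>)\<close>. If it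
  fixes \<open>y\<^sub>2\<close>, then \<open>P\<^sub>2, \<sigma>P\<^sub>2, \<sigma>\<^sup>2P\<^sub>2\<close> lie on a horizontal line: it is diagonal, and its entry \<open>c\<close> at
  \<open>P\<^sub>2\<close> is \<open>1\<close> or satisfies \<open>1 + c + c\<^sup>2 = 0\<close>, which forces \<open>p \<equiv> 1\<close> modulo \<open>3\<close>; in the latter case
  \<open>x\<^sub>2\<close> is cubic over \<open>K(\<zeta>, y\<^sub>2)\<close> with three distinct conjugates.

  The Weil pairing is constructed as a commutator. Let \<open>(X, Y)\<close> be the point of the curve over the
  Laurent series field with \<open>X = t\<^sup>-\<^sup>2\<close>. A rational function is represented by its values at
  the translates \<open>(X, Y) + P\<close>, so that its order at \<open>P\<close> is the subdegree of a Laurent series and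
  translations act by shifting \<open>P\<close>. Norms to the rational functions in \<open>x\<close> show that principal
  divisors have degree \<open>0\<close>. No principal divisor has the form \<open>(P) - (Q)\<close> with \<open>P \<noteq> Q\<close>, and since
  \<open>(P) + (Q) - (P + Q) - (O)\<close> is principal, the addition is associative.
  For an \<open>n\<close>-torsion point \<open>S\<close> and a function \<open>h\<close> with divisor \<open>n(S) - n(O)\<close>, the operators
  \<open>\<phi> \<mapsto> h \<cdot> \<phi>(\<cdot> - S)\<close> commute up to scalars, which are the values of the pairing. If the pairing were
  trivial, then the operators of a basis would have a common eigenfunction \<open>g\<close>, and \<open>div g + n(O)\<close>
  would be a divisor of degree \<open>n\<close> invariant under translation by \<open>n\<^sup>2\<close> points.
\<close>

unbundle fps_syntax

section \<open>Field homomorphisms and Laurent series\<close>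

text \<open>Evaluation at translates of a generic point replaces local rings: the translate by P is
  a point over the Laurent series that reduces to P, and t serves as uniformizer at every P because
  translation carries the situation at O to P. Each translate is itself generic, so a nonzero
  function has a nonzero value at all of them.

  Associativity dictates the order. Shifting P translates a function only if (X, Y) + (P + S) = ((X,
  Y) + P) + S, which is associativity over the Laurent series field. Degrees of divisors and the
  divisors (P) - (Q) must therefore be settled without translations; the symmetry available is
  negation, through t -> -t, which supplies both the norm and a parity argument.

  On the Galois side, automorphisms of the whole algebraic closure with explicit inverses replace
  finite Galois theory. Zorn's lemma provides one that fixes S and moves a given element outside
  K(S); hence a subfield K(S) of K_p is all of K_p once every automorphism fixing S fixes both basis
  points.\<close>

locale field_hom =
  fixes h :: "'a::field \<Rightarrow> 'b::field"
  assumes hom_add [simp]: "h (x + y) = h x + h y"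
    and hom_mult [simp]: "h (x * y) = h x * h y"
    and hom_one [simp]: "h 1 = 1"
begin

lemma hom_zero [simp]: "h 0 = 0"
  using hom_add[of 0 0] by (simp only: add_0_left) (metis add_cancel_right_left)

lemma hom_uminus [simp]: "h (- x) = - h x"
  using hom_add[of x "- x"] by (simp add: eq_neg_iff_add_eq_0 add.commute)

lemma hom_diff [simp]: "h (x - y) = h x - h y"
  using hom_add[of x "- y"] by simp

lemma hom_power [simp]: "h (x ^ n) = h x ^ n"
  by (induction n) auto

lemma hom_of_nat [simp]: "h (of_nat n) = of_nat n"
  by (induction n) auto

lemma hom_numeral [simp]: "h (numeral n) = numeral n"
  using hom_of_nat[of "numeral n"] by simp

lemma hom_eq_zero_iff [simp]: "h x = 0 \<longleftrightarrow> x = 0"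
proof
  assume "h x = 0"
  show "x = 0"
  proof (rule ccontr)
    assume "x \<noteq> 0"
    then have "h x * h (inverse x) = 1"
      by (metis hom_mult hom_one right_inverse)
    with \<open>h x = 0\<close> show False by simp
  qed
qed simp

lemma hom_eq_iff [simp]: "h x = h y \<longleftrightarrow> x = y"
  using hom_eq_zero_iff[of "x - y"] by (simp del: hom_eq_zero_iff)

lemma hom_divide [simp]: "h (x / y) = h x / h y"
proof (cases "y = 0")
  case False
  then have "h (x / y) * h y = h x"
    by (metis hom_mult nonzero_divide_eq_eq)
  with False show ?thesis by (simp add: field_simps)
qed simp

lemma hom_inverse [simp]: "h (inverse x) = inverse (h x)"
  using hom_divide[of 1 x] by (simp add: divide_inverse)

lemma hom_sum [simp]: "h (sum f S) = (\<Sum>x\<in>S. h (f x))"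
  by (induction S rule: infinite_finite_induct) auto

lemma hom_poly: "h (poly q x) = poly (map_poly h q) (h x)"
  by (induction q) (auto simp: map_poly_pCons)

lemma map_poly_hom_eq_zero_iff [simp]: "map_poly h q = 0 \<longleftrightarrow> q = 0"
  by (rule map_poly_eq_0_iff) auto

lemma map_point_hom_inject [simp]: "map_point h P = map_point h Q \<longleftrightarrow> P = Q"
  by (cases P; cases Q) auto

lemma map_point_add:
  "map_point h (point_add W P Q) = point_add (map_weierstrass h W) (map_point h P) (map_point h Q)"
proof (cases W)
  case (Weierstrass a1 a2 a3 a4 a6)
  show ?thesis
  proof (cases P)
    case Infinity
    then show ?thesis by simp
  next
    case P: (Affine x1 y1)
    show ?thesis
    proof (cases Q)
      case Infinity
      then show ?thesis using P by simp
    next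
      case Q: (Affine x2 y2)
      have *: "h y1 + h y2 + h a1 * h x2 + h a3 = 0 \<longleftrightarrow> y1 + y2 + a1 * x2 + a3 = 0"
        using hom_eq_zero_iff[of "y1 + y2 + a1 * x2 + a3"] by simp
      show ?thesis
        using * by (simp add: Weierstrass P Q Let_def)
    qed
  qed
qed

lemma on_curve_map [simp]:
  "on_curve (map_weierstrass h W) (map_point h P) \<longleftrightarrow> on_curve W P"
proof (cases W)
  case (Weierstrass a1 a2 a3 a4 a6)
  show ?thesis
  proof (cases P)
    case (Affine x y)
    have "on_curve W P \<longleftrightarrow> h (y^2 + a1 * x * y + a3 * y) = h (x^3 + a2 * x^2 + a4 * x + a6)"
      by (simp only: hom_eq_iff) (simp add: Weierstrass Affine)
    then show ?thesis by (simp add: Weierstrass Affine)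
  qed simp
qed

lemma weierstrass_disc_map:
  "weierstrass_disc (map_weierstrass h W) = h (weierstrass_disc W)"
  by (cases W) (simp add: Let_def)

end

lemma field_hom_to_ac: "field_hom to_ac"
  by unfold_locales auto

lemma field_hom_fls_const: "field_hom (fls_const :: 'a::field \<Rightarrow> 'a fls)"
  by unfold_locales (auto simp: fls_plus_const)

section \<open>Coefficientwise maps of Laurent series and the substitution t -> -t\<close>

definition fls_map :: "('a::field \<Rightarrow> 'b::field) \<Rightarrow> 'a fls \<Rightarrow> 'b fls"
  where "fls_map h f = Abs_fls (\<lambda>n. h (f $$ n))"

context field_hom
begin

lemma fls_map_nth [simp]: "fls_map h f $$ n = h (f $$ n)"
  unfolding fls_map_def
  by (rule nth_Abs_fls_lower_bound[where N = "fls_subdegree f"]) auto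

lemma fls_map_eq_zero_iff [simp]: "fls_map h f = 0 \<longleftrightarrow> f = 0"
  by (auto simp: fls_eq_iff)

lemma fls_subdegree_map [simp]: "fls_subdegree (fls_map h f) = fls_subdegree f"
proof (cases "f = 0")
  case False
  then show ?thesis by (intro fls_subdegree_eqI) auto
next
  case True
  then have "fls_map h f = 0" by simp
  with True show ?thesis by (simp only: fls_zero_subdegree)
qed

lemma field_hom_fls_map: "field_hom (fls_map h)"
proof
  show "fls_map h (f + g) = fls_map h f + fls_map h g" for f g
    by (simp add: fls_eq_iff)
  show "fls_map h 1 = 1"
    by (simp add: fls_eq_iff)
  show "fls_map h (f * g) = fls_map h f * fls_map h g" for f g
    by (simp add: fls_eq_iff fls_times_nth(2))
qed

lemma fls_map_const [simp]: "fls_map h (fls_const c) = fls_const (h c)"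
  by (simp add: fls_eq_iff)

end

text \<open>The substitution \<open>t \<mapsto> - t\<close>, which will negate the generic point.\<close>

definition fls_neg_X :: "'a::field fls \<Rightarrow> 'a fls"
  where "fls_neg_X f = fls_compose_fps f (- fps_X)"

lemma field_hom_fls_neg_X: "field_hom (fls_neg_X :: 'a::field fls \<Rightarrow> _)"
  by unfold_locales (auto simp: fls_neg_X_def fls_compose_fps_add fls_compose_fps_mult)

interpretation fls_neg_X: field_hom "fls_neg_X :: 'a::field fls \<Rightarrow> 'a fls"
  by (rule field_hom_fls_neg_X)

lemma fls_neg_X_nth: "fls_neg_X f $$ n = (if even n then f $$ n else - (f $$ n))"
proof -
  have "fls_neg_X f $$ n = fls_compose_fps f (fps_const (-1) * fps_X) $$ n"
    by (simp only: fls_neg_X_def fps_const_neg[symmetric] fps_const_1_eq_1 mult_minus1)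
  also have "\<dots> = f $$ n * (-1) powi n"
    by (subst fls_nth_fls_compose_fps_linear) auto
  finally show ?thesis by auto
qed

lemma fls_neg_X_neg_X [simp]: "fls_neg_X (fls_neg_X f) = f"
  by (simp add: fls_eq_iff fls_neg_X_nth)

lemma fls_subdegree_neg_X [simp]: "fls_subdegree (fls_neg_X f) = fls_subdegree f"
proof (cases "f = 0")
  case False
  then show ?thesis by (intro fls_subdegree_eqI) (auto simp: fls_neg_X_nth)
qed simp

lemma fls_neg_X_const [simp]: "fls_neg_X (fls_const c) = fls_const c"
  by (simp add: fls_eq_iff fls_neg_X_nth)

text \<open>At an odd order the leading coefficient would equal its own negative, which
  characteristic 0 excludes.\<close>

lemma fls_neg_X_fixed_imp_even:
  fixes f :: "'a::field_char_0 fls"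
  assumes "fls_neg_X f = f" "f \<noteq> 0"
  shows "even (fls_subdegree f)"
proof (rule ccontr)
  assume "odd (fls_subdegree f)"
  then have "f $$ fls_subdegree f = - (f $$ fls_subdegree f)"
    by (metis assms(1) fls_neg_X_nth)
  then show False using assms(2) by simp
qed

lemma fls_neg_X_negated_imp_odd:
  fixes f :: "'a::field_char_0 fls"
  assumes "fls_neg_X f = - f" "f \<noteq> 0"
  shows "odd (fls_subdegree f)"
proof
  assume "even (fls_subdegree f)"
  then have "f $$ fls_subdegree f = - (f $$ fls_subdegree f)"
    by (metis assms(1) fls_neg_X_nth fls_uminus_nth)
  then show False using assms(2) by simp
qed

text \<open>A condition on coefficients, because the zero series has subdegree 0 by default. In this
  form 0 satisfies every bound, and bounds pass to sums without a case for cancellation.\<close>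

definition vge :: "int \<Rightarrow> 'a::field fls \<Rightarrow> bool"
  where "vge n f \<longleftrightarrow> (\<forall>k<n. f $$ k = 0)"

lemma vge_iff_subdegree: "vge n f \<longleftrightarrow> f = 0 \<or> n \<le> fls_subdegree f"
  unfolding vge_def by (metis fls_eq0_below_subdegree fls_subdegree_geI fls_zero_nth less_le_trans)

lemma vge_add: "vge n f \<Longrightarrow> vge n g \<Longrightarrow> vge n (f + g)"
  and vge_diff: "vge n f \<Longrightarrow> vge n g \<Longrightarrow> vge n (f - g)"
  and vge_uminus: "vge n f \<Longrightarrow> vge n (- f)"
  and vge_mono: "vge n f \<Longrightarrow> m \<le> n \<Longrightarrow> vge m f"
  by (auto simp: vge_def)

lemma vge_mult: "vge n f \<Longrightarrow> vge m g \<Longrightarrow> vge (n + m) (f * g)"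
  by (cases "f = 0"; cases "g = 0") (auto simp: vge_iff_subdegree)

lemma vge_const: "vge 0 (fls_const c)"
  by (simp add: vge_def)

lemma vge_self: "vge (fls_subdegree f) f"
  by (simp add: vge_def)

lemma fls_subdegree_inverse: "fls_subdegree (inverse f :: 'a::field fls) = - fls_subdegree f"
  by (cases "f = 0") auto

lemma fls_subdegree_divide:
  "f \<noteq> 0 \<Longrightarrow> g \<noteq> 0 \<Longrightarrow> fls_subdegree (f / g :: 'a::field fls) = fls_subdegree f - fls_subdegree g"
  by (simp add: divide_inverse fls_subdegree_inverse)

lemma fls_subdegree_power: "fls_subdegree (f ^ n :: 'a::field fls) = int n * fls_subdegree f"
  by (rule fls_subdegree_pow)

lemma subdegree_add_vge:
  assumes "f \<noteq> 0" "vge n g" "fls_subdegree f < n"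
  shows "f + g \<noteq> 0" "fls_subdegree (f + g :: 'a::field fls) = fls_subdegree f"
proof -
  have *: "(f + g) $$ fls_subdegree f \<noteq> 0"
    using assms by (auto simp: vge_def)
  then show "f + g \<noteq> 0" using fls_nonzeroI by blast
  show "fls_subdegree (f + g) = fls_subdegree f"
    using * assms by (intro fls_subdegree_eqI) (auto simp: vge_def)
qed

text \<open>Reduction modulo t: a series congruent to a nonzero constant is a unit. This excludes
  zeros away from the expected points.\<close>

lemma subdegree_zero_of_residue:
  assumes "vge 1 (f - fls_const c)" "c \<noteq> 0"
  shows "f \<noteq> 0" "fls_subdegree (f :: 'a::field fls) = 0"
  using subdegree_add_vge[OF _ assms(1), of "fls_const c"] assms by auto

section \<open>Cubics and the generic point\<close>

lemmas ring_expand = algebra_simps power2_eq_square power3_eq_cube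

section \<open>The addition law on y^2 = x^3 + A x^2 + B x + C\<close>

abbreviation cubic :: "'a::field \<Rightarrow> 'a \<Rightarrow> 'a \<Rightarrow> 'a weierstrass"
  where "cubic A B C \<equiv> Weierstrass 0 A 0 B C"

abbreviation cub :: "'a::field \<Rightarrow> 'a \<Rightarrow> 'a \<Rightarrow> 'a \<Rightarrow> 'a"
  where "cub A B C x \<equiv> x ^ 3 + A * x ^ 2 + B * x + C"

fun pneg :: "'a::field point \<Rightarrow> 'a point"
  where
    "pneg Infinity = Infinity"
  | "pneg (Affine x y) = Affine x (- y)"

lemma pneg_pneg [simp]: "pneg (pneg P) = P"
  by (cases P) auto

lemma pneg_eq_iff [simp]: "pneg P = pneg Q \<longleftrightarrow> P = Q"
  by (metis pneg_pneg)

lemma pneg_eq_Infinity_iff [simp]: "pneg P = Infinity \<longleftrightarrow> P = Infinity"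
  and Infinity_eq_pneg_iff [simp]: "Infinity = pneg P \<longleftrightarrow> P = Infinity"
  by (cases P; simp)+

lemma on_curve_pneg [simp]: "on_curve (cubic A B C) (pneg P) \<longleftrightarrow> on_curve (cubic A B C) P"
  by (cases P) auto

lemma point_add_Infinity_right [simp]: "point_add W P Infinity = P"
  by (cases P) auto

lemma cubic_add_pneg: "point_add (cubic A B C) P (pneg P) = Infinity"
  by (cases P) auto

lemma pneg_cubic_add:
  "pneg (point_add (cubic A B C) P Q) = point_add (cubic A B C) (pneg P) (pneg Q)"
proof (cases P)
  case P: (Affine x1 y1)
  show ?thesis
  proof (cases Q)
    case Q: (Affine x2 y2)
    define l where
      "l = (if x1 = x2 then (3 * x1^2 + 2 * A * x1 + B) / (2 * y1) else (y2 - y1) / (x2 - x1))"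
    have l': "(if x1 = x2 then (3 * x1^2 + 2 * A * x1 + B) / (2 * - y1)
        else (- y2 - - y1) / (x2 - x1)) = - l"
      by (simp add: l_def) (metis minus_diff_eq minus_divide_left)
    have "x1 = x2 \<and> - y1 + - y2 = 0 \<longleftrightarrow> x1 = x2 \<and> y1 + y2 = 0"
      by (metis add.inverse_neutral minus_add_distrib minus_minus)
    moreover have "point_add (cubic A B C) (Affine x1 y1) (Affine x2 y2) =
      (if x1 = x2 \<and> y1 + y2 = 0 then Infinity
       else Affine (l^2 - A - x1 - x2) (- l * (l^2 - A - x1 - x2) - (y1 - l * x1)))"
      by (simp add: Let_def l_def)
    moreover have "point_add (cubic A B C) (Affine x1 (- y1)) (Affine x2 (- y2)) =
      (if x1 = x2 \<and> - y1 + - y2 = 0 then Infinity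
       else Affine ((- l)^2 - A - x1 - x2) (- (- l) * ((- l)^2 - A - x1 - x2) - (- y1 - (- l) * x1)))"
      unfolding l'[symmetric] by (simp add: Let_def)
    ultimately show ?thesis
      unfolding P Q pneg.simps by simp
  qed (simp add: P)
qed simp

lemma point_add_cubic_chord:
  assumes "x1 \<noteq> x2" "y2 = l * (x2 - x1) + y1"
  shows "point_add (cubic A B C) (Affine x1 y1) (Affine x2 y2) =
    Affine (l^2 - A - x1 - x2) (- (l * ((l^2 - A - x1 - x2) - x1) + y1))"
proof -
  have l: "(y2 - y1) / (x2 - x1) = l" using assms by simp
  have "- l * q - (y1 - l * x1) = - (l * (q - x1) + y1)" for q
    by (simp add: algebra_simps)
  then show ?thesis using assms(1) by (simp add: l Let_def)
qed

lemma point_add_cubic_tangent: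
  assumes "2 * y1 \<noteq> 0" "2 * y1 * l = 3 * x1^2 + 2 * A * x1 + B"
  shows "point_add (cubic A B C) (Affine x1 y1) (Affine x1 y1) =
    Affine (l^2 - A - x1 - x1) (- (l * ((l^2 - A - x1 - x1) - x1) + y1))"
proof -
  have l: "(3 * x1^2 + 2 * A * x1 + B) / (2 * y1) = l"
    using assms by (simp flip: assms(2))
  have "- l * q - (y1 - l * x1) = - (l * (q - x1) + y1)" for q
    by (simp add: algebra_simps)
  then show ?thesis using assms(1) by (simp add: l Let_def flip: mult_2)
qed

lemma cub_taylor:
  "cub A B C x = cub A B C a + (3 * a^2 + 2 * A * a + B) * (x - a) + (3 * a + A) * (x - a)^2 + (x - a)^3"
  for x :: "'a::field"
  by (simp add: ring_expand)

text \<open>By Vieta, \<open>l^2 - A - x1 - x2\<close> is the third abscissa that matches the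
  coefficients of x^2. The two correction terms measure the failure of (x1, y1) to lie on the curve
  and of l to be the right slope. As an identity it also applies over the Laurent series
  field.\<close>

lemma cub_minus_line:
  fixes x :: "'a::field"
  shows "cub A B C x - (l * (x - x1) + y1)^2 = (x - x1) * (x - x2) * (x - (l^2 - A - x1 - x2))
    + (cub A B C x1 - y1^2)
    + (3 * x1^2 + 2 * A * x1 + B - 2 * y1 * l - (x2 - x1) * ((l^2 - A - x1 - x2) - x1)) * (x - x1)"
proof -
  define z where "z = x - x1"
  define w where "w = x2 - x1"
  have *: "x = x1 + z" "x2 = x1 + w" by (auto simp: z_def w_def)
  show ?thesis unfolding cub_taylor[of x A B C x1] * by (simp add: ring_expand)
qed
text \<open>Chord and tangent are merged: in both cases the correction terms of
  \<open>cub_minus_line\<close> vanish, so the three abscissas are the roots of the cubic minus the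
  squared line.\<close>

lemma chord_cases:
  assumes "on_curve (cubic A B C) (Affine x1 y1)" "on_curve (cubic A B C) (Affine x2 y2)"
    and "Affine x2 y2 \<noteq> pneg (Affine x1 y1)"
  obtains l where
    "point_add (cubic A B C) (Affine x1 y1) (Affine x2 y2) =
       Affine (l^2 - A - x1 - x2) (- (l * ((l^2 - A - x1 - x2) - x1) + y1))"
    "y2 = l * (x2 - x1) + y1"
    "\<And>x. cub A B C x - (l * (x - x1) + y1)^2 = (x - x1) * (x - x2) * (x - (l^2 - A - x1 - x2))"
proof (cases "x1 = x2")
  case False
  define l where "l = (y2 - y1) / (x2 - x1)"
  have l: "y2 = l * (x2 - x1) + y1"
    using False by (simp add: l_def)
  have c1: "cub A B C x1 - y1^2 = 0" and c2: "cub A B C x2 - (l * (x2 - x1) + y1)^2 = 0"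
    using assms(1,2) unfolding l[symmetric] by simp_all
  define k where "k = 3 * x1^2 + 2 * A * x1 + B - 2 * y1 * l - (x2 - x1) * ((l^2 - A - x1 - x2) - x1)"
  \<comment> \<open>At x2 the product and the constant correction vanish, leaving this term
    alone.\<close>
  have "k * (x2 - x1) = 0"
    using cub_minus_line[of x2 A B C l x1 y1 x2] unfolding c1 c2 k_def[symmetric] by simp
  then have k: "k = 0" using False by simp
  have "cub A B C x - (l * (x - x1) + y1)^2 = (x - x1) * (x - x2) * (x - (l^2 - A - x1 - x2))" for x
    using cub_minus_line[of x A B C l x1 y1 x2] unfolding c1 k_def[symmetric] k by simp
  then show thesis
    by (intro that[of l] point_add_cubic_chord[OF False l] l)
next
  case True
  have c1: "cub A B C x1 - y1^2 = 0" and c2: "y2^2 = y1^2"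
    using assms(1,2) True by simp_all
  have y: "y2 = y1" and nz: "y1 \<noteq> - y1"
    using c2 assms(3) unfolding True power2_eq_iff pneg.simps by fastforce+
  have nz2: "2 * y1 \<noteq> 0"
    using nz by (metis eq_neg_iff_add_eq_0 mult_2)
  define l where "l = (3 * x1^2 + 2 * A * x1 + B) / (2 * y1)"
  have l: "2 * y1 * l = 3 * x1^2 + 2 * A * x1 + B"
    unfolding l_def using nz2 by simp
  have "cub A B C x - (l * (x - x1) + y1)^2 = (x - x1) * (x - x1) * (x - (l^2 - A - x1 - x1))" for x
    using cub_minus_line[of x A B C l x1 y1 x1] unfolding c1 l by simp
  then show thesis
    using point_add_cubic_tangent[OF nz2 l] y unfolding True[symmetric]
    by (intro that[of l]) (simp_all only: True[symmetric] diff_self mult_zero_right add_0_left)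
qed

lemma cubic_add_closed:
  assumes "on_curve (cubic A B C) P" "on_curve (cubic A B C) Q"
  shows "on_curve (cubic A B C) (point_add (cubic A B C) P Q)"
proof (cases "P = Infinity \<or> Q = Infinity \<or> Q = pneg P")
  case True
  then show ?thesis using assms by (auto simp: cubic_add_pneg)
next
  case False
  then obtain x1 y1 x2 y2 where PQ: "P = Affine x1 y1" "Q = Affine x2 y2"
    by (metis point.exhaust)
  obtain l where
    l: "point_add (cubic A B C) (Affine x1 y1) (Affine x2 y2) =
       Affine (l^2 - A - x1 - x2) (- (l * ((l^2 - A - x1 - x2) - x1) + y1))"
    "\<And>x. cub A B C x - (l * (x - x1) + y1)^2 = (x - x1) * (x - x2) * (x - (l^2 - A - x1 - x2))"
    using chord_cases[of A B C x1 y1 x2 y2] assms False PQ by metis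
  show ?thesis
    using l(2)[of "l^2 - A - x1 - x2"] unfolding PQ l(1) on_curve.simps
    by (simp only: diff_self mult_zero_right right_minus_eq power2_minus mult_zero_left add_0_right)
qed

lemma cubic_add_commute:
  assumes "on_curve (cubic A B C) P" "on_curve (cubic A B C) Q"
  shows "point_add (cubic A B C) P Q = point_add (cubic A B C) Q P"
proof (cases P)
  case P: (Affine x1 y1)
  show ?thesis
  proof (cases Q)
    case Q: (Affine x2 y2)
    show ?thesis
    proof (cases "x1 = x2")
      case True
      have "y1^2 = y2^2" using assms by (simp add: P Q True)
      then have "y1 = y2 \<or> y1 = - y2" by (simp add: power2_eq_iff)
      then show ?thesis by (auto simp: P Q True)
    next
      case False
      define l where "l = (y2 - y1) / (x2 - x1)"
      have l': "(y1 - y2) / (x1 - x2) = l"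
        unfolding l_def by (metis minus_diff_eq minus_divide_divide)
      have y2: "y2 - l * x2 = y1 - l * x1"
        using False by (simp add: l_def field_simps)
      have "point_add (cubic A B C) P Q =
          Affine (l^2 - A - x1 - x2) (- l * (l^2 - A - x1 - x2) - (y1 - l * x1))"
        using False by (simp add: P Q Let_def flip: l_def)
      moreover have "point_add (cubic A B C) Q P =
          Affine (l^2 - A - x2 - x1) (- l * (l^2 - A - x2 - x1) - (y2 - l * x2))"
        using False by (simp add: P Q Let_def l')
      moreover have "l^2 - A - x2 - x1 = l^2 - A - x1 - x2" by simp
      ultimately show ?thesis unfolding y2 by simp
    qed
  qed (simp add: P)
qed simp

text \<open>A common root of the cubic and its derivative expresses B and C through A and r, and the
  discriminant vanishes identically at these values.\<close>

lemma cubic_squarefree: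
  fixes r :: "'a::field_char_0"
  assumes "weierstrass_disc (cubic A B C) \<noteq> 0" "cub A B C r = 0"
  shows "3 * r^2 + 2 * A * r + B \<noteq> 0"
proof
  assume "3 * r^2 + 2 * A * r + B = 0"
  then have B: "B = - (3 * r^2 + 2 * A * r)"
    by (metis add.commute eq_neg_iff_add_eq_0)
  have "C = - (r^3 + A * r^2 + B * r)"
    using assms(2) by (metis add.commute eq_neg_iff_add_eq_0)
  then have C: "C = 2 * r^3 + A * r^2"
    by (simp add: B ring_expand)
  have "weierstrass_disc (cubic A B C) =
      16 * (A^2 * B^2 - 4 * A^3 * C - 4 * B^3 - 27 * C^2 + 18 * A * B * C)"
    by (simp add: Let_def ring_expand)
  also have "\<dots> = 0"
    unfolding B C by (simp add: ring_expand)
  finally show False using assms(1) by simp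
qed

text \<open>Meant for (u, v) generic, with poles of order 2 and 3. The first factor is the abscissa
  of (u, v) + (r, s) minus r, a difference in which poles cancel. The right side has a pole of order
  at most 3 against 4 for \<open>(u - r)^2\<close>, so this difference vanishes modulo t.\<close>

lemma chord_x_diff:
  fixes u :: "'a::field"
  assumes "l * (u - r) = v - s" "v^2 = cub A B C u" "s^2 = cub A B C r"
  shows "(l^2 - A - u - r - r) * (u - r)^2 =
    (3 * r^2 + 2 * A * r + B) * (u - r) - 2 * s * (v - s)"
proof -
  have "(l^2 - A - u - r - r) * (u - r)^2 = (l * (u - r))^2 - (A + u + 2 * r) * (u - r)^2"
    by (simp add: ring_expand)
  also have "\<dots> = (v^2 - s^2) - 2 * s * (v - s) - (A + u + 2 * r) * (u - r)^2"
    unfolding assms(1) by (simp add: ring_expand)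
  also have "\<dots> = (3 * r^2 + 2 * A * r + B) * (u - r) - 2 * s * (v - s)"
    unfolding assms(2,3) by (simp add: ring_expand)
  finally show ?thesis .
qed

text \<open>The companion for ordinates: for (u, v) generic, \<open>(u - r)^3 - (v - s)^2\<close>
  loses its pole of order 6 by the curve equation, so the right side has a pole of order at most 5
  against 6 for \<open>(u - r)^3\<close>.\<close>

lemma chord_y_diff:
  fixes u :: "'a::field"
  assumes "l * (u - r) = v - s" "d * (u - r)^2 = e * (u - r) - 2 * s * (v - s)"
  shows "(- (l * d + s) - s) * (u - r)^3 =
    - (2 * s * ((u - r)^3 - (v - s)^2) + e * (v - s) * (u - r))"
proof -
  have "(- (l * d + s) - s) * (u - r)^3 = - (l * (u - r)) * (d * (u - r)^2) - 2 * s * (u - r)^3"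
    by (simp add: ring_expand)
  also have "\<dots> = - (2 * s * ((u - r)^3 - (v - s)^2) + e * (v - s) * (u - r))"
    unfolding assms by (simp add: ring_expand)
  finally show ?thesis .
qed

text \<open>This rule and multiplicativity of the homomorphism \<open>fls_const\<close> rewrite in opposite directions.\<close>

declare fls_const_mult_const [simp del]

section \<open>The generic point and its translates by constant points\<close>

locale smooth_cubic =
  fixes A B C :: "'a::{alg_closed_field, field_char_0}"
  assumes disc_nonzero: "weierstrass_disc (cubic A B C) \<noteq> 0"
begin

abbreviation W where "W \<equiv> cubic A B C"
abbreviation c :: "'a \<Rightarrow> 'a fls" where "c \<equiv> fls_const"
abbreviation WL where "WL \<equiv> cubic (c A) (c B) (c C)"
abbreviation curve where "curve \<equiv> {P. on_curve W P}"
abbreviation padd (infixl "+\<^sub>E" 65) where "P +\<^sub>E Q \<equiv> point_add W P Q"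

sublocale c: field_hom "fls_const :: 'a \<Rightarrow> 'a fls"
  by (rule field_hom_fls_const)

definition Tx :: "'a fls" where "Tx = fls_X_inv ^ 2"

text \<open>For X = t^-2 the cubic is t^-6 times a power series with constant term 1, which has a
  square root. The coefficient at -3 fixes the sign.\<close>

lemma Ty_exists:
  "\<exists>y. y^2 = cub (c A) (c B) (c C) Tx \<and> y $$ (-3) = 1 \<and> fls_subdegree y = -3"
proof -
  define q where "q = 1 + fps_const A * fps_X^2 + fps_const B * fps_X^4 + fps_const C * fps_X^6"
  \<comment> \<open>\<open>q\<close> is t^6 times the cubic at t^-2; the first argument prescribes 1
    as the root of its constant term 1.\<close>
  define s where "s = fps_radical (\<lambda>_ _. 1) (Suc 1) q"
  have q0: "q $ 0 = 1"
    by (simp add: q_def)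
  have s2: "s ^ Suc 1 = q"
    unfolding s_def by (rule iffD1[OF power_radical]) (auto simp: q0)
  have s0: "s $ 0 = 1"
    by (simp add: s_def)
  define u where "u = (fls_X_inv :: 'a fls)"
  define v where "v = (fls_X :: 'a fls)"
  have uv: "u * v = 1"
    unfolding u_def v_def by (metis fls_X_nonzero fls_inverse_X left_inverse)
  define S where "S = fps_to_fls s"
  define y where "y = u ^ 3 * S"
  have "S ^ 2 = fps_to_fls q"
    using s2 by (simp add: S_def numeral_2_eq_2 fps_to_fls_power flip: fls_times_fps_to_fls)
  also have "\<dots> = 1 + c A * v^2 + c B * v^4 + c C * v^6"
    by (simp add: q_def v_def fls_times_fps_to_fls fps_to_fls_power)
  finally have "y^2 = cub (c A) (c B) (c C) Tx"
  proof -
    assume S2: "S ^ 2 = 1 + c A * v^2 + c B * v^4 + c C * v^6"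
    have "y^2 = u^6 * S^2" by (simp add: y_def power_mult_distrib flip: power_mult)
    also have "\<dots> = u^6 + c A * (u^4 * (u * v)^2) + c B * (u^2 * (u * v)^4) + c C * (u * v)^6"
      unfolding S2 by (simp add: algebra_simps power_mult_distrib eval_nat_numeral)
    also have "\<dots> = cub (c A) (c B) (c C) Tx"
      by (simp add: uv Tx_def flip: u_def power_mult)
    finally show ?thesis .
  qed
  moreover have y: "y = fls_shift 3 S"
    unfolding y_def u_def by (simp add: fls_X_inv_power_times_conv_shift)
  have "y $$ (-3) = 1" by (simp add: y S_def s0)
  moreover have "fls_subdegree y = -3"
    by (rule fls_subdegree_eqI) (auto simp: y S_def s0)
  ultimately show ?thesis by blast
qed

definition Ty :: "'a fls"
  where "Ty = (SOME y. y^2 = cub (c A) (c B) (c C) Tx \<and> y $$ (-3) = 1 \<and> fls_subdegree y = -3)"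

lemma Ty: "Ty^2 = cub (c A) (c B) (c C) Tx" "Ty $$ (-3) = 1" "fls_subdegree Ty = -3"
  using someI_ex[OF Ty_exists] unfolding Ty_def by blast+

lemma Ty_nonzero: "Ty \<noteq> 0"
  using Ty(2) by auto

lemma fls_subdegree_Tx: "fls_subdegree Tx = -2"
  by (simp add: Tx_def)

lemma Tx_nonzero: "Tx \<noteq> 0"
  by (simp add: Tx_def)

lemma Ty_unique: "y^2 = cub (c A) (c B) (c C) Tx \<Longrightarrow> y = Ty \<or> y = - Ty"
  using Ty(1) by (metis power2_eq_iff)

lemma Tx_minus_const: "Tx - c r \<noteq> 0" "fls_subdegree (Tx - c r) = -2"
  using subdegree_add_vge[OF Tx_nonzero, of 0 "- c r"]
  by (auto simp: fls_subdegree_Tx vge_uminus vge_const)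

lemma Ty_minus_const: "Ty - c r \<noteq> 0" "fls_subdegree (Ty - c r) = -3"
  using subdegree_add_vge[OF Ty_nonzero, of 0 "- c r"]
  by (auto simp: Ty(3) vge_uminus vge_const)

text \<open>Slope of the chord from the generic point to (r, s). Since \<open>Tx\<close> is never a
  constant, adding a constant affine point is always the chord case, and \<open>xg P\<close>,
  \<open>yg P\<close> are the coordinates of the generic point plus P, as \<open>generic_add\<close>
  confirms.\<close>

definition lam :: "'a \<Rightarrow> 'a \<Rightarrow> 'a fls"
  where "lam r s = (Ty - c s) / (Tx - c r)"

definition xg :: "'a point \<Rightarrow> 'a fls"
  where "xg P = (case P of Infinity \<Rightarrow> Tx | Affine r s \<Rightarrow> (lam r s)^2 - c A - Tx - c r)"

definition yg :: "'a point \<Rightarrow> 'a fls"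
  where "yg P = (case P of Infinity \<Rightarrow> Ty | Affine r s \<Rightarrow> - (lam r s * (xg P - c r) + c s))"

lemma xg_Infinity [simp]: "xg Infinity = Tx" and yg_Infinity [simp]: "yg Infinity = Ty"
  by (auto simp: xg_def yg_def)

lemma on_curve_generic: "on_curve WL (Affine Tx Ty)"
  by (simp add: Ty(1))

lemma on_curve_const: "on_curve W P \<Longrightarrow> on_curve WL (map_point c P)"
  using c.on_curve_map[of W P] by simp

lemma generic_add: "point_add WL (Affine Tx Ty) (map_point c P) = Affine (xg P) (yg P)"
proof (cases P)
  case (Affine r s)
  have ne: "Tx \<noteq> c r" using Tx_minus_const(1)[of r] by auto
  have l: "(c s - Ty) / (c r - Tx) = lam r s"
    unfolding lam_def by (metis minus_diff_eq minus_divide_divide)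
  have "lam r s * (Tx - c r) = Ty - c s"
    using Tx_minus_const(1)[of r] by (simp add: lam_def)
  then show ?thesis using ne l
    by (simp add: Affine Let_def xg_def yg_def) (simp add: algebra_simps)
qed simp

lemma on_curve_xg_yg: "on_curve W P \<Longrightarrow> on_curve WL (Affine (xg P) (yg P))"
  using cubic_add_closed[OF on_curve_generic on_curve_const] by (metis generic_add)

lemma yg_square: "on_curve W P \<Longrightarrow> (yg P)^2 = cub (c A) (c B) (c C) (xg P)"
  using on_curve_xg_yg by simp

lemma xg_minus:
  assumes "on_curve W (Affine r s)"
  shows "(xg (Affine r s) - c r) * (Tx - c r)^2 =
    c (3 * r^2 + 2 * A * r + B) * (Tx - c r) - 2 * c s * (Ty - c s)"
proof -
  have "(c s)^2 = cub (c A) (c B) (c C) (c r)"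
    using on_curve_const[OF assms] by simp
  moreover have "lam r s * (Tx - c r) = Ty - c s"
    using Tx_minus_const(1)[of r] by (simp add: lam_def)
  ultimately show ?thesis
    using chord_x_diff[of "lam r s" Tx "c r" Ty "c s" "c A" "c B" "c C"] Ty(1)
    by (simp add: xg_def)
qed

lemma yg_minus:
  assumes "on_curve W (Affine r s)"
  shows "(yg (Affine r s) - c s) * (Tx - c r)^3 =
    - (2 * c s * ((Tx - c r)^3 - (Ty - c s)^2)
       + c (3 * r^2 + 2 * A * r + B) * (Ty - c s) * (Tx - c r))"
proof -
  have "lam r s * (Tx - c r) = Ty - c s"
    using Tx_minus_const(1)[of r] by (simp add: lam_def)
  from chord_y_diff[OF this xg_minus[OF assms]] show ?thesis
    by (simp add: yg_def)
qed

text \<open>In \<open>xg_minus\<close> the factor \<open>(Tx - c r)^2\<close> has order -4. For s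
  nonzero the term in \<open>Ty\<close> dominates the other side with order -3; for s = 0 it drops
  out and the derivative of the cubic at r is nonzero, leaving order -2. Hence the double zero at
  points of order two.\<close>

lemma xg_minus_self:
  assumes "on_curve W (Affine r s)"
  shows "xg (Affine r s) - c r \<noteq> 0"
    and "fls_subdegree (xg (Affine r s) - c r) = (if s = 0 then 2 else 1)"
proof -
  define d where "d = 3 * r^2 + 2 * A * r + B"
  define N where "N = c d * (Tx - c r) - 2 * c s * (Ty - c s)"
  have N: "N \<noteq> 0 \<and> fls_subdegree N = (if s = 0 then -2 else -3)"
  proof (cases "s = 0")
    case True
    then have "cub A B C r = 0" using assms by simp
    then have "d \<noteq> 0" unfolding d_def using cubic_squarefree disc_nonzero by blast
    then have "c d \<noteq> 0" by (simp only: fls_const_eq_0_iff not_False_eq_True)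
    then show ?thesis
      using True Tx_minus_const[of r]
      by (simp add: N_def)
  next
    case False
    have a: "- (2 * c s * (Ty - c s)) \<noteq> 0" "fls_subdegree (- (2 * c s * (Ty - c s))) = -3"
      using False Ty_minus_const[of s] by auto
    have "vge (0 + -2) (c d * (Tx - c r))"
      by (intro vge_mult vge_const) (use vge_self[of "Tx - c r"] Tx_minus_const in simp)
    then show ?thesis
      using subdegree_add_vge[OF a(1), of "-2"] a(2) False by (simp add: N_def)
  qed
  have eq: "(xg (Affine r s) - c r) * (Tx - c r)^2 = N"
    unfolding N_def d_def by (rule xg_minus[OF assms])
  then show nz: "xg (Affine r s) - c r \<noteq> 0" using N by auto
  have "fls_subdegree (xg (Affine r s) - c r) + fls_subdegree ((Tx - c r)^2) = fls_subdegree N"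
    using nz Tx_minus_const(1)[of r] by (simp flip: eq)
  then show "fls_subdegree (xg (Affine r s) - c r) = (if s = 0 then 2 else 1)"
    using N by (simp add: fls_subdegree_power Tx_minus_const split: if_splits)
qed

lemma vge_xg_minus_self: "on_curve W (Affine r s) \<Longrightarrow> vge 1 (xg (Affine r s) - c r)"
  using xg_minus_self[of r s] by (simp add: vge_iff_subdegree)

lemma vge_Tx: "vge (-2) Tx" and vge_Ty: "vge (-3) Ty"
  using vge_self[of Tx] vge_self[of Ty] by (auto simp: fls_subdegree_Tx Ty(3))

lemma vge_yg_minus_self:
  assumes "on_curve W (Affine r s)"
  shows "vge 1 (yg (Affine r s) - c s)"
proof -
  let ?d = "3 * r^2 + 2 * A * r + B"
  define M where "M = - c A * (Tx * Tx) - c B * Tx - c C - c (3 * r) * (Tx * Tx)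
    + c (3 * r^2) * Tx - c (r^3) + c (2 * s) * Ty - c (s^2)"
  define N where "N = - (2 * c s * ((Tx - c r)^3 - (Ty - c s)^2)
       + c ?d * (Ty - c s) * (Tx - c r))"
  \<comment> \<open>The curve equation cancels \<open>Ty^2\<close> against \<open>Tx^3\<close>, so
    \<open>M\<close> has a pole of order at most 4 and \<open>N\<close> one of order at most 5,
    while \<open>(Tx - c r)^3\<close> has one of order 6.\<close>
  have "(Tx - c r)^3 - (Ty - c s)^2
      = (Tx - c r)^3 - (cub (c A) (c B) (c C) Tx - 2 * c s * Ty + (c s)^2)"
    unfolding Ty(1)[symmetric] by (simp add: ring_expand)
  also have "\<dots> = M"
    unfolding M_def by (simp add: ring_expand)
  finally have "(Tx - c r)^3 - (Ty - c s)^2 = M" .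
  then have N: "N = - (c (2 * s) * M + c ?d * ((Ty - c s) * (Tx - c r)))"
    by (simp add: N_def)
  have T2: "vge (-4) (Tx * Tx)" using vge_mult[OF vge_Tx vge_Tx] by simp
  have cm: "vge n (c a * f)" if "vge n f" for n a f
    using vge_mult[OF vge_const that] by simp
  have M: "vge (-4) M"
    unfolding M_def mult_minus_left
    by (intro vge_add vge_diff vge_uminus cm T2 vge_mono[OF vge_Tx] vge_mono[OF vge_Ty]
        vge_mono[OF vge_const]) auto
  have "vge (-5) ((Ty - c s) * (Tx - c r))"
    using vge_mult[OF vge_self[of "Ty - c s"] vge_self[of "Tx - c r"]]
    by (simp add: Tx_minus_const Ty_minus_const)
  then have "vge (-5) N"
    unfolding N by (intro vge_uminus vge_add cm vge_mono[OF M]) auto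
  moreover have "yg (Affine r s) - c s = N * inverse ((Tx - c r)^3)"
    using yg_minus[OF assms] Tx_minus_const(1)[of r] by (simp add: N_def field_simps)
  moreover have "vge 6 (inverse ((Tx - c r)^3))"
    using vge_self[of "inverse ((Tx - c r)^3)"] Tx_minus_const(2)[of r]
    by (simp add: fls_subdegree_inverse fls_subdegree_power)
  ultimately show ?thesis
    using vge_mult[of "-5" N 6] by simp
qed

lemma xg_minus_other:
  assumes "on_curve W (Affine r s)" "r' \<noteq> r"
  shows "xg (Affine r s) - c r' \<noteq> 0" "fls_subdegree (xg (Affine r s) - c r') = 0"
proof -
  have "vge 1 ((xg (Affine r s) - c r') - c (r - r'))"
    using vge_xg_minus_self[OF assms(1)] by simp
  from subdegree_zero_of_residue[OF this] assms(2)
  show "xg (Affine r s) - c r' \<noteq> 0" "fls_subdegree (xg (Affine r s) - c r') = 0"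
    by auto
qed

lemma xg_minus_nonzero: "on_curve W P \<Longrightarrow> xg P - c r \<noteq> 0"
proof (cases P)
  case Infinity
  then show ?thesis using Tx_minus_const(1) by simp
next
  case (Affine r' s)
  assume "on_curve W P"
  then show ?thesis
    using xg_minus_self(1)[of r' s] xg_minus_other(1)[of r' s r] Affine by metis
qed

lemma neg_X_Tx [simp]: "fls_neg_X Tx = Tx"
proof -
  have "fls_neg_X fls_X_inv = (- fls_X_inv :: 'a fls)"
    by (simp add: fls_eq_iff fls_neg_X_nth)
  then show ?thesis by (simp add: Tx_def)
qed

lemma neg_X_Ty [simp]: "fls_neg_X Ty = - Ty"
proof -
  have "(fls_neg_X Ty)^2 = fls_neg_X (Ty^2)" by simp
  also have "\<dots> = cub (c A) (c B) (c C) Tx" by (simp add: Ty(1))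
  finally have "fls_neg_X Ty = Ty \<or> fls_neg_X Ty = - Ty" by (rule Ty_unique)
  moreover have "fls_neg_X Ty $$ (-3) \<noteq> Ty $$ (-3)"
    by (simp add: fls_neg_X_nth Ty(2))
  ultimately show ?thesis by metis
qed

lemma neg_X_lam: "fls_neg_X (lam r s) = - lam r (- s)"
  unfolding lam_def by simp (metis minus_add_distrib minus_divide_left diff_conv_add_uminus)

text \<open>The substitution negates the generic point and fixes constants, so it sends the
  translate by P to the negative of the translate by -P.\<close>

lemma neg_X_xg: "fls_neg_X (xg P) = xg (pneg P)"
  by (cases P) (auto simp: xg_def neg_X_lam)

lemma neg_X_yg: "fls_neg_X (yg P) = - yg (pneg P)"
  by (cases P) (auto simp: yg_def neg_X_lam neg_X_xg)

end

section \<open>The function field and its divisors\<close>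

lemma (in field_hom) map_poly_hom_add: "map_poly h (p + q) = map_poly h p + map_poly h q"
  by (rule poly_eqI) (simp add: coeff_map_poly)

lemma (in field_hom) map_poly_hom_mult: "map_poly h (p * q) = map_poly h p * map_poly h q"
  by (rule poly_eqI) (simp add: coeff_map_poly coeff_mult)

text \<open>Reduces statements on polynomials in x to the factors x - r, whose orders at the
  translates are explicit.\<close>

lemma linear_factor_induct [consumes 1, case_names const factor]:
  fixes p :: "'a::alg_closed_field poly"
  assumes "p \<noteq> 0"
    and "\<And>k. k \<noteq> 0 \<Longrightarrow> R [:k:]"
    and "\<And>r q. q \<noteq> 0 \<Longrightarrow> R q \<Longrightarrow> R ([:- r, 1:] * q)"
  shows "R p"
  using assms(1)
proof (induction "degree p" arbitrary: p)
  case 0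
  then obtain k where "p = [:k:]" by (metis degree_eq_zeroE)
  with 0 assms(2) show ?case by auto
next
  case (Suc n)
  then obtain r where "poly p r = 0"
    using alg_closed_imp_poly_has_root[of p] by auto
  then obtain q where q: "p = [:- r, 1:] * q"
    by (metis dvdE poly_eq_0_iff_dvd)
  with Suc.prems have "q \<noteq> 0" by auto
  then have "degree p = Suc (degree q)"
    unfolding q by (subst degree_mult_eq) auto
  then show ?case
    using Suc q \<open>q \<noteq> 0\<close> assms(3) by auto
qed

text \<open>Divisors of degree 0, as integer-valued functions. Finiteness is demanded separately
  because \<open>Sum_any\<close> is 0 by default on infinite support.\<close>

definition balanced :: "('p \<Rightarrow> int) \<Rightarrow> bool"
  where "balanced f \<longleftrightarrow> finite {P. f P \<noteq> 0} \<and> Sum_any f = 0"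

lemma balanced_zero: "balanced (\<lambda>_. 0)"
  by (simp add: balanced_def)

lemma balanced_add:
  assumes "balanced f" "balanced g"
  shows "balanced (\<lambda>P. f P + g P)"
proof -
  have "finite ({P. f P \<noteq> 0} \<union> {P. g P \<noteq> 0})"
    using assms by (simp add: balanced_def)
  then have "finite {P. f P + g P \<noteq> 0}"
    by (rule rev_finite_subset) auto
  moreover have "Sum_any (\<lambda>P. f P + g P) = Sum_any f + Sum_any g"
    using assms by (intro Sum_any.distrib) (auto simp: balanced_def)
  ultimately show ?thesis using assms by (simp add: balanced_def)
qed

lemma balanced_uminus:
  assumes "balanced f"
  shows "balanced (\<lambda>P. - f P)"
  using assms by (simp add: balanced_def Sum_any.expand_set sum_negf)

lemma balanced_diff:
  assumes "balanced f" "balanced g"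
  shows "balanced (\<lambda>P. f P - g P)"
  using balanced_add[OF assms(1) balanced_uminus[OF assms(2)]] by simp

lemma balanced_nonneg_imp_zero:
  assumes "balanced f" "\<And>P. f P \<ge> 0"
  shows "f P = 0"
proof (rule ccontr)
  assume "f P \<noteq> 0"
  then have "(\<Sum>Q | f Q \<noteq> 0. f Q) > 0"
    using assms by (intro sum_pos2[of _ P]) (auto simp: balanced_def order.strict_iff_order)
  then show False using assms(1) by (simp add: balanced_def Sum_any.expand_set)
qed

definition pt :: "'p \<Rightarrow> 'p \<Rightarrow> int"
  where "pt Q P = (if P = Q then 1 else 0)"

lemma pt_self [simp]: "pt P P = 1" and pt_nonneg: "pt Q P \<ge> 0"
  by (auto simp: pt_def)

lemma finite_pt_combination:
  assumes "finite S" "\<And>P. P \<notin> S \<Longrightarrow> f P = (0::int)"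
  shows "finite {P. f P \<noteq> 0}"
  using assms by (metis (mono_tags, lifting) mem_Collect_eq rev_finite_subset subsetI)

lemma Sum_any_pt: "Sum_any (pt Q) = 1" and finite_pt: "finite {P. pt Q P \<noteq> 0}"
proof -
  have "{P. pt Q P \<noteq> 0} = {Q}" by (auto simp: pt_def)
  then show "Sum_any (pt Q) = 1" "finite {P. pt Q P \<noteq> 0}"
    by (simp_all add: Sum_any.expand_set)
qed

lemma balanced_pt_diff: "balanced (\<lambda>P. pt Q P - pt R P)"
proof -
  have "finite {P. - pt R P \<noteq> 0}" using finite_pt[of R] by simp
  then have "Sum_any (\<lambda>P. pt Q P + - pt R P) = Sum_any (pt Q) + Sum_any (\<lambda>P. - pt R P)"
    by (intro Sum_any.distrib finite_pt)
  moreover have "Sum_any (\<lambda>P. - pt R P) = - Sum_any (pt R)"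
    by (simp add: Sum_any.expand_set sum_negf)
  moreover have "finite {P. pt Q P - pt R P \<noteq> 0}"
    by (rule finite_pt_combination[of "{Q, R}"]) (auto simp: pt_def)
  ultimately show ?thesis by (simp add: balanced_def Sum_any_pt)
qed

section \<open>Rational functions on the curve\<close>

context smooth_cubic
begin

definition pev :: "'a poly \<Rightarrow> 'a point \<Rightarrow> 'a fls"
  where "pev a P = poly (map_poly c a) (xg P)"

lemma pev_0 [simp]: "pev 0 P = 0"
  and pev_1 [simp]: "pev 1 P = 1"
  and pev_pCons [simp]: "pev (pCons k a) P = c k + xg P * pev a P"
  by (simp_all add: pev_def map_poly_pCons)

lemma pev_add [simp]: "pev (a + b) P = pev a P + pev b P"
  by (simp add: pev_def c.map_poly_hom_add)

lemma pev_mult [simp]: "pev (a * b) P = pev a P * pev b P"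
  by (simp add: pev_def c.map_poly_hom_mult)

lemma pev_uminus [simp]: "pev (- a) P = - pev a P"
  using pev_add[of a "- a" P] by (simp add: eq_neg_iff_add_eq_0 add.commute)

lemma pev_diff [simp]: "pev (a - b) P = pev a P - pev b P"
  using pev_add[of a "- b" P] by simp

lemma pev_power [simp]: "pev (a ^ n) P = pev a P ^ n"
  by (induction n) auto

lemma pev_nonzero:
  assumes "a \<noteq> 0" "on_curve W P"
  shows "pev a P \<noteq> 0"
  using assms(1)
proof (induction rule: linear_factor_induct)
  case (factor r q)
  then show ?case using xg_minus_nonzero[OF assms(2), of r] by (simp only: pev_mult) simp
qed simp

definition cubp :: "'a poly" where "cubp = [:C, B, A, 1:]"

lemma pev_cubp [simp]: "on_curve W P \<Longrightarrow> pev cubp P = (yg P)^2"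
  by (subst yg_square) (auto simp: cubp_def ring_expand)

text \<open>The norm of a + b y from the function field to the rational functions in x.\<close>

definition nrm :: "'a poly \<Rightarrow> 'a poly \<Rightarrow> 'a poly"
  where "nrm a b = a^2 - b^2 * cubp"

text \<open>\<open>a^2\<close> has even degree and \<open>b^2 * cubp\<close> odd degree, so they
  cannot cancel.\<close>

lemma nrm_nonzero:
  assumes "a \<noteq> 0 \<or> b \<noteq> 0"
  shows "nrm a b \<noteq> 0"
proof
  assume "nrm a b = 0"
  then have eq: "a^2 = b^2 * cubp" by (simp add: nrm_def)
  show False
  proof (cases "b = 0")
    case False
    have nz: "cubp \<noteq> 0" "degree cubp = 3" by (auto simp: cubp_def)
    with False eq have "a \<noteq> 0" by auto
    then have "2 * degree a = degree (a^2)"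
      by (simp add: degree_power_eq)
    also have "\<dots> = 2 * degree b + 3"
      unfolding eq using nz False by (simp add: degree_mult_eq degree_power_eq)
    finally show False by presburger
  qed (use eq assms in auto)
qed

lemma pev_nrm:
  "on_curve W P \<Longrightarrow> pev (nrm a b) P = (pev a P + pev b P * yg P) * (pev a P - pev b P * yg P)"
  by (simp add: nrm_def ring_expand)

text \<open>Rational functions, given by their values at the translates of the generic point; the
  values at arguments off the curve are irrelevant.\<close>

definition FF :: "('a point \<Rightarrow> 'a fls) set"
  where "FF = {\<phi>. \<exists>a b d. d \<noteq> 0 \<and>
    (\<forall>P. on_curve W P \<longrightarrow> \<phi> P = (pev a P + pev b P * yg P) / pev d P)}"

lemma FF_I:
  assumes "d \<noteq> 0" "\<And>P. on_curve W P \<Longrightarrow> \<phi> P * pev d P = pev a P + pev b P * yg P"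
  shows "\<phi> \<in> FF"
proof -
  have "\<phi> P = (pev a P + pev b P * yg P) / pev d P" if "on_curve W P" for P
    using assms(2)[OF that] pev_nonzero[OF assms(1) that] by (simp add: field_simps)
  then show ?thesis using assms(1) unfolding FF_def by blast
qed

lemma FF_E:
  assumes "\<phi> \<in> FF"
  obtains a b d where "d \<noteq> 0" "\<And>P. on_curve W P \<Longrightarrow> pev d P \<noteq> 0"
    "\<And>P. on_curve W P \<Longrightarrow> \<phi> P * pev d P = pev a P + pev b P * yg P"
    "\<And>P. on_curve W P \<Longrightarrow> \<phi> P = (pev a P + pev b P * yg P) / pev d P"
proof -
  obtain a b d where "d \<noteq> 0"
    and *: "\<And>P. on_curve W P \<Longrightarrow> \<phi> P = (pev a P + pev b P * yg P) / pev d P"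
    using assms unfolding FF_def by blast
  moreover have "pev d P \<noteq> 0" if "on_curve W P" for P
    using pev_nonzero[OF \<open>d \<noteq> 0\<close> that] .
  ultimately show thesis using that by simp
qed

lemma FF_cong: "\<phi> \<in> FF \<Longrightarrow> (\<And>P. on_curve W P \<Longrightarrow> \<psi> P = \<phi> P) \<Longrightarrow> \<psi> \<in> FF"
  unfolding FF_def by auto

lemma FF_const: "(\<lambda>_. c k) \<in> FF"
  by (rule FF_I[of 1 _ "[:k:]" 0]) auto

lemma FF_xg: "xg \<in> FF"
  by (rule FF_I[of 1 _ "[:0, 1:]" 0]) auto

lemma FF_yg: "yg \<in> FF"
  by (rule FF_I[of 1 _ 0 1]) auto

lemma FF_add:
  assumes "\<phi> \<in> FF" "\<psi> \<in> FF"
  shows "(\<lambda>P. \<phi> P + \<psi> P) \<in> FF"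
proof -
  obtain a b d where d: "d \<noteq> 0"
    and *: "\<And>P. on_curve W P \<Longrightarrow> \<phi> P * pev d P = pev a P + pev b P * yg P"
    using FF_E[OF assms(1)] by metis
  obtain a' b' d' where d': "d' \<noteq> 0"
    and **: "\<And>P. on_curve W P \<Longrightarrow> \<psi> P * pev d' P = pev a' P + pev b' P * yg P"
    using FF_E[OF assms(2)] by metis
  show ?thesis
  proof (rule FF_I[of "d * d'" _ "a * d' + a' * d" "b * d' + b' * d"])
    fix P assume P: "on_curve W P"
    have "(\<phi> P + \<psi> P) * pev (d * d') P = (\<phi> P * pev d P) * pev d' P + (\<psi> P * pev d' P) * pev d P"
      by (simp add: algebra_simps)
    also have "\<dots> = pev (a * d' + a' * d) P + pev (b * d' + b' * d) P * yg P"
      unfolding *[OF P] **[OF P] by (simp add: algebra_simps)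
    finally show "(\<phi> P + \<psi> P) * pev (d * d') P =
      pev (a * d' + a' * d) P + pev (b * d' + b' * d) P * yg P" .
  qed (use d d' in auto)
qed

lemma FF_mult:
  assumes "\<phi> \<in> FF" "\<psi> \<in> FF"
  shows "(\<lambda>P. \<phi> P * \<psi> P) \<in> FF"
proof -
  obtain a b d where d: "d \<noteq> 0"
    and *: "\<And>P. on_curve W P \<Longrightarrow> \<phi> P * pev d P = pev a P + pev b P * yg P"
    using FF_E[OF assms(1)] by metis
  obtain a' b' d' where d': "d' \<noteq> 0"
    and **: "\<And>P. on_curve W P \<Longrightarrow> \<psi> P * pev d' P = pev a' P + pev b' P * yg P"
    using FF_E[OF assms(2)] by metis
  show ?thesis
  proof (rule FF_I[of "d * d'" _ "a * a' + b * b' * cubp" "a * b' + a' * b"])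
    fix P assume P: "on_curve W P"
    have "\<phi> P * \<psi> P * pev (d * d') P = (\<phi> P * pev d P) * (\<psi> P * pev d' P)"
      by (simp add: algebra_simps)
    also have "\<dots> = pev (a * a' + b * b' * cubp) P + pev (a * b' + a' * b) P * yg P"
      unfolding *[OF P] **[OF P] using P by (simp add: algebra_simps power2_eq_square)
    finally show "\<phi> P * \<psi> P * pev (d * d') P =
      pev (a * a' + b * b' * cubp) P + pev (a * b' + a' * b) P * yg P" .
  qed (use d d' in auto)
qed

text \<open>The values at all P come from a single (a + b y)/d. The norm of a + b y is a polynomial
  in x, which is either the zero polynomial or nonzero at every translate.\<close>

lemma FF_cases:
  assumes "\<phi> \<in> FF"
  shows "(\<forall>P. on_curve W P \<longrightarrow> \<phi> P = 0) \<or> (\<forall>P. on_curve W P \<longrightarrow> \<phi> P \<noteq> 0)"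
proof -
  obtain a b d where
    *: "\<And>P. on_curve W P \<Longrightarrow> pev d P \<noteq> 0"
    "\<And>P. on_curve W P \<Longrightarrow> \<phi> P = (pev a P + pev b P * yg P) / pev d P"
    using FF_E[OF assms] by metis
  show ?thesis
  proof (cases "a = 0 \<and> b = 0")
    case True
    then show ?thesis using * by auto
  next
    case False
    then have "nrm a b \<noteq> 0" using nrm_nonzero by blast
    have "\<phi> P \<noteq> 0" if P: "on_curve W P" for P
      using pev_nonzero[OF \<open>nrm a b \<noteq> 0\<close> P] * P by (auto simp: pev_nrm)
    then show ?thesis by blast
  qed
qed

lemma FF_inverse:
  assumes "\<phi> \<in> FF"
  shows "(\<lambda>P. inverse (\<phi> P)) \<in> FF"
proof -
  obtain a b d where d: "d \<noteq> 0" "\<And>P. on_curve W P \<Longrightarrow> pev d P \<noteq> 0"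
    and *: "\<And>P. on_curve W P \<Longrightarrow> \<phi> P = (pev a P + pev b P * yg P) / pev d P"
    using FF_E[OF assms] by metis
  show ?thesis
  proof (cases "a = 0 \<and> b = 0")
    case True
    then show ?thesis using * by (intro FF_I[of 1 _ 0 0]) auto
  next
    case False
    then have n: "nrm a b \<noteq> 0" using nrm_nonzero by blast
    show ?thesis
    \<comment> \<open>Rationalized denominator: the inverse of (a + b y)/d is d (a - b y) over the
      norm.\<close>
    proof (rule FF_I[OF n, of _ "d * a" "- (d * b)"])
      fix P assume P: "on_curve W P"
      define u v where "u = pev a P + pev b P * yg P" and "v = pev a P - pev b P * yg P"
      have "u \<noteq> 0" "pev (nrm a b) P = u * v"
        using pev_nonzero[OF n P] P by (auto simp: pev_nrm u_def v_def)
      then have "inverse (\<phi> P) * pev (nrm a b) P = pev d P * v"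
        using *[OF P] d(2)[OF P] by (simp flip: u_def)
      then show "inverse (\<phi> P) * pev (nrm a b) P = pev (d * a) P + pev (- (d * b)) P * yg P"
        by (simp add: v_def algebra_simps)
    qed
  qed
qed

lemma FF_uminus: "\<phi> \<in> FF \<Longrightarrow> (\<lambda>P. - \<phi> P) \<in> FF"
  using FF_mult[OF FF_const[of "-1"]] by simp

lemma FF_diff: "\<phi> \<in> FF \<Longrightarrow> \<psi> \<in> FF \<Longrightarrow> (\<lambda>P. \<phi> P - \<psi> P) \<in> FF"
  using FF_add[OF _ FF_uminus] by simp

lemma FF_divide: "\<phi> \<in> FF \<Longrightarrow> \<psi> \<in> FF \<Longrightarrow> (\<lambda>P. \<phi> P / \<psi> P) \<in> FF"
  using FF_mult[OF _ FF_inverse] by (simp add: divide_inverse)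

lemma FF_power: "\<phi> \<in> FF \<Longrightarrow> (\<lambda>P. \<phi> P ^ n) \<in> FF"
  using FF_const[of 1] by (induction n) (auto intro: FF_mult)

section \<open>Nonzero functions, their orders and the degree of principal divisors\<close>

definition FFx :: "('a point \<Rightarrow> 'a fls) set"
  where "FFx = {\<phi> \<in> FF. \<forall>P. on_curve W P \<longrightarrow> \<phi> P \<noteq> 0}"

lemma FFx_FF: "\<phi> \<in> FFx \<Longrightarrow> \<phi> \<in> FF"
  and FFx_nonzero: "\<phi> \<in> FFx \<Longrightarrow> on_curve W P \<Longrightarrow> \<phi> P \<noteq> 0"
  by (auto simp: FFx_def)

lemma FFx_I: "\<phi> \<in> FF \<Longrightarrow> on_curve W P \<Longrightarrow> \<phi> P \<noteq> 0 \<Longrightarrow> \<phi> \<in> FFx"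
  using FF_cases[of \<phi>] by (auto simp: FFx_def)

lemma FFx_mult: "\<phi> \<in> FFx \<Longrightarrow> \<psi> \<in> FFx \<Longrightarrow> (\<lambda>P. \<phi> P * \<psi> P) \<in> FFx"
  and FFx_divide: "\<phi> \<in> FFx \<Longrightarrow> \<psi> \<in> FFx \<Longrightarrow> (\<lambda>P. \<phi> P / \<psi> P) \<in> FFx"
  and FFx_const: "k \<noteq> 0 \<Longrightarrow> (\<lambda>_. c k) \<in> FFx"
  by (auto simp: FFx_def FF_mult FF_divide FF_const)

text \<open>The value 0 off the curve makes a sum over all of \<open>'a point\<close> a sum over the
  curve.\<close>

definition ord :: "('a point \<Rightarrow> 'a fls) \<Rightarrow> 'a point \<Rightarrow> int"
  where "ord \<phi> P = (if on_curve W P then fls_subdegree (\<phi> P) else 0)"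

lemma ord_mult: "\<phi> \<in> FFx \<Longrightarrow> \<psi> \<in> FFx \<Longrightarrow> ord (\<lambda>P. \<phi> P * \<psi> P) P = ord \<phi> P + ord \<psi> P"
  by (simp add: ord_def FFx_nonzero)

lemma ord_divide: "\<phi> \<in> FFx \<Longrightarrow> \<psi> \<in> FFx \<Longrightarrow> ord (\<lambda>P. \<phi> P / \<psi> P) P = ord \<phi> P - ord \<psi> P"
  by (simp add: ord_def FFx_nonzero fls_subdegree_divide)

lemma ord_const [simp]: "ord (\<lambda>_. c k) P = 0"
  by (simp add: ord_def)

lemma on_curve_root_exists: "\<exists>s. on_curve W (Affine r s)"
proof -
  obtain s where "s ^ 2 = cub A B C r"
    using nth_root_exists[of 2 "cub A B C r"] by auto
  then show ?thesis by auto
qed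

lemma ord_xg_minus:
  assumes "on_curve W (Affine r s)"
  shows "ord (\<lambda>P. xg P - c r) P =
    pt (Affine r s) P + pt (pneg (Affine r s)) P - 2 * pt Infinity P"
proof (cases P)
  case Infinity
  then show ?thesis by (simp add: ord_def pt_def Tx_minus_const)
next
  case P: (Affine r' s')
  show ?thesis
  proof (cases "on_curve W P")
    case True
    show ?thesis
    proof (cases "r' = r")
      case False
      then show ?thesis
        using True P xg_minus_other[of r' s' r] by (simp add: ord_def pt_def)
    next
      case eq: True
      have "s'^2 = s^2" using True assms by (simp add: P eq)
      then have "s' = s \<or> s' = - s" by (simp add: power2_eq_iff)
      moreover have "ord (\<lambda>P. xg P - c r) P = (if s' = 0 then 2 else 1)"
        using True xg_minus_self(2)[of r' s'] by (simp add: ord_def P eq)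
      \<comment> \<open>For ordinate 0 the point is its own negative, and the two point terms add up
        to the double zero.\<close>
      ultimately show ?thesis
        by (auto simp: P eq pt_def)
    qed
  next
    case False
    then have "pt (Affine r s) P = 0" "pt (pneg (Affine r s)) P = 0" "pt Infinity P = 0"
      using assms unfolding pt_def by (auto simp: P)
    then show ?thesis using False by (simp add: ord_def)
  qed
qed

lemma FFx_xg_minus: "(\<lambda>P. xg P - c r) \<in> FFx"
  using xg_minus_nonzero FF_diff[OF FF_xg FF_const[of r]] by (auto simp: FFx_def)

lemma FF_pev: "pev a \<in> FF"
  by (rule FF_I[of 1 _ a 0]) auto

lemma FFx_pev: "a \<noteq> 0 \<Longrightarrow> pev a \<in> FFx"
  using FF_pev pev_nonzero by (auto simp: FFx_def)

lemma balanced_ord_xg_minus: "balanced (ord (\<lambda>P. xg P - c r))"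
proof -
  obtain s where s: "on_curve W (Affine r s)" using on_curve_root_exists by blast
  have "balanced (\<lambda>P. (pt (Affine r s) P - pt Infinity P)
      + (pt (pneg (Affine r s)) P - pt Infinity P))"
    by (intro balanced_add balanced_pt_diff)
  moreover have "ord (\<lambda>P. xg P - c r) = (\<lambda>P. (pt (Affine r s) P - pt Infinity P)
      + (pt (pneg (Affine r s)) P - pt Infinity P))"
    by (rule ext) (simp only: ord_xg_minus[OF s])
  ultimately show ?thesis by simp
qed

lemma balanced_ord_pev:
  assumes "a \<noteq> 0"
  shows "balanced (ord (pev a))"
  using assms
proof (induction rule: linear_factor_induct)
  case (const k)
  have "ord (pev [:k:]) = (\<lambda>_. 0)" by (rule ext) (simp add: ord_def)
  then show ?case by (simp add: balanced_zero)
next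
  case (factor r q)
  have "ord (pev ([:- r, 1:] * q)) P = ord (\<lambda>P. xg P - c r) P + ord (pev q) P" for P
  proof -
    have "pev ([:- r, 1:] * q) = (\<lambda>P. (xg P - c r) * pev q P)"
      by (rule ext) (simp only: pev_mult, simp)
    then show ?thesis using ord_mult[OF FFx_xg_minus FFx_pev[OF factor(1)]] by simp
  qed
  then have "ord (pev ([:- r, 1:] * q)) = (\<lambda>P. ord (\<lambda>P. xg P - c r) P + ord (pev q) P)"
    by (rule ext)
  then show ?case
    using balanced_add[OF balanced_ord_xg_minus factor(2)] by (simp only:)
qed

lemma vge_xg: "on_curve W (Affine r s) \<Longrightarrow> vge 0 (xg (Affine r s))"
  using vge_add[OF vge_mono[OF vge_xg_minus_self, of r s 0] vge_const[of r]] by simp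

lemma vge_yg: "on_curve W (Affine r s) \<Longrightarrow> vge 0 (yg (Affine r s))"
  using vge_add[OF vge_mono[OF vge_yg_minus_self, of r s 0] vge_const[of s]] by simp

lemma vge_pev: "on_curve W (Affine r s) \<Longrightarrow> vge 0 (pev a (Affine r s))"
proof (induction a)
  case (pCons k a)
  then show ?case
    using vge_add[OF vge_const vge_mult[OF vge_xg, where m = 0, simplified]] by simp
qed (simp add: vge_def)

lemma neg_X_pev: "fls_neg_X (pev a P) = pev a (pneg P)"
  by (induction a) (auto simp: neg_X_xg)

lemma Sum_any_pneg: "Sum_any (\<lambda>P. f (pneg P)) = Sum_any f"
  by (rule Sum_any.reindex_cong[symmetric, of pneg])
     (auto simp: bij_def inj_def surj_def intro: exI[of _ "pneg _"])

text \<open>The second factor of the norm is the value of a + b y at -P after t -> -t, so the orders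
  at P and -P add up to the order of a polynomial in x, whose divisor has degree 0. Summing over P
  counts the degree of a + b y twice.\<close>

lemma balanced_ord_pev_add:
  assumes "a \<noteq> 0 \<or> b \<noteq> 0"
  shows "(\<lambda>P. pev a P + pev b P * yg P) \<in> FFx" "balanced (ord (\<lambda>P. pev a P + pev b P * yg P))"
proof -
  define u where "u = (\<lambda>P. pev a P + pev b P * yg P)"
  have n: "nrm a b \<noteq> 0" using assms nrm_nonzero by blast
  have u': "fls_neg_X (u (pneg P)) = pev a P - pev b P * yg P" for P
    by (simp add: u_def neg_X_pev neg_X_yg)
  have N: "pev (nrm a b) P = u P * fls_neg_X (u (pneg P))" if "on_curve W P" for P
    unfolding u' using that by (simp add: pev_nrm u_def)
  have nz: "u P \<noteq> 0" if "on_curve W P" for P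
    using N[OF that] pev_nonzero[OF n that] by auto
  moreover have "u \<in> FF"
    by (rule FF_I[of 1 _ a b]) (auto simp: u_def)
  ultimately have FFx: "u \<in> FFx" by (simp add: FFx_def)
  have sum: "ord u P + ord u (pneg P) = ord (pev (nrm a b)) P" for P
    using nz nz[of "pneg P"] by (simp add: ord_def N)
  have bal: "balanced (ord (pev (nrm a b)))" by (rule balanced_ord_pev[OF n])
  have nonneg: "ord u P \<ge> 0" if "P \<noteq> Infinity" for P
  proof (cases P)
    case (Affine r s)
    have "vge 0 (u P)" if "on_curve W P"
      using vge_add[OF vge_pev vge_mult[OF vge_pev vge_yg, of r s r s, simplified]] that
      by (simp add: u_def Affine)
    then show ?thesis using nz[of P] by (auto simp: ord_def vge_iff_subdegree)
  qed (use that in simp)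
  \<comment> \<open>Off \<open>Infinity\<close> both orders are nonnegative, so they vanish where
    their sum does.\<close>
  have "ord u P = 0" if "P \<notin> insert Infinity {P. ord (pev (nrm a b)) P \<noteq> 0}" for P
    using sum[of P] nonneg[of P] nonneg[of "pneg P"] that by auto
  then have fin: "finite {P. ord u P \<noteq> 0}"
    using bal
    by (intro finite_pt_combination[of "insert Infinity {P. ord (pev (nrm a b)) P \<noteq> 0}"])
       (auto simp: balanced_def)
  have fin': "finite {P. ord u (pneg P) \<noteq> 0}"
  proof -
    have "{P. ord u (pneg P) \<noteq> 0} = pneg ` {P. ord u P \<noteq> 0}"
      by (auto simp: image_iff) (metis pneg_pneg)
    then show ?thesis using fin by simp
  qed
  have "Sum_any (ord u) + Sum_any (\<lambda>P. ord u (pneg P)) = Sum_any (ord (pev (nrm a b)))"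
    using Sum_any.distrib[OF fin fin'] sum by simp
  then have "Sum_any (ord u) = 0"
    using bal by (simp add: Sum_any_pneg balanced_def)
  then show "(\<lambda>P. pev a P + pev b P * yg P) \<in> FFx"
    "balanced (ord (\<lambda>P. pev a P + pev b P * yg P))"
    using FFx fin by (simp_all add: balanced_def u_def)
qed

lemma ord_cong: "(\<And>P. on_curve W P \<Longrightarrow> \<phi> P = \<psi> P) \<Longrightarrow> ord \<phi> = ord \<psi>"
  by (rule ext) (simp add: ord_def)

theorem balanced_ord:
  assumes "\<phi> \<in> FFx"
  shows "balanced (ord \<phi>)"
proof -
  obtain a b d where d: "d \<noteq> 0"
    and *: "\<And>P. on_curve W P \<Longrightarrow> \<phi> P = (pev a P + pev b P * yg P) / pev d P"
    using FF_E[OF FFx_FF[OF assms]] by metis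
  have "a \<noteq> 0 \<or> b \<noteq> 0"
    using FFx_nonzero[OF assms, of Infinity] *[of Infinity] by auto
  note u = balanced_ord_pev_add[OF this]
  have "ord \<phi> = ord (\<lambda>P. (pev a P + pev b P * yg P) / pev d P)"
    by (rule ord_cong) (rule *)
  also have "\<dots> = (\<lambda>P. ord (\<lambda>P. pev a P + pev b P * yg P) P - ord (pev d) P)"
    by (rule ext) (rule ord_divide[OF u(1) FFx_pev[OF d]])
  finally show ?thesis
    using balanced_diff[OF u(2) balanced_ord_pev[OF d]] by simp
qed

text \<open>Subtracting the value at O leaves a function without poles. If it were nonzero, degree 0
  would forbid zeros, yet it vanishes at O.\<close>

lemma ord_zero_imp_const:
  assumes "\<phi> \<in> FFx" "\<And>P. ord \<phi> P = 0"
  shows "\<exists>k. k \<noteq> 0 \<and> (\<forall>P. on_curve W P \<longrightarrow> \<phi> P = c k)"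
proof -
  define k where "k = \<phi> Infinity $$ 0"
  define \<psi> where "\<psi> = (\<lambda>P. \<phi> P - c k)"
  have \<psi>: "\<psi> \<in> FF" unfolding \<psi>_def by (intro FF_diff FFx_FF assms FF_const)
  have "\<not> \<psi> \<in> FFx"
  proof
    assume x: "\<psi> \<in> FFx"
    have "vge 0 (\<psi> P)" if "on_curve W P" for P
      unfolding \<psi>_def using assms(2)[of P] that
      by (intro vge_diff vge_const) (auto simp: ord_def vge_iff_subdegree)
    then have "ord \<psi> P \<ge> 0" for P
      using FFx_nonzero[OF x] by (auto simp: ord_def vge_iff_subdegree)
    then have "ord \<psi> Infinity = 0"
      by (rule balanced_nonneg_imp_zero[OF balanced_ord[OF x]])
    then have "\<psi> Infinity $$ 0 \<noteq> 0"
      using FFx_nonzero[OF x, of Infinity] nth_fls_subdegree_nonzero[of "\<psi> Infinity"]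
      by (simp add: ord_def)
    then show False by (simp add: \<psi>_def k_def)
  qed
  then have "\<phi> P = c k" if "on_curve W P" for P
    using FF_cases[OF \<psi>] \<psi> that by (auto simp: FFx_def \<psi>_def)
  moreover from this[of Infinity] have "k \<noteq> 0"
    using FFx_nonzero[OF assms(1), of Infinity] by auto
  ultimately show ?thesis by blast
qed

text \<open>The function is the line through both points divided by the vertical line through the
  third intersection point R, the negative of the sum. The norm of the line is \<open>- D\<close>,
  which vanishes at the three points and their negatives; lying on the line decides which of P and
  -P carries the zero.\<close>

lemma divisor_add_exists_chord:
  assumes S: "on_curve W (Affine x1 y1)" and T: "on_curve W (Affine x2 y2)"
    and ne: "Affine x2 y2 \<noteq> pneg (Affine x1 y1)"
  shows "\<exists>m \<in> FFx. \<forall>P. ord m P = pt (Affine x1 y1) P + pt (Affine x2 y2) P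
    - pt (Affine x1 y1 +\<^sub>E Affine x2 y2) P - pt Infinity P"
proof -
  obtain l where
    add: "Affine x1 y1 +\<^sub>E Affine x2 y2 =
       Affine (l^2 - A - x1 - x2) (- (l * ((l^2 - A - x1 - x2) - x1) + y1))"
    and y2: "y2 = l * (x2 - x1) + y1"
    and id: "\<And>x. cub A B C x - (l * (x - x1) + y1)^2 = (x - x1) * (x - x2) * (x - (l^2 - A - x1 - x2))"
    using chord_cases[OF S T ne] by metis
  define x3 where "x3 = l^2 - A - x1 - x2"
  define y3 where "y3 = l * (x3 - x1) + y1"
  define k where "k = 3 * x1^2 + 2 * A * x1 + B - 2 * y1 * l - (x2 - x1) * (x3 - x1)"
  have c1: "cub A B C x1 - y1^2 = 0" using S by simp
  \<comment> \<open>By \<open>id\<close> the linear correction term vanishes at every x; at x1 + 1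
    it equals k.\<close>
  have k0: "k = 0"
    using cub_minus_line[of "x1 + 1" A B C l x1 y1 x2]
    unfolding id c1 k_def[unfolded x3_def, symmetric] by simp
  define R where "R = Affine x3 y3"
  have R: "Affine x1 y1 +\<^sub>E Affine x2 y2 = pneg R"
    by (simp only: add R_def y3_def x3_def pneg.simps)
  have onR: "on_curve W R"
    using cubic_add_closed[OF S T] unfolding R by simp
  define lin where "lin = (\<lambda>P. c l * (xg P - c x1) + c y1)"
  define f where "f = (\<lambda>P. yg P - lin P)"
  define D where "D = (\<lambda>P. (xg P - c x1) * (xg P - c x2) * (xg P - c x3))"
  have "c k = 0" "c (cub A B C x1 - y1^2) = 0"
    unfolding k0 c1 by simp_all
  then have nf: "(yg P)^2 - (lin P)^2 = D P" if "on_curve W P" for P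
    using cub_minus_line[of "xg P" "c A" "c B" "c C" "c l" "c x1" "c y1" "c x2"] yg_square[OF that]
    by (simp add: k_def x3_def lin_def D_def)
  have neg_f: "fls_neg_X (f (pneg P)) = - (yg P + lin P)" for P
    by (simp add: f_def lin_def neg_X_xg neg_X_yg)
  have prod: "f P * fls_neg_X (f (pneg P)) = - D P" if "on_curve W P" for P
    unfolding neg_f nf[OF that, symmetric] by (simp add: f_def ring_expand)
  have D: "D \<in> FFx" unfolding D_def by (intro FFx_mult FFx_xg_minus)
  have ordD: "ord D P = pt (Affine x1 y1) P + pt (pneg (Affine x1 y1)) P
     + (pt (Affine x2 y2) P + pt (pneg (Affine x2 y2)) P) + (pt R P + pt (pneg R) P)
     - 6 * pt Infinity P" for P
    unfolding D_def using ord_xg_minus[OF S] ord_xg_minus[OF T] ord_xg_minus[OF onR[unfolded R_def]]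
    by (simp add: ord_mult FFx_mult FFx_xg_minus R_def)
  have fFF: "f \<in> FF"
    unfolding f_def lin_def by (intro FF_diff FF_add FF_mult FF_const FF_xg FF_yg)
  have f: "f \<in> FFx"
    using prod[of Infinity] FFx_nonzero[OF D, of Infinity] by (intro FFx_I[OF fFF, of Infinity]) auto
  have sum: "ord f P + ord f (pneg P) = ord D P" for P
    using FFx_nonzero[OF f, of P] FFx_nonzero[OF f, of "pneg P"] prod[of P]
    by (auto simp: ord_def simp flip: fls_subdegree_mult)
       (metis fls_neg_X.hom_eq_zero_iff fls_subdegree_mult fls_subdegree_neg_X fls_uminus_subdegree)
  \<comment> \<open>At an affine point off the line, the function reduces to a nonzero constant
    modulo t.\<close>
  have res: "ord f (Affine r s) = 0" if "on_curve W (Affine r s)" "s \<noteq> l * (r - x1) + y1" for r s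
  proof -
    have "vge 1 ((yg (Affine r s) - c s) - c l * (xg (Affine r s) - c r))"
      using vge_mult[OF vge_const vge_xg_minus_self[OF that(1)], of l]
      by (intro vge_diff vge_yg_minus_self that) simp
    also have "(yg (Affine r s) - c s) - c l * (xg (Affine r s) - c r) =
      f (Affine r s) - c (s - (l * (r - x1) + y1))"
      by (simp add: f_def lin_def algebra_simps)
    finally show ?thesis
      using subdegree_zero_of_residue(2)[of "f (Affine r s)" "s - (l * (r - x1) + y1)"] that
      by (simp add: ord_def)
  qed
  have ordf: "ord f P = pt (Affine x1 y1) P + pt (Affine x2 y2) P + pt R P - 3 * pt Infinity P" for P
  proof (cases "on_curve W P")
    case False
    then have "P \<noteq> Affine x1 y1" "P \<noteq> Affine x2 y2" "P \<noteq> R" "P \<noteq> Infinity"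
      using S T onR by auto
    with False show ?thesis by (simp add: ord_def pt_def)
  next
    case on: True
    show ?thesis
    proof (cases P)
      case Infinity
      then show ?thesis
        using sum[of P] ordD[of P] by (simp add: pt_def R_def)
    next
      case P: (Affine r s)
      show ?thesis
      proof (cases "s = l * (r - x1) + y1")
        case False
        then have "P \<noteq> Affine x1 y1" "P \<noteq> Affine x2 y2" "P \<noteq> R"
          using y2 by (auto simp: P R_def y3_def)
        then show ?thesis using res[of r s] on False by (simp add: pt_def P)
      next
        case line: True
        show ?thesis
        \<comment> \<open>For s = 0 the point is its own negative and gets half the order of
          \<open>D\<close>. For s nonzero its negative lies off the line and contributes 0, so the
          point gets the whole order of \<open>D\<close>.\<close>
        proof (cases "s = 0")
          case True
          then have "pneg P = P" by (simp add: P)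
          then have "pt (pneg Q) P = pt Q P" for Q
            unfolding pt_def by (metis pneg_pneg)
          then show ?thesis
            using sum[of P] ordD[of P] \<open>pneg P = P\<close> by (simp add: pt_def P)
        next
          case False
          then have neq: "- s \<noteq> l * (r - x1) + y1"
            using line[symmetric] by simp
          then have "pneg P \<noteq> Affine x1 y1" "pneg P \<noteq> Affine x2 y2" "pneg P \<noteq> R"
            using y2 by (auto simp: P R_def y3_def)
          then have "P \<noteq> pneg (Affine x1 y1)" "P \<noteq> pneg (Affine x2 y2)" "P \<noteq> pneg R"
            by (metis pneg_pneg)+
          moreover have "ord f (pneg P) = 0"
            using res[of r "- s"] neq on by (simp add: P)
          ultimately show ?thesis
            using sum[of P] ordD[of P] by (simp add: pt_def P)
        qed
      qed
    qed
  qed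
  define m where "m = (\<lambda>P. f P / (xg P - c x3))"
  have "m \<in> FFx" unfolding m_def by (intro FFx_divide f FFx_xg_minus)
  moreover have "ord m P = pt (Affine x1 y1) P + pt (Affine x2 y2) P
    - pt (Affine x1 y1 +\<^sub>E Affine x2 y2) P - pt Infinity P" for P
    unfolding m_def R using ordf[of P] ord_xg_minus[OF onR[unfolded R_def], of P]
    by (simp add: ord_divide[OF f FFx_xg_minus] R_def)
  ultimately show ?thesis by blast
qed

lemma divisor_add_exists:
  assumes "on_curve W S" "on_curve W T"
  obtains m where "m \<in> FFx"
    "\<And>P. ord m P = pt S P + pt T P - pt (S +\<^sub>E T) P - pt Infinity P"
proof (cases "S = Infinity \<or> T = Infinity")
  case True
  then show thesis
    by (intro that[OF FFx_const[of 1]]) (auto simp: ord_def)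
next
  case False
  then obtain x1 y1 x2 y2 where ST: "S = Affine x1 y1" "T = Affine x2 y2"
    by (metis point.exhaust)
  show thesis
  proof (cases "T = pneg S")
    case True
    show thesis
    proof (rule that[OF FFx_xg_minus[of x1]])
      show "ord (\<lambda>P. xg P - c x1) P = pt S P + pt T P - pt (S +\<^sub>E T) P - pt Infinity P" for P
        using ord_xg_minus[of x1 y1 P] assms(1) unfolding True cubic_add_pneg ST(1) by simp
    qed
  next
    case False
    then show thesis
      using divisor_add_exists_chord[of x1 y1 x2 y2] assms that unfolding ST by blast
  qed
qed

end

section \<open>Associativity and translations\<close>

context smooth_cubic
begin

text \<open>Composition with negation on the curve: the negative of the translate by P is the
  translate by -P after t -> -t.\<close>

definition conj :: "('a point \<Rightarrow> 'a fls) \<Rightarrow> 'a point \<Rightarrow> 'a fls"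
  where "conj \<phi> P = fls_neg_X (\<phi> (pneg P))"

lemma FF_conj:
  assumes "\<phi> \<in> FF"
  shows "conj \<phi> \<in> FF"
proof -
  obtain a b d where d: "d \<noteq> 0"
    and *: "\<And>P. on_curve W P \<Longrightarrow> \<phi> P * pev d P = pev a P + pev b P * yg P"
    using FF_E[OF assms] by metis
  show ?thesis
  proof (rule FF_I[OF d, of _ a "- b"])
    fix P assume "on_curve W P"
    then have "fls_neg_X (\<phi> (pneg P) * pev d (pneg P)) =
      fls_neg_X (pev a (pneg P) + pev b (pneg P) * yg (pneg P))"
      using *[of "pneg P"] by simp
    then show "conj \<phi> P * pev d P = pev a P + pev (- b) P * yg P"
      by (simp add: conj_def neg_X_pev neg_X_yg)
  qed
qed

lemma ord_conj: "ord (conj \<phi>) P = ord \<phi> (pneg P)"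
  by (simp add: ord_def conj_def)

lemma two_torsion_exists:
  obtains r1 r2 where "r1 \<noteq> r2" "on_curve W (Affine r1 0)" "on_curve W (Affine r2 0)"
proof -
  have "degree cubp = 3" "cubp \<noteq> 0" by (auto simp: cubp_def)
  then obtain r1 where r1: "poly cubp r1 = 0"
    using alg_closed_imp_poly_has_root[of cubp] by auto
  then obtain q where q: "cubp = [:- r1, 1:] * q"
    by (metis dvdE poly_eq_0_iff_dvd)
  with \<open>cubp \<noteq> 0\<close> have "q \<noteq> 0" by auto
  then have "degree cubp = Suc (degree q)"
    unfolding q by (subst degree_mult_eq) auto
  with \<open>degree cubp = 3\<close> obtain r2 where r2: "poly q r2 = 0"
    using alg_closed_imp_poly_has_root[of q] by auto
  have cub: "poly cubp r = cub A B C r" for r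
    by (simp add: cubp_def ring_expand)
  have "poly (pderiv cubp) r1 = 3 * r1^2 + 2 * A * r1 + B"
    by (simp add: cubp_def pderiv_pCons ring_expand)
  moreover have "3 * r1^2 + 2 * A * r1 + B \<noteq> 0"
    using cubic_squarefree[OF disc_nonzero, of r1] r1 cub by metis
  \<comment> \<open>With \<open>cubp\<close> = (x - r1) q the derivative at r1 is q(r1), nonzero
    because r1 is a simple root; r2 is a root of q.\<close>
  moreover have "poly (pderiv cubp) r1 = poly q r1"
    unfolding q pderiv_mult by (simp add: pderiv_pCons)
  ultimately have "r1 \<noteq> r2" using r2 by auto
  moreover have "cub A B C r1 = 0" "cub A B C r2 = 0"
    using r1 r2 q cub by (metis, metis mult_zero_right poly_mult)
  ultimately show thesis using that by simp
qed

text \<open>The function \<open>\<psi>\<close> with divisor \<open>(S) + (- T) - 2(O)\<close> is even: its odd part \<open>\<omega>\<close> has odd order at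
  every point \<open>P = - P\<close>, so it would have more zeros than poles.\<close>

lemma ord_pt_diff_imp_eq:
  assumes S: "on_curve W S" and T: "on_curve W T" and \<phi>: "\<phi> \<in> FFx"
    and ord: "\<And>P. ord \<phi> P = pt S P - pt T P"
  shows "S = T"
proof -
  obtain m where m: "m \<in> FFx"
    "\<And>P. ord m P = pt T P + pt (pneg T) P - pt (T +\<^sub>E pneg T) P - pt Infinity P"
    using divisor_add_exists[of T "pneg T"] T by auto
  define \<psi> where "\<psi> = (\<lambda>P. \<phi> P * m P)"
  have \<psi>: "\<psi> \<in> FFx" unfolding \<psi>_def by (intro FFx_mult \<phi> m)
  have ord\<psi>: "ord \<psi> P = pt S P + pt (pneg T) P - 2 * pt Infinity P" for P
    unfolding \<psi>_def using ord_mult[OF \<phi> m(1)] ord m(2) by (simp add: cubic_add_pneg)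
  define \<omega> where "\<omega> = (\<lambda>P. \<psi> P - conj \<psi> P)"
  have \<omega>: "\<omega> \<in> FF" unfolding \<omega>_def by (intro FF_diff FF_conj FFx_FF \<psi>)
  have "\<omega> \<notin> FFx"
  proof
    assume x: "\<omega> \<in> FFx"
    have odd: "odd (ord \<omega> P)" if "on_curve W P" "pneg P = P" for P
    proof -
      have "fls_neg_X (\<omega> P) = - \<omega> P" by (simp add: \<omega>_def conj_def that)
      then show ?thesis
        using fls_neg_X_negated_imp_odd[of "\<omega> P"] FFx_nonzero[OF x that(1)] that(1)
        by (simp add: ord_def)
    qed
    have ge: "ord \<omega> P \<ge> - 2 * pt Infinity P" for P
    proof (cases "on_curve W P")
      case True
      have "vge (- 2 * pt Infinity P) (\<psi> P)"
        using ord\<psi>[of P] True pt_nonneg[of S P] pt_nonneg[of "pneg T" P]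
        by (auto simp: vge_iff_subdegree ord_def)
      moreover have "ord (conj \<psi>) P \<ge> - 2 * pt Infinity P"
        unfolding ord_conj ord\<psi> using pt_nonneg[of S "pneg P"] pt_nonneg[of "pneg T" "pneg P"]
        by (auto simp: pt_def)
      then have "vge (- 2 * pt Infinity P) (conj \<psi> P)"
        using True by (auto simp: vge_iff_subdegree ord_def)
      ultimately have "vge (- 2 * pt Infinity P) (\<omega> P)"
        unfolding \<omega>_def by (rule vge_diff)
      then show ?thesis
        using FFx_nonzero[OF x True] True by (simp add: vge_iff_subdegree ord_def)
    next
      case False
      then show ?thesis by (simp add: ord_def pt_nonneg)
    qed
    obtain r1 r2 where r: "r1 \<noteq> r2" "on_curve W (Affine r1 0)" "on_curve W (Affine r2 0)"
      by (rule two_torsion_exists)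
    let ?Q1 = "Affine r1 0" and ?Q2 = "Affine r2 0"
    have Q: "ord \<omega> Q \<ge> 1" if "on_curve W Q" "pneg Q = Q" "Q \<noteq> Infinity" for Q
      using odd[OF that(1,2)] ge[of Q] that(3) by (cases "ord \<omega> Q = 0") (auto simp: pt_def)
    have "ord \<omega> Infinity \<noteq> -2" using odd[of Infinity] by auto
    then have O: "ord \<omega> Infinity \<ge> -1" using ge[of Infinity] by simp
    \<comment> \<open>Zeros at \<open>?Q1\<close> and \<open>?Q2\<close> stand against at most a
      simple pole at O: removing (Q1) - (O) leaves a nonnegative divisor of degree 0 that is still
      positive at \<open>?Q2\<close>.\<close>
    define g where "g = (\<lambda>P. ord \<omega> P - (pt ?Q1 P - pt Infinity P))"
    have "balanced g"
      unfolding g_def by (intro balanced_diff balanced_ord x balanced_pt_diff)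
    moreover have "g P \<ge> 0" for P
      using ge[of P] O Q[OF r(2)] by (auto simp: g_def pt_def split: if_splits)
    ultimately have "g ?Q2 = 0" by (rule balanced_nonneg_imp_zero)
    then show False using Q[OF r(3)] r(1) by (simp add: g_def pt_def)
  qed
  then have even: "\<psi> P = fls_neg_X (\<psi> (pneg P))" if "on_curve W P" for P
    using FF_cases[OF \<omega>] \<omega> that by (auto simp: FFx_def \<omega>_def conj_def)
  have ord_neg: "ord \<psi> (pneg P) = ord \<psi> P" if "on_curve W P" for P
    using even[OF that] that by (simp add: ord_def)
  have ord_even: "even (ord \<psi> P)" if "on_curve W P" "pneg P = P" for P
    using even[OF that(1)] that fls_neg_X_fixed_imp_even[of "\<psi> P"] FFx_nonzero[OF \<psi> that(1)]
    by (simp add: ord_def)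
  show ?thesis
  proof (cases "S = Infinity \<or> T = Infinity")
    case True
    then show ?thesis
      using ord_even[of Infinity] by (auto simp: ord\<psi> pt_def split: if_splits)
  next
    case False
    \<comment> \<open>The divisor (S) + (-T) - 2(O) is invariant under negation and even at fixed
      points. If S = -S, evenness at S forces -T = S; otherwise -S must occur as well, which is
      possible only as -T.\<close>
    show ?thesis
    proof (cases "pneg S = S")
      case True
      then have "even (pt S S + pt (pneg T) S - 2 * pt Infinity S)"
        using ord_even[OF S] unfolding ord\<psi> by simp
      then have "pneg T = S" by (auto simp: pt_def split: if_splits)
      then show ?thesis using True by (metis pneg_pneg)
    next
      case neq: False
      have "ord \<psi> (pneg S) = ord \<psi> S" by (rule ord_neg[OF S])
      then show ?thesis
        unfolding ord\<psi> using neq False by (auto simp: pt_def split: if_splits)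
    qed
  qed
qed

text \<open>Four instances of (P) + (Q) - (P + Q) - (O) combine to the difference of the two triple
  sums, and a difference of points is principal only if they agree.\<close>

lemma add_assoc:
  assumes S: "on_curve W S" and T: "on_curve W T" and U: "on_curve W U"
  shows "(S +\<^sub>E T) +\<^sub>E U = S +\<^sub>E (T +\<^sub>E U)"
proof -
  have ST: "on_curve W (S +\<^sub>E T)" and TU: "on_curve W (T +\<^sub>E U)"
    using S T U cubic_add_closed by blast+
  obtain m1 where m1: "m1 \<in> FFx" "\<And>P. ord m1 P = pt S P + pt T P - pt (S +\<^sub>E T) P - pt Infinity P"
    using divisor_add_exists[OF S T] by blast
  obtain m2 where m2: "m2 \<in> FFx"
    "\<And>P. ord m2 P = pt (S +\<^sub>E T) P + pt U P - pt ((S +\<^sub>E T) +\<^sub>E U) P - pt Infinity P"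
    using divisor_add_exists[OF ST U] by blast
  obtain m3 where m3: "m3 \<in> FFx" "\<And>P. ord m3 P = pt T P + pt U P - pt (T +\<^sub>E U) P - pt Infinity P"
    using divisor_add_exists[OF T U] by blast
  obtain m4 where m4: "m4 \<in> FFx"
    "\<And>P. ord m4 P = pt S P + pt (T +\<^sub>E U) P - pt (S +\<^sub>E (T +\<^sub>E U)) P - pt Infinity P"
    using divisor_add_exists[OF S TU] by blast
  define \<phi> where "\<phi> = (\<lambda>P. (m3 P * m4 P) / (m1 P * m2 P))"
  have "\<phi> \<in> FFx" unfolding \<phi>_def by (intro FFx_divide FFx_mult m1 m2 m3 m4)
  moreover have "ord \<phi> P = pt ((S +\<^sub>E T) +\<^sub>E U) P - pt (S +\<^sub>E (T +\<^sub>E U)) P" for P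
    unfolding \<phi>_def
    by (simp add: ord_divide ord_mult FFx_mult m1 m2 m3 m4)
  ultimately show ?thesis
    using ord_pt_diff_imp_eq cubic_add_closed ST TU S U by metis
qed

end

text \<open>The divisor argument takes place over an algebraically closed field, but associativity
  is also wanted over the Laurent series field. The addition formulas commute with the embedding
  into the algebraic closure, which is injective on points.\<close>

lemma cubic_add_assoc:
  fixes A B C :: "'a::field_char_0"
  assumes disc: "weierstrass_disc (cubic A B C) \<noteq> 0"
    and "on_curve (cubic A B C) P" "on_curve (cubic A B C) Q" "on_curve (cubic A B C) R"
  shows "point_add (cubic A B C) (point_add (cubic A B C) P Q) R =
    point_add (cubic A B C) P (point_add (cubic A B C) Q R)"
proof -
  interpret h: field_hom "to_ac :: 'a \<Rightarrow> 'a alg_closure" by (rule field_hom_to_ac)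
  have map: "map_weierstrass to_ac (cubic A B C) = cubic (to_ac A) (to_ac B) (to_ac C)" by simp
  interpret smooth_cubic "to_ac A" "to_ac B" "to_ac C"
    by unfold_locales
      (use disc h.weierstrass_disc_map[of "cubic A B C"] map h.hom_eq_zero_iff in metis)
  note add = h.map_point_add[of "cubic A B C", unfolded map]
  note on = h.on_curve_map[of "cubic A B C", unfolded map]
  have "map_point to_ac (point_add (cubic A B C) (point_add (cubic A B C) P Q) R) =
    map_point to_ac (point_add (cubic A B C) P (point_add (cubic A B C) Q R))"
    unfolding add by (rule add_assoc) (use assms on in auto)
  then show ?thesis by (simp only: h.map_point_hom_inject)
qed

lemma comm_group_curve_group_cubic:
  fixes A B C :: "'a::field_char_0"
  assumes disc: "weierstrass_disc (cubic A B C) \<noteq> 0"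
  shows "comm_group (curve_group (cubic A B C))"
proof (rule comm_groupI; unfold curve_group_def; simp only: partial_object.simps monoid.simps mem_Collect_eq)
  show "\<exists>Q\<in>{Q. on_curve (cubic A B C) Q}. point_add (cubic A B C) Q P = Infinity"
    if "on_curve (cubic A B C) P" for P
    using that cubic_add_pneg[of A B C "pneg P"] by (intro bexI[of _ "pneg P"]) auto
qed (rule cubic_add_closed cubic_add_assoc[OF disc] cubic_add_commute on_curve.simps point_add.simps
    iffD2[OF on_curve.simps(1) TrueI]; assumption)+

section \<open>Translations of rational functions\<close>

context smooth_cubic
begin

sublocale E: comm_group "curve_group W"
  by (rule comm_group_curve_group_cubic[OF disc_nonzero])

lemma carrier_E [simp]: "P \<in> carrier (curve_group W) \<longleftrightarrow> on_curve W P"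
  and mult_E [simp]: "P \<otimes>\<^bsub>curve_group W\<^esub> Q = P +\<^sub>E Q"
  and one_E [simp]: "\<one>\<^bsub>curve_group W\<^esub> = Infinity"
  by (auto simp: curve_group_def)

lemma inv_E [simp]: "on_curve W P \<Longrightarrow> inv\<^bsub>curve_group W\<^esub> P = pneg P"
  using cubic_add_pneg[of A B C P] E.inv_unique'[of P "pneg P"] cubic_add_pneg[of A B C "pneg P"]
  by simp

lemma add_closed: "on_curve W P \<Longrightarrow> on_curve W Q \<Longrightarrow> on_curve W (P +\<^sub>E Q)"
  by (rule cubic_add_closed)

lemma add_pneg_cancel [simp]:
  assumes "on_curve W P" "on_curve W Q"
  shows "P +\<^sub>E Q +\<^sub>E pneg Q = P" "P +\<^sub>E pneg Q +\<^sub>E Q = P"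
  using assms cubic_add_pneg[of A B C Q] cubic_add_pneg[of A B C "pneg Q"]
  by (auto simp: add_assoc)

lemma disc_WL: "weierstrass_disc WL \<noteq> 0"
proof -
  have "map_weierstrass c W = WL" by simp
  then show ?thesis
    using disc_nonzero c.weierstrass_disc_map[of W] c.hom_eq_zero_iff by metis
qed

text \<open>Associativity over the Laurent series field turns the shift of P by S into the addition
  of S to the point at which functions are evaluated.\<close>

lemma generic_translate:
  assumes "on_curve W P" "on_curve W S"
  shows "Affine (xg (P +\<^sub>E S)) (yg (P +\<^sub>E S)) =
    point_add WL (Affine (xg P) (yg P)) (map_point c S)"
proof -
  have "map_point c (P +\<^sub>E S) = point_add WL (map_point c P) (map_point c S)"
    using c.map_point_add[of W P S] by simp
  then have "Affine (xg (P +\<^sub>E S)) (yg (P +\<^sub>E S)) =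
      point_add WL (Affine Tx Ty) (point_add WL (map_point c P) (map_point c S))"
    by (simp only: generic_add[symmetric])
  also have "\<dots> = point_add WL (point_add WL (Affine Tx Ty) (map_point c P)) (map_point c S)"
    by (rule cubic_add_assoc[OF disc_WL on_curve_generic, symmetric])
       (use assms on_curve_const in blast)+
  finally show ?thesis by (simp only: generic_add)
qed

lemma xg_yg_translate:
  assumes "on_curve W P" "on_curve W (Affine r s)"
  shows "xg (P +\<^sub>E Affine r s) = ((c s - yg P) / (c r - xg P))^2 - c A - xg P - c r"
    and "yg (P +\<^sub>E Affine r s) =
      - ((c s - yg P) / (c r - xg P)) * (((c s - yg P) / (c r - xg P))^2 - c A - xg P - c r)
      - (yg P - ((c s - yg P) / (c r - xg P)) * xg P)"
proof -
  have "xg P \<noteq> c r" using xg_minus_nonzero[OF assms(1), of r] by auto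
  then have "Affine (xg (P +\<^sub>E Affine r s)) (yg (P +\<^sub>E Affine r s)) =
    Affine (((c s - yg P) / (c r - xg P))^2 - c A - xg P - c r)
     (- ((c s - yg P) / (c r - xg P)) * (((c s - yg P) / (c r - xg P))^2 - c A - xg P - c r)
      - (yg P - ((c s - yg P) / (c r - xg P)) * xg P))"
    unfolding generic_translate[OF assms] by (simp add: Let_def)
  then show "xg (P +\<^sub>E Affine r s) = ((c s - yg P) / (c r - xg P))^2 - c A - xg P - c r"
    "yg (P +\<^sub>E Affine r s) =
      - ((c s - yg P) / (c r - xg P)) * (((c s - yg P) / (c r - xg P))^2 - c A - xg P - c r)
      - (yg P - ((c s - yg P) / (c r - xg P)) * xg P)"
    by (simp_all only: point.inject)
qed

lemma FF_xg_yg_translate: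
  assumes "on_curve W S"
  shows "(\<lambda>P. xg (P +\<^sub>E S)) \<in> FF" "(\<lambda>P. yg (P +\<^sub>E S)) \<in> FF"
proof -
  have "(\<lambda>P. xg (P +\<^sub>E S)) \<in> FF \<and> (\<lambda>P. yg (P +\<^sub>E S)) \<in> FF"
  proof (cases S)
    case Infinity
    then show ?thesis by (simp add: FF_xg FF_yg)
  next
    case (Affine r s)
    define l where "l = (\<lambda>P. (c s - yg P) / (c r - xg P))"
    have l: "l \<in> FF" unfolding l_def by (intro FF_divide FF_diff FF_const FF_xg FF_yg)
    have x: "(\<lambda>P. l P ^ 2 - c A - xg P - c r) \<in> FF"
      by (intro FF_diff FF_power l FF_const FF_xg)
    have y: "(\<lambda>P. - l P * (l P ^ 2 - c A - xg P - c r) - (yg P - l P * xg P)) \<in> FF"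
      by (intro FF_diff FF_mult FF_uminus FF_power l FF_const FF_xg FF_yg)
    have "on_curve W (Affine r s)" using assms Affine by simp
    then show ?thesis
      unfolding Affine
      by (intro conjI FF_cong[OF x] FF_cong[OF y])
         (simp_all only: xg_yg_translate l_def)
  qed
  then show "(\<lambda>P. xg (P +\<^sub>E S)) \<in> FF" "(\<lambda>P. yg (P +\<^sub>E S)) \<in> FF" by auto
qed

lemma FF_translate:
  assumes "on_curve W S" "\<phi> \<in> FF"
  shows "(\<lambda>P. \<phi> (P +\<^sub>E S)) \<in> FF"
proof -
  obtain a b d where
    *: "\<And>P. on_curve W P \<Longrightarrow> \<phi> P = (pev a P + pev b P * yg P) / pev d P"
    using FF_E[OF assms(2)] by metis
  have pev: "(\<lambda>P. pev q (P +\<^sub>E S)) \<in> FF" for q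
  proof (induction q)
    case 0
    then show ?case using FF_const[of 0] by simp
  next
    case (pCons k q)
    then show ?case by (simp add: FF_add FF_mult FF_const FF_xg_yg_translate assms(1))
  qed
  have "(\<lambda>P. (pev a (P +\<^sub>E S) + pev b (P +\<^sub>E S) * yg (P +\<^sub>E S)) / pev d (P +\<^sub>E S)) \<in> FF"
    by (intro FF_divide FF_add FF_mult pev FF_xg_yg_translate assms)
  then show ?thesis
    by (rule FF_cong) (simp add: * add_closed assms(1))
qed

lemma FFx_translate: "on_curve W S \<Longrightarrow> \<phi> \<in> FFx \<Longrightarrow> (\<lambda>P. \<phi> (P +\<^sub>E S)) \<in> FFx"
  by (auto simp: FFx_def FF_translate add_closed)

end

section \<open>The Weil pairing\<close>

context smooth_cubic
begin

abbreviation padd_sub (infixl "-\<^sub>E" 65) where "P -\<^sub>E Q \<equiv> P +\<^sub>E pneg Q"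
abbreviation mul :: "nat \<Rightarrow> 'a point \<Rightarrow> 'a point" where "mul n P \<equiv> P [^]\<^bsub>curve_group W\<^esub> n"

definition tor :: "nat \<Rightarrow> 'a point \<Rightarrow> bool"
  where "tor n P \<longleftrightarrow> on_curve W P \<and> mul n P = Infinity"

lemma on_curve_mul [simp]: "on_curve W P \<Longrightarrow> on_curve W (mul n P)"
  using E.nat_pow_closed[of P n] by simp

lemma mul_Suc: "mul (Suc n) P = mul n P +\<^sub>E P"
  by (simp add: E.nat_pow_Suc)

lemma on_curve_sub [simp]: "on_curve W P \<Longrightarrow> on_curve W Q \<Longrightarrow> on_curve W (P -\<^sub>E Q)"
  by (simp add: add_closed)

lemma add_commute: "on_curve W P \<Longrightarrow> on_curve W Q \<Longrightarrow> P +\<^sub>E Q = Q +\<^sub>E P"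
  by (rule cubic_add_commute)

lemma sub_eq_iff:
  assumes "on_curve W P" "on_curve W Q" "on_curve W R"
  shows "P -\<^sub>E Q = R \<longleftrightarrow> P = R +\<^sub>E Q"
  using assms by auto

lemma sub_add:
  assumes "on_curve W P" "on_curve W Q" "on_curve W R"
  shows "P -\<^sub>E (Q +\<^sub>E R) = P -\<^sub>E Q -\<^sub>E R"
  using assms by (simp add: pneg_cubic_add add_assoc)

lemma sub_commute:
  assumes "on_curve W P" "on_curve W Q" "on_curve W R"
  shows "P -\<^sub>E Q -\<^sub>E R = P -\<^sub>E R -\<^sub>E Q"
  using assms by (metis sub_add add_commute)

lemma tor_add: "tor n P \<Longrightarrow> tor n Q \<Longrightarrow> tor n (P +\<^sub>E Q)"
  using E.nat_pow_distrib[of P Q n] by (simp add: tor_def add_closed)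

lemma tor_Infinity [simp]: "tor n Infinity"
  using E.nat_pow_one[of n] by (simp add: tor_def)

lemma tor_mul: "tor n P \<Longrightarrow> tor n (mul k P)"
  by (induction k) (auto simp: mul_Suc tor_add simp del: nat_pow_Suc)

lemma tor_on_curve: "tor n P \<Longrightarrow> on_curve W P"
  by (simp add: tor_def)

lemma pt_sub:
  assumes "on_curve W P" "on_curve W Q" "on_curve W S"
  shows "pt Q (P -\<^sub>E S) = pt (Q +\<^sub>E S) P"
  using assms sub_eq_iff[of P S Q] by (simp add: pt_def)

text \<open>Such an h together with S is an element of a Heisenberg group over the n-torsion:
  \<open>lift_mult\<close> is its multiplication, and by \<open>lift_unique\<close> the elements
  over a given S differ by nonzero constants.\<close>

definition lift :: "nat \<Rightarrow> 'a point \<Rightarrow> ('a point \<Rightarrow> 'a fls) \<Rightarrow> bool"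
  where "lift n S h \<longleftrightarrow> h \<in> FFx \<and> (\<forall>P. ord h P = int n * (pt S P - pt Infinity P))"

lemma lift_nonzero: "lift n S h \<Longrightarrow> on_curve W P \<Longrightarrow> h P \<noteq> 0"
  by (simp add: lift_def FFx_nonzero)

lemma lift_exists:
  assumes "tor n S"
  shows "\<exists>h. lift n S h"
proof -
  have S: "on_curve W S" and n: "mul n S = Infinity" using assms by (auto simp: tor_def)
  \<comment> \<open>Generalized from n to k: the divisor k(S) - (kS) - (k - 1)(O) becomes n(S) -
    n(O) at k = n.\<close>
  have "\<exists>h \<in> FFx. \<forall>P. ord h P = int k * pt S P - pt (mul k S) P - (int k - 1) * pt Infinity P" for k
  proof (induction k)
    case 0
    show ?case by (rule bexI[OF _ FFx_const[of 1]]) (auto simp: ord_def)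
  next
    case (Suc k)
    then obtain h where h: "h \<in> FFx"
      "\<And>P. ord h P = int k * pt S P - pt (mul k S) P - (int k - 1) * pt Infinity P"
      by blast
    obtain m where m: "m \<in> FFx"
      "\<And>P. ord m P = pt (mul k S) P + pt S P - pt (mul k S +\<^sub>E S) P - pt Infinity P"
      using divisor_add_exists[OF on_curve_mul[OF S] S] by blast
    have "ord (\<lambda>P. h P * m P) P =
        int (Suc k) * pt S P - pt (mul (Suc k) S) P - (int (Suc k) - 1) * pt Infinity P" for P
      unfolding ord_mult[OF h(1) m(1)] h(2) m(2) mul_Suc by (simp add: algebra_simps)
    then show ?case using FFx_mult[OF h(1) m(1)] by blast
  qed
  from this[of n] obtain h where "h \<in> FFx"
    "\<And>P. ord h P = int n * pt S P - pt Infinity P - (int n - 1) * pt Infinity P"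
    unfolding n by blast
  then have "lift n S h" by (simp add: lift_def algebra_simps)
  then show ?thesis by blast
qed

lemma lift_Infinity: "k \<noteq> 0 \<Longrightarrow> lift n Infinity (\<lambda>_. c k)"
  by (simp add: lift_def FFx_const)

lemma lift_scale: "lift n S h \<Longrightarrow> k \<noteq> 0 \<Longrightarrow> lift n S (\<lambda>P. c k * h P)"
  using FFx_const[of k] by (simp add: lift_def FFx_mult ord_mult)

lemma lift_mult:
  assumes "lift n S h" "lift n T h'" "on_curve W S" "on_curve W T"
  shows "lift n (S +\<^sub>E T) (\<lambda>P. h P * h' (P -\<^sub>E S))"
  unfolding lift_def
proof (intro conjI allI)
  have x: "h \<in> FFx" "(\<lambda>P. h' (P -\<^sub>E S)) \<in> FFx"
    using FFx_translate[of "pneg S" h'] assms by (auto simp: lift_def)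
  then show "(\<lambda>P. h P * h' (P -\<^sub>E S)) \<in> FFx" by (rule FFx_mult)
  show "ord (\<lambda>P. h P * h' (P -\<^sub>E S)) P = int n * (pt (S +\<^sub>E T) P - pt Infinity P)" for P
  proof (cases "on_curve W P")
    case True
    have "ord (\<lambda>P. h P * h' (P -\<^sub>E S)) P = ord h P + ord h' (P -\<^sub>E S)"
      unfolding ord_mult[OF x] using True assms(3) by (simp add: ord_def)
    \<comment> \<open>Translation by S moves n(T) - n(O) to n(T + S) - n(S), and the terms at S
      cancel.\<close>
    also have "\<dots> = int n * (pt S P - pt Infinity P) + int n * (pt (T +\<^sub>E S) P - pt S P)"
      using assms True pt_sub[of P T S] pt_sub[of P Infinity S] by (simp add: lift_def)
    finally show ?thesis
      using add_commute[OF assms(3,4)] by (simp add: algebra_simps)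
  next
    case False
    then have "P \<noteq> S +\<^sub>E T" "P \<noteq> Infinity" using assms add_closed by auto
    then show ?thesis using False by (simp add: ord_def pt_def)
  qed
qed

lemma lift_unique:
  assumes "lift n S h" "lift n S h'"
  obtains k where "k \<noteq> 0" "\<And>P. on_curve W P \<Longrightarrow> h P = c k * h' P"
proof -
  have x: "h \<in> FFx" "h' \<in> FFx" using assms by (auto simp: lift_def)
  have "ord (\<lambda>P. h P / h' P) P = 0" for P
    using assms by (simp add: ord_divide[OF x] lift_def)
  then obtain k where "k \<noteq> 0" "\<And>P. on_curve W P \<Longrightarrow> h P / h' P = c k"
    using ord_zero_imp_const[OF FFx_divide[OF x]] by blast
  moreover have "h P = c k * h' P" if "on_curve W P" for P
    using calculation(2)[OF that] FFx_nonzero[OF x(2) that] by (simp add: field_simps)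
  ultimately show thesis using that by blast
qed

text \<open>The commutator of a lift of S and a lift of T. Rescaling h or h' affects both sides
  alike, so the scalar depends only on S and T.\<close>

definition weil :: "nat \<Rightarrow> 'a point \<Rightarrow> 'a point \<Rightarrow> 'a"
  where "weil n S T = (THE k. \<exists>h h'. lift n S h \<and> lift n T h' \<and>
    (\<forall>P. on_curve W P \<longrightarrow> h P * h' (P -\<^sub>E S) = c k * (h' P * h (P -\<^sub>E T))))"

lemma weil_eqI:
  assumes S: "on_curve W S" and T: "on_curve W T" and h: "lift n S h" "lift n T h'"
    and eq: "\<And>P. on_curve W P \<Longrightarrow> h P * h' (P -\<^sub>E S) = c k * (h' P * h (P -\<^sub>E T))"
  shows "weil n S T = k"
  unfolding weil_def
proof (rule the_equality)
  fix l assume "\<exists>h h'. lift n S h \<and> lift n T h' \<and>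
    (\<forall>P. on_curve W P \<longrightarrow> h P * h' (P -\<^sub>E S) = c l * (h' P * h (P -\<^sub>E T)))"
  then obtain g g' where g: "lift n S g" "lift n T g'"
    and eq': "\<And>P. on_curve W P \<Longrightarrow> g P * g' (P -\<^sub>E S) = c l * (g' P * g (P -\<^sub>E T))"
    by blast
  obtain a where a: "a \<noteq> 0" "\<And>P. on_curve W P \<Longrightarrow> g P = c a * h P"
    using lift_unique[OF g(1) h(1)] by metis
  obtain b where b: "b \<noteq> 0" "\<And>P. on_curve W P \<Longrightarrow> g' P = c b * h' P"
    using lift_unique[OF g(2) h(2)] by metis
  have on: "on_curve W (Infinity -\<^sub>E S)" "on_curve W (Infinity -\<^sub>E T)" using S T by auto
  have O: "on_curve W Infinity" by simp
  \<comment> \<open>Both equations are compared at the single point \<open>Infinity\<close>, up to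
    the nonzero common factor \<open>u\<close>.\<close>
  define u where "u = c a * c b * (h' Infinity * h (Infinity -\<^sub>E T))"
  have "u * c k = (c a * c b) * (c k * (h' Infinity * h (Infinity -\<^sub>E T)))"
    unfolding u_def by (simp only: mult_ac)
  also have "\<dots> = (c a * h Infinity) * (c b * h' (Infinity -\<^sub>E S))"
    unfolding eq[OF O, symmetric] by (simp only: mult_ac)
  also have "\<dots> = c l * ((c b * h' Infinity) * (c a * h (Infinity -\<^sub>E T)))"
    using eq'[OF O] unfolding a(2)[OF O] b(2)[OF O] a(2)[OF on(2)] b(2)[OF on(1)] .
  also have "\<dots> = u * c l"
    unfolding u_def by (simp only: mult_ac)
  finally have "u * c k = u * c l" .
  moreover have "u \<noteq> 0"
    unfolding u_def using a(1) b(1) lift_nonzero[OF h(1) on(2)] lift_nonzero[OF h(2), of Infinity] by auto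
  ultimately have "c k = c l" by (simp only: mult_cancel_left) blast
  then show "l = k" by simp
qed (use assms in blast)

lemma weil_eq:
  assumes S: "on_curve W S" and T: "on_curve W T" and h: "lift n S h" "lift n T h'"
  shows "weil n S T \<noteq> 0"
    and "on_curve W P \<Longrightarrow> h P * h' (P -\<^sub>E S) = c (weil n S T) * (h' P * h (P -\<^sub>E T))"
proof -
  have L: "lift n (S +\<^sub>E T) (\<lambda>P. h' P * h (P -\<^sub>E T))"
    using lift_mult[OF h(2,1) T S] add_commute[OF S T] by simp
  obtain k where k: "k \<noteq> 0"
    "\<And>P. on_curve W P \<Longrightarrow> h P * h' (P -\<^sub>E S) = c k * (h' P * h (P -\<^sub>E T))"
  proof -
    have "\<exists>k. k \<noteq> 0 \<and> (\<forall>P. on_curve W P \<longrightarrow>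
        h P * h' (P -\<^sub>E S) = c k * (h' P * h (P -\<^sub>E T)))"
      by (rule lift_unique[OF lift_mult[OF h S T] L]) blast
    then show thesis using that by blast
  qed
  then have "weil n S T = k" by (intro weil_eqI[OF S T h])
  with k show "weil n S T \<noteq> 0"
    "on_curve W P \<Longrightarrow> h P * h' (P -\<^sub>E S) = c (weil n S T) * (h' P * h (P -\<^sub>E T))"
    by auto
qed

lemma weil_nonzero: "tor n S \<Longrightarrow> tor n T \<Longrightarrow> weil n S T \<noteq> 0"
  using lift_exists weil_eq(1) tor_on_curve by metis

lemma weil_swap:
  assumes "tor n S" "tor n T"
  shows "weil n T S = inverse (weil n S T)"
proof -
  obtain h h' where h: "lift n S h" "lift n T h'"
    using lift_exists[OF assms(1)] lift_exists[OF assms(2)] by blast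
  note on = assms[THEN tor_on_curve]
  show ?thesis
  proof (rule weil_eqI[OF on(2,1) h(2,1)])
    fix P assume P: "on_curve W P"
    have "c (inverse (weil n S T)) * c (weil n S T) = c 1"
      unfolding c.hom_mult[symmetric] field_class.field_inverse[OF weil_eq(1)[OF on h]] ..
    then show "h' P * h (P -\<^sub>E T) = c (inverse (weil n S T)) * (h P * h' (P -\<^sub>E S))"
      unfolding weil_eq(2)[OF on h P] mult.assoc[symmetric] by (simp only: c.hom_one mult_1_left)
  qed
qed

text \<open>A lift of S commutes past the product of lifts of T and U in two steps, the second of
  them at the point P - T.\<close>

lemma weil_add_right:
  assumes "tor n S" "tor n T" "tor n U"
  shows "weil n S (T +\<^sub>E U) = weil n S T * weil n S U"
proof -
  obtain h h' h'' where h: "lift n S h" "lift n T h'" "lift n U h''"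
    using lift_exists[OF assms(1)] lift_exists[OF assms(2)] lift_exists[OF assms(3)] by blast
  note on = assms[THEN tor_on_curve]
  show ?thesis
  proof (rule weil_eqI[OF on(1) add_closed[OF on(2,3)] h(1) lift_mult[OF h(2,3) on(2,3)]])
    fix P assume P: "on_curve W P"
    have "h P * (h' (P -\<^sub>E S) * h'' (P -\<^sub>E S -\<^sub>E T)) = (h P * h' (P -\<^sub>E S)) * h'' (P -\<^sub>E T -\<^sub>E S)"
      using sub_commute[OF P on(1,2)] by simp
    also have "\<dots> = c (weil n S T) * h' P * (h (P -\<^sub>E T) * h'' (P -\<^sub>E T -\<^sub>E S))"
      using weil_eq(2)[OF on(1,2) h(1,2) P] by simp
    also have "h (P -\<^sub>E T) * h'' (P -\<^sub>E T -\<^sub>E S) =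
        c (weil n S U) * (h'' (P -\<^sub>E T) * h (P -\<^sub>E T -\<^sub>E U))"
      using P on by (intro weil_eq(2)[OF on(1,3) h(1,3)]) simp
    finally show "h P * (h' (P -\<^sub>E S) * h'' (P -\<^sub>E S -\<^sub>E T)) =
      c (weil n S T * weil n S U) * (h' P * h'' (P -\<^sub>E T) * h (P -\<^sub>E (T +\<^sub>E U)))"
      using sub_add[OF P on(2,3)] by (simp add: mult_ac)
  qed
qed

lemma weil_Infinity_right: "tor n S \<Longrightarrow> weil n S Infinity = 1"
proof -
  assume S: "tor n S"
  obtain h where h: "lift n S h" using lift_exists S by blast
  show ?thesis
    by (rule weil_eqI[OF tor_on_curve[OF S] _ h lift_Infinity[of 1]]) auto
qed

lemma weil_mul_right:
  assumes "tor n S" "tor n T"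
  shows "weil n S (mul k T) = weil n S T ^ k"
proof (induction k)
  case 0
  show ?case using weil_Infinity_right[OF assms(1)] by simp
next
  case (Suc k)
  then show ?case
    unfolding mul_Suc using weil_add_right[OF assms(1) tor_mul[OF assms(2)] assms(2)] by simp
qed

lemma weil_mul_left:
  assumes "tor n S" "tor n T"
  shows "weil n (mul k S) T = weil n S T ^ k"
  using weil_swap[OF assms(2) tor_mul[OF assms(1)]] weil_swap[OF assms] weil_mul_right[OF assms(2,1)]
  by (simp add: power_inverse)

lemma weil_power:
  assumes "tor n S" "tor n T"
  shows "weil n S T ^ n = 1"
  using weil_mul_right[OF assms, of n] weil_Infinity_right[OF assms(1)] assms(2)
  by (simp add: tor_def)

end

section \<open>Galois equivariance of the pairing\<close>

locale smooth_cubic_aut = smooth_cubic A B C + s: field_hom \<sigma> + s': field_hom \<sigma>'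
  for A B C :: "'a::{alg_closed_field, field_char_0}" and \<sigma> \<sigma>' :: "'a \<Rightarrow> 'a" +
  assumes inverse_left: "\<sigma>' (\<sigma> x) = x" and inverse_right: "\<sigma> (\<sigma>' x) = x"
    and fixed: "\<sigma> A = A" "\<sigma> B = B" "\<sigma> C = C"
begin

abbreviation \<Sigma> where "\<Sigma> \<equiv> fls_map \<sigma>"

sublocale S: field_hom \<Sigma>
  by (rule s.field_hom_fls_map)

lemma fixed': "\<sigma>' A = A" "\<sigma>' B = B" "\<sigma>' C = C"
  using fixed inverse_left by metis+

lemma map_point_inverse [simp]:
  "map_point \<sigma>' (map_point \<sigma> P) = P" "map_point \<sigma> (map_point \<sigma>' P) = P"
  by (cases P; simp add: inverse_left inverse_right)+

lemma on_curve_map_s [simp]: "on_curve W (map_point \<sigma> P) \<longleftrightarrow> on_curve W P"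
  using s.on_curve_map[of W P] by (simp add: fixed)

lemma on_curve_map_s' [simp]: "on_curve W (map_point \<sigma>' P) \<longleftrightarrow> on_curve W P"
  using s'.on_curve_map[of W P] by (simp add: fixed')

lemma map_add: "map_point \<sigma> (P +\<^sub>E Q) = map_point \<sigma> P +\<^sub>E map_point \<sigma> Q"
  using s.map_point_add[of W P Q] by (simp add: fixed)

lemma map_add': "map_point \<sigma>' (P +\<^sub>E Q) = map_point \<sigma>' P +\<^sub>E map_point \<sigma>' Q"
  using s'.map_point_add[of W P Q] by (simp add: fixed')

lemma map_pneg': "map_point \<sigma>' (pneg P) = pneg (map_point \<sigma>' P)"
  by (cases P) auto

lemma map_Tx: "\<Sigma> Tx = Tx"
proof -
  have "\<Sigma> fls_X_inv = fls_X_inv" by (simp add: fls_eq_iff)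
  then show ?thesis by (simp add: Tx_def)
qed

text \<open>The equation determines \<open>Ty\<close> up to sign, and \<sigma> preserves its leading
  coefficient 1.\<close>

lemma map_Ty: "\<Sigma> Ty = Ty"
proof -
  have "(\<Sigma> Ty)^2 = \<Sigma> (Ty^2)" by simp
  also have "\<dots> = cub (c A) (c B) (c C) Tx" unfolding Ty(1) by (simp add: map_Tx fixed)
  finally have "\<Sigma> Ty = Ty \<or> \<Sigma> Ty = - Ty" by (rule Ty_unique)
  moreover have "\<Sigma> Ty $$ (-3) \<noteq> (- Ty) $$ (-3)"
    by (simp add: Ty(2))
  ultimately show ?thesis by metis
qed

lemma map_xg: "\<Sigma> (xg P) = xg (map_point \<sigma> P)"
  by (cases P) (auto simp: xg_def lam_def map_Tx map_Ty fixed)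

lemma map_yg: "\<Sigma> (yg P) = yg (map_point \<sigma> P)"
  by (cases P) (auto simp: yg_def xg_def lam_def map_Tx map_Ty fixed)

lemma map_pev: "\<Sigma> (pev a P) = pev (map_poly \<sigma> a) (map_point \<sigma> P)"
  by (induction a) (auto simp: map_xg map_poly_pCons)

text \<open>The Galois conjugate of a function: \<sigma> acts on the coefficients, and the argument
  is pulled back so that the coordinate functions are fixed.\<close>

definition twist :: "('a point \<Rightarrow> 'a fls) \<Rightarrow> 'a point \<Rightarrow> 'a fls"
  where "twist \<phi> P = \<Sigma> (\<phi> (map_point \<sigma>' P))"

lemma FF_twist:
  assumes "\<phi> \<in> FF"
  shows "twist \<phi> \<in> FF"
proof -
  obtain a b d where d: "d \<noteq> 0"
    and *: "\<And>P. on_curve W P \<Longrightarrow> \<phi> P * pev d P = pev a P + pev b P * yg P"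
    using FF_E[OF assms] by metis
  have d': "map_poly \<sigma> d \<noteq> 0" using d by simp
  show ?thesis
  proof (rule FF_I[OF d', of _ "map_poly \<sigma> a" "map_poly \<sigma> b"])
    fix P assume "on_curve W P"
    then have "\<Sigma> (\<phi> (map_point \<sigma>' P) * pev d (map_point \<sigma>' P)) =
      \<Sigma> (pev a (map_point \<sigma>' P) + pev b (map_point \<sigma>' P) * yg (map_point \<sigma>' P))"
      using *[of "map_point \<sigma>' P"] by simp
    then show "twist \<phi> P * pev (map_poly \<sigma> d) P =
      pev (map_poly \<sigma> a) P + pev (map_poly \<sigma> b) P * yg P"
      by (simp add: twist_def map_pev map_yg)
  qed
qed

lemma FFx_twist: "\<phi> \<in> FFx \<Longrightarrow> twist \<phi> \<in> FFx"
  by (auto simp: FFx_def FF_twist) (simp add: twist_def)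

lemma ord_twist: "ord (twist \<phi>) P = ord \<phi> (map_point \<sigma>' P)"
  by (simp add: ord_def twist_def)

lemma pt_map: "pt Q (map_point \<sigma>' P) = pt (map_point \<sigma> Q) P"
  unfolding pt_def by (metis map_point_inverse)

lemma lift_twist: "lift n S h \<Longrightarrow> lift n (map_point \<sigma> S) (twist h)"
  by (simp add: lift_def FFx_twist ord_twist pt_map)

lemma weil_map:
  assumes "tor n S" "tor n T"
  shows "weil n (map_point \<sigma> S) (map_point \<sigma> T) = \<sigma> (weil n S T)"
proof -
  obtain h h' where h: "lift n S h" "lift n T h'"
    using lift_exists[OF assms(1)] lift_exists[OF assms(2)] by blast
  note on = assms[THEN tor_on_curve]
  show ?thesis
  proof (rule weil_eqI)
    fix P assume "on_curve W P"
    then have "\<Sigma> (h (map_point \<sigma>' P) * h' (map_point \<sigma>' P -\<^sub>E S)) =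
      \<Sigma> (c (weil n S T) * (h' (map_point \<sigma>' P) * h (map_point \<sigma>' P -\<^sub>E T)))"
      using weil_eq(2)[OF on h, of "map_point \<sigma>' P"] by simp
    then show "twist h P * twist h' (P -\<^sub>E map_point \<sigma> S) =
      c (\<sigma> (weil n S T)) * (twist h' P * twist h (P -\<^sub>E map_point \<sigma> T))"
      by (simp add: twist_def map_add' map_pneg')
  qed (use on h lift_twist in auto)
qed

end

section \<open>Nondegeneracy\<close>

lemma primitive_root_nonzero: "primitive_root_of_unity n (z::'a::field) \<Longrightarrow> n > 0 \<Longrightarrow> z \<noteq> 0"
  by (auto simp: primitive_root_of_unity_def power_0_left)

lemma sum_powers_primitive_root:
  fixes z :: "'a::field"
  assumes "primitive_root_of_unity n z" "0 < j" "j < n"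
  shows "(\<Sum>i<n. (inverse z ^ j) ^ i) = 0"
proof -
  let ?w = "inverse z ^ j"
  have "z ^ j \<noteq> 1" using assms by (auto simp: primitive_root_of_unity_def)
  then have "?w \<noteq> 1" by (simp add: power_inverse inverse_eq_1_iff)
  moreover have "?w ^ n = 1"
    using assms(1) unfolding primitive_root_of_unity_def
    by (metis inverse_1 mult.commute power_inverse power_mult power_one)
  ultimately show ?thesis
    by (simp add: sum_gp_strict)
qed

section \<open>Translation operators and their eigenfunctions\<close>

context smooth_cubic
begin

definition Uop :: "('a point \<Rightarrow> 'a fls) \<Rightarrow> 'a point \<Rightarrow> ('a point \<Rightarrow> 'a fls) \<Rightarrow> 'a point \<Rightarrow> 'a fls"
  where "Uop h S \<phi> P = h P * \<phi> (P -\<^sub>E S)"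

lemma FF_Uop: "on_curve W S \<Longrightarrow> h \<in> FF \<Longrightarrow> \<phi> \<in> FF \<Longrightarrow> Uop h S \<phi> \<in> FF"
  using FF_mult[OF _ FF_translate[of "pneg S" \<phi>], of h] by (simp add: Uop_def[abs_def])

lemma Uop_funpow_Suc: "(Uop h S ^^ Suc j) \<phi> P = h P * (Uop h S ^^ j) \<phi> (P -\<^sub>E S)"
  by (simp add: Uop_def[of h S "(Uop h S ^^ j) \<phi>"])

lemma Uop_funpow:
  assumes "on_curve W S" "on_curve W P"
  shows "(Uop h S ^^ j) \<phi> P = (Uop h S ^^ j) (\<lambda>_. 1) P * \<phi> (P -\<^sub>E mul j S)"
  using assms(2)
proof (induction j arbitrary: P)
  case 0
  then show ?case by simp
next
  case (Suc j)
  have "(Uop h S ^^ Suc j) \<phi> P =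
      h P * ((Uop h S ^^ j) (\<lambda>_. 1) (P -\<^sub>E S) * \<phi> (P -\<^sub>E S -\<^sub>E mul j S))"
    using Suc.IH[of "P -\<^sub>E S"] Suc.prems assms(1) unfolding Uop_funpow_Suc by simp
  moreover have "P -\<^sub>E S -\<^sub>E mul j S = P -\<^sub>E mul (Suc j) S"
    using sub_add[of P S "mul j S"] add_commute[of S "mul j S"] assms(1) Suc.prems
    unfolding mul_Suc by simp
  ultimately show ?case unfolding Uop_funpow_Suc by (simp only: mult.assoc)
qed

lemma lift_Uop_funpow:
  assumes "tor n S" "lift n S h"
  shows "lift n (mul j S) ((Uop h S ^^ j) (\<lambda>_. 1))"
proof (induction j)
  case 0
  show ?case using lift_Infinity[of 1 n] by simp
next
  case (Suc j)
  note S = tor_on_curve[OF assms(1)]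
  have "lift n (S +\<^sub>E mul j S) (\<lambda>P. h P * (Uop h S ^^ j) (\<lambda>_. 1) (P -\<^sub>E S))"
    using lift_mult[OF assms(2) Suc] S by simp
  moreover have "S +\<^sub>E mul j S = mul (Suc j) S"
    unfolding mul_Suc using add_commute[of S "mul j S"] S by simp
  moreover have "(\<lambda>P. h P * (Uop h S ^^ j) (\<lambda>_. 1) (P -\<^sub>E S)) = (Uop h S ^^ Suc j) (\<lambda>_. 1)"
    by (rule ext) (simp only: Uop_funpow_Suc)
  ultimately show ?case by (simp only:)
qed

text \<open>The n-th power of the operator belongs to a lift of nS = O, so it is multiplication by a
  constant, and an n-th root of its inverse rescales h. Periodicity makes eigenfunctions accessible
  through Fourier sums.\<close>

lemma normalized_lift_exists:
  assumes "tor n S" "n > 0"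
  obtains h where "lift n S h"
    "\<And>\<phi> P. on_curve W P \<Longrightarrow> (Uop h S ^^ n) \<phi> P = \<phi> P"
proof -
  note S = tor_on_curve[OF assms(1)]
  obtain g where g: "lift n S g" using lift_exists[OF assms(1)] by blast
  have "lift n Infinity ((Uop g S ^^ n) (\<lambda>_. 1))"
    using lift_Uop_funpow[OF assms(1) g, of n] assms(1) by (simp add: tor_def)
  then have "\<exists>k. k \<noteq> 0 \<and> (\<forall>P. on_curve W P \<longrightarrow> (Uop g S ^^ n) (\<lambda>_. 1) P = c k)"
    using ord_zero_imp_const[of "(Uop g S ^^ n) (\<lambda>_. 1)"] by (simp add: lift_def)
  then obtain k where k: "k \<noteq> 0" "\<And>P. on_curve W P \<Longrightarrow> (Uop g S ^^ n) (\<lambda>_. 1) P = c k"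
    by blast
  obtain r where r: "r ^ n = inverse k"
    using nth_root_exists[of n "inverse k"] assms(2) by auto
  with k(1) assms(2) have r0: "r \<noteq> 0" by (auto simp: power_0_left)
  define h where "h = (\<lambda>P. c r * g P)"
  have scale: "(Uop h S ^^ j) (\<lambda>_. 1) P = c (r ^ j) * (Uop g S ^^ j) (\<lambda>_. 1) P" for j P
  proof (induction j arbitrary: P)
    case (Suc j)
    then show ?case unfolding Uop_funpow_Suc by (simp add: h_def mult_ac)
  qed simp
  show thesis
  proof (rule that[of h])
    show "lift n S h" unfolding h_def by (rule lift_scale[OF g r0])
    show "(Uop h S ^^ n) \<phi> P = \<phi> P" if P: "on_curve W P" for \<phi> P
    proof -
      have "c (r ^ n) * c k = c 1"
        unfolding r c.hom_mult[symmetric] field_class.field_inverse[OF k(1)] ..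
      then have "(Uop h S ^^ n) (\<lambda>_. 1) P = 1"
        unfolding scale k(2)[OF P] by (simp only: c.hom_one)
      moreover have "mul n S = Infinity" using assms(1) by (simp add: tor_def)
      ultimately show ?thesis
        using Uop_funpow[OF S P, where h = h and j = n and \<phi> = \<phi>] by simp
    qed
  qed
qed

text \<open>Discrete Fourier transform of the periodic orbit of \<phi>: its components are
  eigenfunctions and add up to n \<phi>, so one of them is nonzero. The space V is a parameter so
  that the second operator can be restricted to an eigenspace of the first.\<close>

lemma eigenfunction_exists:
  fixes \<zeta> :: 'a
  assumes \<zeta>: "primitive_root_of_unity n \<zeta>" and n: "n > 0"
    and S: "on_curve W S" and h: "h \<in> FF"
    and period: "\<And>\<phi> P. on_curve W P \<Longrightarrow> (Uop h S ^^ n) \<phi> P = \<phi> P"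
    and V: "V \<subseteq> FF" "(\<lambda>_. 0) \<in> V"
      "\<And>\<phi> \<psi>. \<phi> \<in> V \<Longrightarrow> \<psi> \<in> V \<Longrightarrow> (\<lambda>P. \<phi> P + \<psi> P) \<in> V"
      "\<And>k \<phi>. \<phi> \<in> V \<Longrightarrow> (\<lambda>P. c k * \<phi> P) \<in> V"
      "\<And>\<phi>. \<phi> \<in> V \<Longrightarrow> Uop h S \<phi> \<in> V"
    and \<phi>: "\<phi> \<in> V" "\<phi> \<in> FFx"
  obtains w l where "w \<in> V" "w \<in> FFx" "\<And>P. on_curve W P \<Longrightarrow> Uop h S w P = c l * w P"
proof -
  define \<xi> where "\<xi> = inverse \<zeta>"
  have \<zeta>0: "\<zeta> \<noteq> 0" using primitive_root_nonzero[OF \<zeta> n] .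
  define u where "u = (\<lambda>j. (Uop h S ^^ j) \<phi>)"
  have uV: "u j \<in> V" for j
    unfolding u_def by (induction j) (use \<phi> V in auto)
  \<comment> \<open>n times the component of \<phi> with eigenvalue \<open>\<zeta> ^ i\<close>;
    shifting the orbit by one step produces that factor.\<close>
  define w where "w = (\<lambda>i P. \<Sum>j<n. c (\<xi> ^ (i * j)) * u j P)"
  have wV: "w i \<in> V" for i
  proof -
    have "(\<lambda>P. \<Sum>j<m. c (\<xi> ^ (i * j)) * u j P) \<in> V" for m
      by (induction m) (use V uV in \<open>auto simp del: c.hom_power\<close>)
    then show ?thesis by (simp add: w_def)
  qed
  have eig: "Uop h S (w i) P = c (\<zeta> ^ i) * w i P" if P: "on_curve W P" for i P
  proof -
    define f where "f = (\<lambda>j. c (\<xi> ^ (i * j)) * u j P)"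
    have fn: "f n = f 0"
    proof -
      have "\<xi> ^ (i * n) = 1"
        using \<zeta> by (simp add: \<xi>_def primitive_root_of_unity_def power_inverse mult.commute[of i]
            power_mult)
      then have "c (\<xi> ^ (i * n)) = 1" by (simp only: c.hom_one)
      then show ?thesis using period[OF P, of \<phi>] by (simp add: f_def u_def del: c.hom_power)
    qed
    have "Uop h S (w i) P = (\<Sum>j<n. c (\<xi> ^ (i * j)) * u (Suc j) P)"
      unfolding Uop_def[of h S "w i"]
      by (simp add: w_def sum_distrib_left mult.left_commute Uop_funpow_Suc u_def del: funpow.simps)
    also have "\<dots> = (\<Sum>j<n. c (\<zeta> ^ i) * f (Suc j))"
    proof (rule sum.cong[OF refl])
      fix j
      have "\<zeta> ^ i * \<xi> ^ (i * Suc j) = \<xi> ^ (i * j)"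
        using \<zeta>0 by (simp add: \<xi>_def power_add power_inverse field_simps)
      then have "c (\<zeta> ^ i) * c (\<xi> ^ (i * Suc j)) = c (\<xi> ^ (i * j))"
        by (simp only: c.hom_mult[symmetric])
      then show "c (\<xi> ^ (i * j)) * u (Suc j) P = c (\<zeta> ^ i) * f (Suc j)"
        unfolding f_def mult.assoc[symmetric] by (simp only:)
    qed
    also have "\<dots> = c (\<zeta> ^ i) * (\<Sum>j<n. f (Suc j))"
      by (rule sum_distrib_left[symmetric])
    also have "(\<Sum>j<n. f (Suc j)) = (\<Sum>j<n. f j)"
    proof -
      have "(\<Sum>j<Suc n. f j) = f 0 + (\<Sum>j<n. f (Suc j))" by (rule sum.lessThan_Suc_shift)
      then show ?thesis using fn by simp
    qed
    finally show ?thesis by (simp add: w_def f_def)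
  qed
  \<comment> \<open>Summation over i kills every term with j > 0, since the powers of \<xi>^j run
    over a geometric sum that vanishes.\<close>
  have "(\<Sum>i<n. w i Infinity) = of_nat n * \<phi> Infinity"
  proof -
    have "(\<Sum>i<n. w i Infinity) = (\<Sum>j<n. \<Sum>i<n. c (\<xi> ^ (i * j)) * u j Infinity)"
      unfolding w_def by (rule sum.swap)
    also have "\<dots> = (\<Sum>j<n. c (\<Sum>i<n. (\<xi> ^ j) ^ i) * u j Infinity)"
      unfolding c.hom_sum sum_distrib_right
      by (intro sum.cong refl) (simp add: mult.commute power_mult)
    also have "\<dots> = (\<Sum>j<n. if j = 0 then of_nat n * u 0 Infinity else 0)"
    proof (rule sum.cong[OF refl])
      fix j assume "j \<in> {..<n}"
      show "c (\<Sum>i<n. (\<xi> ^ j) ^ i) * u j Infinity = (if j = 0 then of_nat n * u 0 Infinity else 0)"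
      proof (cases "j = 0")
        case True
        then show ?thesis by simp
      next
        case False
        then have "(\<Sum>i<n. (\<xi> ^ j) ^ i) = 0"
          unfolding \<xi>_def using sum_powers_primitive_root[OF \<zeta>, of j] \<open>j \<in> {..<n}\<close> by simp
        then show ?thesis using False by (simp only: c.hom_zero mult_zero_left if_False)
      qed
    qed
    also have "\<dots> = of_nat n * \<phi> Infinity"
      using n by (simp add: u_def)
    finally show ?thesis .
  qed
  moreover have "of_nat n * \<phi> Infinity \<noteq> 0"
    using n FFx_nonzero[OF \<phi>(2), of Infinity] by simp
  ultimately obtain i where i: "w i Infinity \<noteq> 0"
    by (metis sum.neutral)
  have "w i \<in> FFx"
    using FFx_I[of "w i" Infinity] i wV V(1) by auto
  then show thesis using that wV eig by blast
qed

text \<open>T is a union of cosets of H, each with \<open>card H\<close> elements, on which D is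
  constant; one coset at a time is split off.\<close>

lemma card_dvd_sum_invariant:
  fixes D :: "'a point \<Rightarrow> int"
  assumes H: "subgroup H (curve_group W)" "finite H"
    and inv: "\<And>P Q. on_curve W P \<Longrightarrow> Q \<in> H \<Longrightarrow> D (P +\<^sub>E Q) = D P"
    and fin: "finite T" and on: "\<And>P. P \<in> T \<Longrightarrow> on_curve W P"
    and closed: "\<And>P Q. P \<in> T \<Longrightarrow> Q \<in> H \<Longrightarrow> P +\<^sub>E Q \<in> T"
  shows "int (card H) dvd sum D T"
  using fin on closed
proof (induction "card T" arbitrary: T rule: less_induct)
  case less
  interpret H: subgroup H "curve_group W" by (rule H)
  have onH: "on_curve W Q" if "Q \<in> H" for Q
    using H.mem_carrier[OF that] by simp
  show ?case
  proof (cases "T = {}")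
    case False
    then obtain R where R: "R \<in> T" by blast
    note onR = less.prems(2)[OF R]
    define orb where "orb = (\<lambda>Q. R +\<^sub>E Q) ` H"
    have sub: "orb \<subseteq> T" using less.prems(3)[OF R] by (auto simp: orb_def)
    have "Infinity \<in> H" using H.one_closed by simp
    then have "R \<in> orb" by (force simp: orb_def)
    have inj: "inj_on (\<lambda>Q. R +\<^sub>E Q) H"
      using E.l_cancel[of R] onR onH by (auto simp: inj_on_def)
    have orb: "sum D orb = int (card H) * D R"
      unfolding orb_def by (subst sum.reindex[OF inj]) (simp add: inv[OF onR])
    have "int (card H) dvd sum D (T - orb)"
    proof (rule less.hyps)
      show "card (T - orb) < card T"
        using sub \<open>R \<in> orb\<close> R less.prems(1) by (intro psubset_card_mono) auto
      show "finite (T - orb)" using less.prems(1) by simp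
      show "on_curve W P" if "P \<in> T - orb" for P using less.prems(2) that by blast
      show "P +\<^sub>E Q \<in> T - orb" if P: "P \<in> T - orb" and Q: "Q \<in> H" for P Q
      proof -
        have onP: "on_curve W P" using less.prems(2) P by blast
        have "P +\<^sub>E Q \<notin> orb"
        proof
          assume "P +\<^sub>E Q \<in> orb"
          then obtain Q' where Q': "Q' \<in> H" "P +\<^sub>E Q = R +\<^sub>E Q'" by (auto simp: orb_def)
          have "P = R +\<^sub>E Q' -\<^sub>E Q"
            using add_pneg_cancel(1)[OF onP onH[OF Q]] Q'(2) by simp
          also have "\<dots> = R +\<^sub>E (Q' -\<^sub>E Q)"
            using onR onH[OF Q'(1)] onH[OF Q] by (simp add: add_assoc)
          finally have "P = R +\<^sub>E (Q' -\<^sub>E Q)" .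
          moreover have "Q' -\<^sub>E Q \<in> H"
            using H.m_closed[OF Q'(1) H.m_inv_closed[OF Q]] onH[OF Q] by simp
          ultimately show False using P by (auto simp: orb_def)
        qed
        then show ?thesis using less.prems(3)[of P Q] P Q by blast
      qed
    qed
    moreover have "sum D T = sum D orb + sum D (T - orb)"
      using sum.subset_diff[OF sub less.prems(1), of D] by (simp add: add.commute)
    ultimately show ?thesis using orb by simp
  qed simp
qed

theorem weil_nondegenerate:
  fixes \<zeta> :: 'a
  assumes p: "p \<ge> 2" and \<zeta>: "primitive_root_of_unity p \<zeta>"
    and S: "tor p S" and T: "tor p T"
    and gen: "\<And>Q. tor p Q \<Longrightarrow> \<exists>i j. Q = mul i S +\<^sub>E mul j T"
    and card: "card {Q. tor p Q} = p^2"
  shows "weil p S T \<noteq> 1"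
proof
  assume triv: "weil p S T = 1"
  have p0: "p > 0" using p by simp
  note onS = tor_on_curve[OF S] and onT = tor_on_curve[OF T]
  obtain h1 where h1: "lift p S h1" "\<And>\<phi> P. on_curve W P \<Longrightarrow> (Uop h1 S ^^ p) \<phi> P = \<phi> P"
    by (rule normalized_lift_exists[OF S p0]) blast
  obtain h2 where h2: "lift p T h2" "\<And>\<phi> P. on_curve W P \<Longrightarrow> (Uop h2 T ^^ p) \<phi> P = \<phi> P"
    by (rule normalized_lift_exists[OF T p0]) blast
  have hFF: "h1 \<in> FF" "h2 \<in> FF" using h1 h2 by (auto simp: lift_def FFx_def)
  have comm: "h1 P * h2 (P -\<^sub>E S) = h2 P * h1 (P -\<^sub>E T)" if "on_curve W P" for P
    using weil_eq(2)[OF onS onT h1(1) h2(1) that] by (simp add: triv)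
  have "\<exists>w l. w \<in> FF \<and> w \<in> FFx \<and> (\<forall>P. on_curve W P \<longrightarrow> Uop h1 S w P = c l * w P)"
    by (rule eigenfunction_exists[OF \<zeta> p0 onS hFF(1) h1(2), of FF "\<lambda>_. c 1"])
       (use FF_const[of 0] FF_const[of 1] FF_add FF_mult FF_const FF_Uop[OF onS hFF(1)]
         FFx_const[of 1] in auto)
  then obtain w1 l1 where w1: "w1 \<in> FF" "w1 \<in> FFx"
    "\<And>P. on_curve W P \<Longrightarrow> Uop h1 S w1 P = c l1 * w1 P" by blast
  \<comment> \<open>The eigenspace of the first operator. The trivial pairing makes the operators
    commute, so the second one preserves it.\<close>
  define V where "V = {\<phi> \<in> FF. \<forall>P. on_curve W P \<longrightarrow> Uop h1 S \<phi> P = c l1 * \<phi> P}"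
  have V_Uop: "Uop h2 T \<phi> \<in> V" if "\<phi> \<in> V" for \<phi>
  proof -
    have "Uop h1 S (Uop h2 T \<phi>) P = c l1 * Uop h2 T \<phi> P" if P: "on_curve W P" for P
    proof -
      have "Uop h1 S (Uop h2 T \<phi>) P = (h1 P * h2 (P -\<^sub>E S)) * \<phi> (P -\<^sub>E S -\<^sub>E T)"
        by (simp add: Uop_def mult.assoc)
      also have "\<dots> = h2 P * (h1 (P -\<^sub>E T) * \<phi> (P -\<^sub>E T -\<^sub>E S))"
        unfolding comm[OF P] sub_commute[OF P onS onT] by (rule mult.assoc)
      also have "h1 (P -\<^sub>E T) * \<phi> (P -\<^sub>E T -\<^sub>E S) = c l1 * \<phi> (P -\<^sub>E T)"
        using \<open>\<phi> \<in> V\<close> P onT by (simp add: V_def Uop_def)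
      finally show ?thesis by (simp add: Uop_def mult_ac)
    qed
    then show ?thesis using that FF_Uop[OF onT hFF(2)] by (simp add: V_def)
  qed
  have "\<exists>w l. w \<in> V \<and> w \<in> FFx \<and> (\<forall>P. on_curve W P \<longrightarrow> Uop h2 T w P = c l * w P)"
  proof (rule eigenfunction_exists[OF \<zeta> p0 onT hFF(2) h2(2), of V w1])
    show "V \<subseteq> FF" by (auto simp: V_def)
    show "(\<lambda>_. 0) \<in> V" using FF_const[of 0] by (simp add: V_def Uop_def)
    show "(\<lambda>P. \<phi> P + \<psi> P) \<in> V" if "\<phi> \<in> V" "\<psi> \<in> V" for \<phi> \<psi>
      using that FF_add by (simp add: V_def Uop_def distrib_left)
    show "(\<lambda>P. c k * \<phi> P) \<in> V" if "\<phi> \<in> V" for k \<phi>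
      using that FF_mult[OF FF_const] by (simp add: V_def Uop_def mult.left_commute)
    show "w1 \<in> V" using w1 by (simp add: V_def)
  qed (use V_Uop w1 in blast)+
  then obtain g l2 where g: "g \<in> V" "g \<in> FFx"
    and g2: "\<And>P. on_curve W P \<Longrightarrow> Uop h2 T g P = c l2 * g P" by blast
  have g1: "Uop h1 S g P = c l1 * g P" if "on_curve W P" for P
    using g(1) that by (simp add: V_def)
  \<comment> \<open>By the eigen-equation the translate of div g by Q differs from div g by p(O) -
    p(Q); the summand p(O) absorbs this.\<close>
  define D where "D = (\<lambda>P. ord g P + int p * pt Infinity P)"
  have shift: "D (P -\<^sub>E Q) = D P"
    if P: "on_curve W P" and Q: "on_curve W Q" and h: "lift p Q h"
      and eig: "Uop h Q g P = c l * g P" for P Q h l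
  proof -
    have "g (P -\<^sub>E Q) \<noteq> 0" "g P \<noteq> 0" "h P \<noteq> 0"
      using FFx_nonzero[OF g(2)] P Q lift_nonzero[OF h P] by auto
    moreover from this have "l \<noteq> 0" using eig by (auto simp: Uop_def)
    moreover from eig have "fls_subdegree (h P * g (P -\<^sub>E Q)) = fls_subdegree (c l * g P)"
      by (simp add: Uop_def)
    ultimately have "ord h P + ord g (P -\<^sub>E Q) = ord g P"
      using P Q by (simp add: ord_def)
    moreover have "ord h P = int p * (pt Q P - pt Infinity P)"
      using h by (simp add: lift_def)
    moreover have "pt Infinity (P -\<^sub>E Q) = pt Q P"
      using pt_sub[OF P _ Q, of Infinity] by simp
    ultimately show ?thesis by (simp add: D_def algebra_simps)
  qed
  have add1: "D (P +\<^sub>E S) = D P" if "on_curve W P" for P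
    using shift[OF _ onS h1(1) g1, of "P +\<^sub>E S"] that onS add_closed by simp
  have add2: "D (P +\<^sub>E T) = D P" if "on_curve W P" for P
    using shift[OF _ onT h2(1) g2, of "P +\<^sub>E T"] that onT add_closed by simp
  have addm: "D (P +\<^sub>E mul i Q) = D P"
    if "on_curve W P" "on_curve W Q" "\<And>P. on_curve W P \<Longrightarrow> D (P +\<^sub>E Q) = D P" for P Q i
  proof (induction i)
    case (Suc i)
    then show ?case
      unfolding mul_Suc using that add_closed[OF that(1) on_curve_mul[OF that(2)]]
      by (simp add: add_assoc[symmetric])
  qed simp
  let ?H = "{Q. tor p Q}"
  have inv: "D (P +\<^sub>E Q) = D P" if P: "on_curve W P" and "Q \<in> ?H" for P Q
  proof -
    obtain i j where Q: "Q = mul i S +\<^sub>E mul j T" using gen[of Q] \<open>Q \<in> ?H\<close> by blast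
    have "D (P +\<^sub>E mul i S +\<^sub>E mul j T) = D P"
      using addm[OF _ onT add2, of "P +\<^sub>E mul i S"] addm[OF P onS add1]
        add_closed[OF P on_curve_mul[OF onS]] by simp
    then show ?thesis unfolding Q using P onS onT by (simp add: add_assoc)
  qed
  have sub: "subgroup ?H (curve_group W)"
  proof
    show "inv\<^bsub>curve_group W\<^esub> Q \<in> ?H" if "Q \<in> ?H" for Q
      using that E.nat_pow_inv[of Q p] by (auto simp: tor_def)
  qed (auto simp: tor_add tor_on_curve)
  have fin: "finite ?H" using card p by (metis card.infinite power_eq_0_iff not_numeral_le_zero)
  have bal: "balanced (ord g)" by (rule balanced_ord[OF g(2)])
  define Z where "Z = {P. on_curve W P \<and> D P \<noteq> 0}"
  have "finite Z"
  proof (rule finite_subset)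
    show "Z \<subseteq> insert Infinity {P. ord g P \<noteq> 0}" by (auto simp: Z_def D_def pt_def)
    show "finite (insert Infinity {P. ord g P \<noteq> 0})" using bal by (simp add: balanced_def)
  qed
  have "int (card ?H) dvd sum D Z"
    by (rule card_dvd_sum_invariant[OF sub fin inv \<open>finite Z\<close>])
       (use inv add_closed tor_on_curve in \<open>auto simp: Z_def\<close>)
  moreover have "sum D Z = int p"
  proof -
    have Z: "{P. D P \<noteq> 0} = Z" by (auto simp: Z_def D_def ord_def pt_def)
    have fin2: "finite {P :: 'a point. int p * pt Infinity P \<noteq> 0}"
      by (rule finite_pt_combination[of "{Infinity}"]) (auto simp: pt_def)
    have "sum D Z = Sum_any D" unfolding Sum_any.expand_set Z ..
    also have "\<dots> = Sum_any (ord g) + Sum_any (\<lambda>P :: 'a point. int p * pt Infinity P)"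
      unfolding D_def
      using Sum_any.distrib[of "ord g" "\<lambda>P. int p * pt Infinity P"] bal fin2
      by (simp add: balanced_def)
    also have "Sum_any (\<lambda>P :: 'a point. int p * pt Infinity P) = int p * Sum_any (pt (Infinity :: 'a point))"
      by (rule Sum_any_right_distrib[symmetric]) (rule finite_pt)
    finally show ?thesis using bal by (simp add: balanced_def Sum_any_pt)
  qed
  ultimately have "int (p^2) dvd int p" by (simp only: card)
  then have "p^2 dvd p" by (simp only: int_dvd_int_iff)
  then have "p^2 \<le> p" using p0 by (rule dvd_imp_le)
  then show False using p by (simp add: power2_eq_square)
qed

end

section \<open>General Weierstrass equations\<close>

text \<open>Writing a1 = 2u and a3 = 2v, possible in characteristic 0, lets z = y + u x + v complete
  the square, with the coefficients in \<open>completed\<close>.\<close>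

abbreviation halved :: "'a::field_char_0 \<Rightarrow> 'a \<Rightarrow> 'a \<Rightarrow> 'a \<Rightarrow> 'a \<Rightarrow> 'a weierstrass"
  where "halved u v a2 a4 a6 \<equiv> Weierstrass (2 * u) a2 (2 * v) a4 a6"

abbreviation completed :: "'a::field_char_0 \<Rightarrow> 'a \<Rightarrow> 'a \<Rightarrow> 'a \<Rightarrow> 'a \<Rightarrow> 'a weierstrass"
  where "completed u v a2 a4 a6 \<equiv> cubic (a2 + u^2) (a4 + 2 * u * v) (a6 + v^2)"

lemma weierstrass_halved_cases:
  fixes W :: "'a::field_char_0 weierstrass"
  obtains u v a2 a4 a6 where "W = halved u v a2 a4 a6"
proof (cases W)
  case (Weierstrass a1 a2 a3 a4 a6)
  then have "W = halved (a1 / 2) (a3 / 2) a2 a4 a6" by simp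
  then show thesis by (rule that)
qed

fun shear :: "'a::field \<Rightarrow> 'a \<Rightarrow> 'a point \<Rightarrow> 'a point"
  where
    "shear u v Infinity = Infinity"
  | "shear u v (Affine x y) = Affine x (y + u * x + v)"

lemma shear_inject [simp]: "shear u v P = shear u v Q \<longleftrightarrow> P = Q"
  by (cases P; cases Q) auto

lemma shear_surj: "\<exists>P. shear u v P = Q"
proof (cases Q)
  case Infinity
  then show ?thesis by (metis shear.simps(1))
next
  case (Affine x y)
  then have "shear u v (Affine x (y - u * x - v)) = Q" by simp
  then show ?thesis by blast
qed

text \<open>The quantities b2, b4, b6 and b8 are unchanged, and the discriminant is a polynomial in
  them.\<close>

lemma weierstrass_disc_completed:
  "weierstrass_disc (completed u v a2 a4 a6) = weierstrass_disc (halved u v a2 a4 a6)"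
proof -
  have "4 * (a2 + u^2) = (2 * u)^2 + 4 * a2" "2 * (a4 + 2 * u * v) = 2 * a4 + 2 * u * (2 * v)"
    "4 * (a6 + v^2) = (2 * v)^2 + 4 * a6"
    "4 * (a2 + u^2) * (a6 + v^2) - (a4 + 2 * u * v)^2 =
      (2 * u)^2 * a6 + 4 * a2 * a6 - 2 * u * (2 * v) * a4 + a2 * (2 * v)^2 - a4^2"
    by (simp_all add: ring_expand)
  then show ?thesis
    unfolding weierstrass_disc.simps Let_def by (simp only: mult_zero_left power_zero_numeral
      add_0_left add_0_right diff_0_right mult_zero_right zero_power2 diff_zero)
qed

lemma on_curve_shear:
  "on_curve (completed u v a2 a4 a6) (shear u v P) \<longleftrightarrow> on_curve (halved u v a2 a4 a6) P"
proof (cases P)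
  case (Affine x y)
  have "(y + u * x + v)^2 - cub (a2 + u^2) (a4 + 2 * u * v) (a6 + v^2) x =
    y^2 + 2 * u * x * y + 2 * v * y - (x^3 + a2 * x^2 + a4 * x + a6)"
    by (simp add: ring_expand)
  then show ?thesis unfolding Affine shear.simps on_curve.simps
    by (metis (no_types, lifting) add.right_neutral eq_iff_diff_eq_0 mult_zero_left)
qed simp

text \<open>The shear maps lines to lines, adding u to the slope and preserving abscissas, so chords
  and tangents correspond.\<close>

lemma shear_add:
  fixes u v :: "'a::field_char_0"
  assumes "on_curve (halved u v a2 a4 a6) P" "on_curve (halved u v a2 a4 a6) Q"
  shows "shear u v (point_add (halved u v a2 a4 a6) P Q) =
    point_add (completed u v a2 a4 a6) (shear u v P) (shear u v Q)"
proof (cases "P = Infinity \<or> Q = Infinity")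
  case True
  then show ?thesis by auto
next
  case False
  then obtain x1 y1 x2 y2 where PQ: "P = Affine x1 y1" "Q = Affine x2 y2"
    by (metis point.exhaust)
  define z1 z2 where z: "z1 = y1 + u * x1 + v" "z2 = y2 + u * x2 + v"
  define A B C where AB: "A = a2 + u^2" "B = a4 + 2 * u * v" "C = a6 + v^2"
  have sh: "shear u v P = Affine x1 z1" "shear u v Q = Affine x2 z2"
    by (simp_all add: PQ z)
  have on: "on_curve (cubic A B C) (Affine x1 z1)" "on_curve (cubic A B C) (Affine x2 z2)"
    using assms unfolding sh[symmetric] AB on_curve_shear .
  have inf: "z1 + z2 = y1 + y2 + 2 * u * x2 + 2 * v" if "x1 = x2"
    using that by (simp add: z)
  show ?thesis
  proof (cases "x1 = x2 \<and> z1 + z2 = 0")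
    case True
    then show ?thesis
      using inf unfolding sh AB[symmetric] by (auto simp: PQ)
  next
    case neg: False
    define l where "l = (if x1 = x2
      then (3 * x1^2 + 2 * a2 * x1 + a4 - 2 * u * y1) / (2 * y1 + 2 * u * x1 + 2 * v)
      else (y2 - y1) / (x2 - x1))"
    define x3 where "x3 = l^2 + 2 * u * l - a2 - x1 - x2"
    have add: "point_add (halved u v a2 a4 a6) P Q =
        Affine x3 (- (l + 2 * u) * x3 - (y1 - l * x1) - 2 * v)"
      unfolding PQ using neg inf by (auto simp: l_def x3_def Let_def)
    have x3: "x3 = (l + u)^2 - A - x1 - x2"
      unfolding x3_def AB by (simp add: ring_expand)
    have y3: "- (l + 2 * u) * x3 - (y1 - l * x1) - 2 * v + u * x3 + v =
        - ((l + u) * (x3 - x1) + z1)" for x3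
      by (simp add: z algebra_simps)
    have "point_add (cubic A B C) (Affine x1 z1) (Affine x2 z2) =
      Affine ((l + u)^2 - A - x1 - x2) (- ((l + u) * (((l + u)^2 - A - x1 - x2) - x1) + z1))"
    proof (cases "x1 = x2")
      case True
      have "z1^2 = z2^2" using on True by simp
      then have "z2 = z1" "z1 \<noteq> 0" using neg True by (auto simp: power2_eq_iff)
      have nz: "2 * z1 \<noteq> 0" using \<open>z1 \<noteq> 0\<close> by simp
      have den: "2 * y1 + 2 * u * x1 + 2 * v = 2 * z1" by (simp add: z)
      have "2 * z1 * l = 3 * x1^2 + 2 * a2 * x1 + a4 - 2 * u * y1"
        unfolding l_def den using True nz by simp
      then have "2 * z1 * (l + u) = 3 * x1^2 + 2 * A * x1 + B"
        unfolding distrib_left by (simp add: AB z ring_expand)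
      from point_add_cubic_tangent[OF nz this] show ?thesis
        using True \<open>z2 = z1\<close> by simp
    next
      case False
      have "y2 = l * (x2 - x1) + y1" using False by (simp add: l_def)
      then have "z2 = (l + u) * (x2 - x1) + z1"
        by (simp add: z algebra_simps)
      from point_add_cubic_chord[OF False this] show ?thesis .
    qed
    then show ?thesis
      unfolding add sh AB[symmetric] shear.simps x3[symmetric] y3 by (rule sym)
  qed
qed

lemma comm_group_curve_group:
  fixes W :: "'a::field_char_0 weierstrass"
  assumes "elliptic_curve W"
  shows "comm_group (curve_group W)"
proof -
  obtain u v a2 a4 a6 where W: "W = halved u v a2 a4 a6" by (rule weierstrass_halved_cases)
  let ?V = "completed u v a2 a4 a6"
  interpret V: comm_group "curve_group ?V"
    by (rule comm_group_curve_group_cubic)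
       (use assms in \<open>simp only: elliptic_curve_def weierstrass_disc_completed W not_False_eq_True\<close>)
  have car: "P \<in> carrier (curve_group W) \<longleftrightarrow> shear u v P \<in> carrier (curve_group ?V)" for P
    by (simp add: W curve_group_def on_curve_shear del: on_curve.simps)
  have mul: "shear u v (P \<otimes>\<^bsub>curve_group W\<^esub> Q) = shear u v P \<otimes>\<^bsub>curve_group ?V\<^esub> shear u v Q"
    if "P \<in> carrier (curve_group W)" "Q \<in> carrier (curve_group W)" for P Q
    using that by (simp add: W curve_group_def shear_add del: point_add.simps on_curve.simps)
  have one: "shear u v \<one>\<^bsub>curve_group W\<^esub> = \<one>\<^bsub>curve_group ?V\<^esub>"
    by (simp add: curve_group_def)
  have clo: "P \<otimes>\<^bsub>curve_group W\<^esub> Q \<in> carrier (curve_group W)"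
    if "P \<in> carrier (curve_group W)" "Q \<in> carrier (curve_group W)" for P Q
    using that by (simp only: car mul V.m_closed)
  show ?thesis
  proof (rule comm_groupI)
    show "\<one>\<^bsub>curve_group W\<^esub> \<in> carrier (curve_group W)"
      by (simp only: car one V.one_closed)
    fix P Q R assume PQR: "P \<in> carrier (curve_group W)" "Q \<in> carrier (curve_group W)"
      "R \<in> carrier (curve_group W)"
    then have "shear u v (P \<otimes>\<^bsub>curve_group W\<^esub> Q \<otimes>\<^bsub>curve_group W\<^esub> R) =
        shear u v (P \<otimes>\<^bsub>curve_group W\<^esub> (Q \<otimes>\<^bsub>curve_group W\<^esub> R))"
      by (simp add: mul clo V.m_assoc car[THEN iffD1])
    then show "P \<otimes>\<^bsub>curve_group W\<^esub> Q \<otimes>\<^bsub>curve_group W\<^esub> R =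
        P \<otimes>\<^bsub>curve_group W\<^esub> (Q \<otimes>\<^bsub>curve_group W\<^esub> R)"
      by (simp only: shear_inject)
  next
    fix P Q assume PQ: "P \<in> carrier (curve_group W)" "Q \<in> carrier (curve_group W)"
    then have "shear u v (P \<otimes>\<^bsub>curve_group W\<^esub> Q) = shear u v (Q \<otimes>\<^bsub>curve_group W\<^esub> P)"
      using V.m_comm[OF car[THEN iffD1] car[THEN iffD1]] by (simp add: mul)
    then show "P \<otimes>\<^bsub>curve_group W\<^esub> Q = Q \<otimes>\<^bsub>curve_group W\<^esub> P"
      by (simp only: shear_inject)
  next
    fix P assume P: "P \<in> carrier (curve_group W)"
    show "\<one>\<^bsub>curve_group W\<^esub> \<otimes>\<^bsub>curve_group W\<^esub> P = P" by (simp add: curve_group_def)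
    obtain Q where Q: "shear u v Q = inv\<^bsub>curve_group ?V\<^esub> (shear u v P)"
      using shear_surj by blast
    have Qc: "Q \<in> carrier (curve_group W)"
      unfolding car Q using P car by blast
    moreover have "shear u v (Q \<otimes>\<^bsub>curve_group W\<^esub> P) = shear u v \<one>\<^bsub>curve_group W\<^esub>"
      unfolding mul[OF Qc P] Q one using P car by (intro V.l_inv) blast
    ultimately show "\<exists>Q\<in>carrier (curve_group W). Q \<otimes>\<^bsub>curve_group W\<^esub> P = \<one>\<^bsub>curve_group W\<^esub>"
      by (auto simp only: shear_inject)
  qed (rule clo)
qed

text \<open>Only the value e of the pairing at the basis is exported. An automorphism raises e to
  the determinant of its matrix; for an antidiagonal matrix this is -ab, and the product form keeps
  the exponent natural.\<close>

theorem weil_pairing_value_exists: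
  fixes W :: "'a::{alg_closed_field, field_char_0} weierstrass" and \<zeta> :: 'a
  defines "G \<equiv> curve_group W"
  assumes ell: "elliptic_curve W" and p: "p \<ge> 2" and \<zeta>: "primitive_root_of_unity p \<zeta>"
    and S: "S \<in> carrier G" "S [^]\<^bsub>G\<^esub> p = \<one>\<^bsub>G\<^esub>" and T: "T \<in> carrier G" "T [^]\<^bsub>G\<^esub> p = \<one>\<^bsub>G\<^esub>"
    and gen: "\<And>Q. Q \<in> carrier G \<Longrightarrow> Q [^]\<^bsub>G\<^esub> p = \<one>\<^bsub>G\<^esub> \<Longrightarrow>
      \<exists>(i::nat) (j::nat). Q = S [^]\<^bsub>G\<^esub> i \<otimes>\<^bsub>G\<^esub> T [^]\<^bsub>G\<^esub> j"
    and card: "card {Q \<in> carrier G. Q [^]\<^bsub>G\<^esub> p = \<one>\<^bsub>G\<^esub>} = p^2"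
  obtains e :: 'a where "e ^ p = 1" "e \<noteq> 1"
    "\<And>\<sigma> \<sigma>' a b. field_hom \<sigma> \<Longrightarrow> field_hom \<sigma>' \<Longrightarrow> (\<And>x. \<sigma>' (\<sigma> x) = x) \<Longrightarrow> (\<And>x. \<sigma> (\<sigma>' x) = x) \<Longrightarrow>
      map_weierstrass \<sigma> W = W \<Longrightarrow> map_point \<sigma> S = S [^]\<^bsub>G\<^esub> (a::nat) \<Longrightarrow>
      map_point \<sigma> T = T [^]\<^bsub>G\<^esub> (b::nat) \<Longrightarrow> \<sigma> e = e ^ (a * b)"
    "\<And>\<sigma> \<sigma>' a b. field_hom \<sigma> \<Longrightarrow> field_hom \<sigma>' \<Longrightarrow> (\<And>x. \<sigma>' (\<sigma> x) = x) \<Longrightarrow> (\<And>x. \<sigma> (\<sigma>' x) = x) \<Longrightarrow>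
      map_weierstrass \<sigma> W = W \<Longrightarrow> map_point \<sigma> S = T [^]\<^bsub>G\<^esub> (a::nat) \<Longrightarrow>
      map_point \<sigma> T = S [^]\<^bsub>G\<^esub> (b::nat) \<Longrightarrow> \<sigma> e * e ^ (a * b) = 1"
proof -
  obtain u v a2 a4 a6 where W: "W = halved u v a2 a4 a6" by (rule weierstrass_halved_cases)
  define A B C where AB: "A = a2 + u^2" "B = a4 + 2 * u * v" "C = a6 + v^2"
  interpret smooth_cubic A B C
    by unfold_locales
      (use ell in \<open>simp only: AB elliptic_curve_def weierstrass_disc_completed W not_False_eq_True\<close>)
  interpret G: comm_group G unfolding G_def by (rule comm_group_curve_group[OF ell])
  let ?sh = "shear u v" and ?V = "cubic A B C"
  let ?add = "point_add ?V" and ?mul = "\<lambda>(k::nat) P. P [^]\<^bsub>curve_group ?V\<^esub> k"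
  have car: "P \<in> carrier G \<longleftrightarrow> on_curve (cubic A B C) (?sh P)" for P
    by (simp add: W G_def curve_group_def AB on_curve_shear del: on_curve.simps)
  have mulG: "?sh (P \<otimes>\<^bsub>G\<^esub> Q) = ?add (?sh P) (?sh Q)"
    if "P \<in> carrier G" "Q \<in> carrier G" for P Q
    using that by (simp add: W G_def curve_group_def AB shear_add del: point_add.simps on_curve.simps)
  have one: "?sh \<one>\<^bsub>G\<^esub> = Infinity"
    by (simp add: G_def curve_group_def)
  have pow: "?sh (P [^]\<^bsub>G\<^esub> k) = ?mul k (?sh P)" if "P \<in> carrier G" for P and k :: nat
  proof (induction k)
    case 0
    then show ?case using one by simp
  next
    case (Suc k)
    then show ?case using that by (simp add: mulG G.nat_pow_Suc mul_Suc del: nat_pow_Suc)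
  qed
  have tor: "tor p (?sh P) \<longleftrightarrow> P \<in> carrier G \<and> P [^]\<^bsub>G\<^esub> p = \<one>\<^bsub>G\<^esub>" for P
  proof (cases "P \<in> carrier G")
    case True
    then show ?thesis
      using pow[OF True, of p] car[of P] one by (metis shear_inject tor_def)
  next
    case False
    then show ?thesis using car[of P] by (simp add: tor_def)
  qed
  have tS: "tor p (?sh S)" and tT: "tor p (?sh T)" using S T tor by auto
  define e where "e = weil p (?sh S) (?sh T)"
  have "{Q. tor p Q} = ?sh ` {Q \<in> carrier G. Q [^]\<^bsub>G\<^esub> p = \<one>\<^bsub>G\<^esub>}"
  proof (intro equalityI subsetI)
    fix Q assume Q: "Q \<in> {Q. tor p Q}"
    obtain P where P: "Q = ?sh P" using shear_surj by metis
    show "Q \<in> ?sh ` {Q \<in> carrier G. Q [^]\<^bsub>G\<^esub> p = \<one>\<^bsub>G\<^esub>}"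
      unfolding P by (rule imageI) (use Q tor[of P] P in simp)
  qed (use tor in auto)
  then have card': "card {Q. tor p Q} = p^2"
    using card by (simp add: card_image inj_on_def)
  have gen': "\<exists>i j. Q = ?add (?mul i (?sh S)) (?mul j (?sh T))" if Q: "tor p Q" for Q
  proof -
    obtain P where P: "?sh P = Q" using shear_surj by metis
    then obtain i j :: nat where "P = S [^]\<^bsub>G\<^esub> i \<otimes>\<^bsub>G\<^esub> T [^]\<^bsub>G\<^esub> j"
      using gen[of P] tor[of P] Q by metis
    then have "Q = ?add (?mul i (?sh S)) (?mul j (?sh T))"
      using P S T by (simp add: mulG pow)
    then show ?thesis by blast
  qed
  have aut: "smooth_cubic_aut A B C \<sigma> \<sigma>'" "\<And>P. map_point \<sigma> (?sh P) = ?sh (map_point \<sigma> P)"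
    if "field_hom \<sigma>" "field_hom \<sigma>'" "\<And>x. \<sigma>' (\<sigma> x) = x" "\<And>x. \<sigma> (\<sigma>' x) = x"
      "map_weierstrass \<sigma> W = W" for \<sigma> \<sigma>'
  proof -
    interpret s: field_hom \<sigma> by fact
    interpret s': field_hom \<sigma>' by fact
    have fx: "\<sigma> u = u" "\<sigma> v = v" "\<sigma> a2 = a2" "\<sigma> a4 = a4" "\<sigma> a6 = a6"
      using that(5) by (auto simp: W)
    show "smooth_cubic_aut A B C \<sigma> \<sigma>'"
      by unfold_locales (auto simp: that(3,4) AB fx)
    show "map_point \<sigma> (?sh P) = ?sh (map_point \<sigma> P)" for P
      by (cases P) (auto simp: fx)
  qed
  have e: "\<sigma> e = weil p (?sh (map_point \<sigma> S)) (?sh (map_point \<sigma> T))"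
    if h: "field_hom \<sigma>" "field_hom \<sigma>'" "\<And>x. \<sigma>' (\<sigma> x) = x" "\<And>x. \<sigma> (\<sigma>' x) = x"
      "map_weierstrass \<sigma> W = W" for \<sigma> \<sigma>'
  proof -
    interpret smooth_cubic_aut A B C \<sigma> \<sigma>' by (rule aut(1)[OF h])
    show ?thesis
      unfolding e_def weil_map[OF tS tT, symmetric] aut(2)[OF h] ..
  qed
  show thesis
  proof (rule that[of e])
    show "e ^ p = 1" unfolding e_def by (rule weil_power[OF tS tT])
    show "e \<noteq> 1" unfolding e_def by (rule weil_nondegenerate[OF p \<zeta> tS tT gen' card'])
  next
    fix \<sigma> \<sigma>' and a b :: nat
    assume h: "field_hom \<sigma>" "field_hom \<sigma>'" "\<And>x. \<sigma>' (\<sigma> x) = x" "\<And>x. \<sigma> (\<sigma>' x) = x"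
      "map_weierstrass \<sigma> W = W"
      and ST: "map_point \<sigma> S = S [^]\<^bsub>G\<^esub> a" "map_point \<sigma> T = T [^]\<^bsub>G\<^esub> b"
    have "\<sigma> e = weil p (?mul a (?sh S)) (?mul b (?sh T))"
      unfolding e[OF h] ST pow[OF S(1)] pow[OF T(1)] ..
    also have "\<dots> = e ^ (a * b)"
      unfolding e_def weil_mul_left[OF tS tor_mul[OF tT]] weil_mul_right[OF tS tT]
      by (simp add: mult.commute flip: power_mult)
    finally show "\<sigma> e = e ^ (a * b)" .
  next
    fix \<sigma> \<sigma>' and a b :: nat
    assume h: "field_hom \<sigma>" "field_hom \<sigma>'" "\<And>x. \<sigma>' (\<sigma> x) = x" "\<And>x. \<sigma> (\<sigma>' x) = x"
      "map_weierstrass \<sigma> W = W"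
      and ST: "map_point \<sigma> S = T [^]\<^bsub>G\<^esub> a" "map_point \<sigma> T = S [^]\<^bsub>G\<^esub> b"
    have "\<sigma> e = weil p (?mul a (?sh T)) (?mul b (?sh S))"
      unfolding e[OF h] ST pow[OF S(1)] pow[OF T(1)] ..
    also have "\<dots> = weil p (?sh T) (?sh S) ^ (a * b)"
      unfolding weil_mul_left[OF tT tor_mul[OF tS]] weil_mul_right[OF tT tS]
      by (simp add: mult.commute flip: power_mult)
    also have "\<dots> = inverse (e ^ (a * b))"
      unfolding weil_swap[OF tS tT] e_def by (simp add: power_inverse)
    finally show "\<sigma> e * e ^ (a * b) = 1"
      using weil_nonzero[OF tS tT] by (simp add: e_def)
  qed
qed

section \<open>Automorphisms of algebraic closures\<close>

definition subfld :: "'a::field set \<Rightarrow> bool"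
  where "subfld M \<longleftrightarrow> 1 \<in> M \<and> (\<forall>x\<in>M. \<forall>y\<in>M. x + y \<in> M \<and> x * y \<in> M) \<and>
    (\<forall>x\<in>M. - x \<in> M \<and> inverse x \<in> M)"

lemma subfldD:
  assumes "subfld M"
  shows "1 \<in> M" "0 \<in> M" "x \<in> M \<Longrightarrow> y \<in> M \<Longrightarrow> x + y \<in> M" "x \<in> M \<Longrightarrow> y \<in> M \<Longrightarrow> x * y \<in> M"
    "x \<in> M \<Longrightarrow> - x \<in> M" "x \<in> M \<Longrightarrow> inverse x \<in> M" "x \<in> M \<Longrightarrow> y \<in> M \<Longrightarrow> x - y \<in> M"
    "x \<in> M \<Longrightarrow> y \<in> M \<Longrightarrow> x / y \<in> M" "x \<in> M \<Longrightarrow> x ^ n \<in> M"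
proof -
  show 1: "1 \<in> M" "x \<in> M \<Longrightarrow> y \<in> M \<Longrightarrow> x + y \<in> M" "x \<in> M \<Longrightarrow> y \<in> M \<Longrightarrow> x * y \<in> M"
    "x \<in> M \<Longrightarrow> - x \<in> M" "x \<in> M \<Longrightarrow> inverse x \<in> M" for x y
    using assms by (auto simp: subfld_def)
  show "0 \<in> M" using 1(2)[OF 1(1) 1(4)[OF 1(1)]] by simp
  show "x \<in> M \<Longrightarrow> y \<in> M \<Longrightarrow> x - y \<in> M" using 1(2)[of x "- y"] 1(4)[of y] by simp
  show "x \<in> M \<Longrightarrow> y \<in> M \<Longrightarrow> x / y \<in> M" using 1(3)[of x "inverse y"] 1(5)[of y] by (simp add: divide_inverse)
  show "x \<in> M \<Longrightarrow> x ^ n \<in> M" using 1(1,3) by (induction n) auto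
qed

definition polys :: "'a::field set \<Rightarrow> 'a poly set"
  where "polys M = {f. \<forall>i. coeff f i \<in> M}"

lemma polys_pCons_iff: "pCons a f \<in> polys M \<longleftrightarrow> a \<in> M \<and> f \<in> polys M"
proof
  assume "pCons a f \<in> polys M"
  then have *: "coeff (pCons a f) i \<in> M" for i by (simp add: polys_def)
  show "a \<in> M \<and> f \<in> polys M"
    using *[of 0] *[of "Suc _"] by (simp add: polys_def)
qed (auto simp: polys_def coeff_pCons split: nat.splits)

definition rel_poly :: "('a::field \<times> 'a) set \<Rightarrow> 'a poly \<Rightarrow> 'a poly \<Rightarrow> bool"
  where "rel_poly R f g \<longleftrightarrow> (\<forall>i. (coeff f i, coeff g i) \<in> R)"

locale algebraic_over =
  fixes M :: "'a::{alg_closed_field, field_char_0} set"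
  assumes subfld: "subfld M"
    and algebraic: "\<And>x. \<exists>f \<in> polys M. f \<noteq> 0 \<and> poly f x = 0"
begin

lemmas M = subfldD[OF subfld]

text \<open>Partial automorphisms over \<open>M\<close> as subrings of the square of the field; the definition is
  symmetric under exchanging the two factors.\<close>

definition good :: "('a \<times> 'a) set \<Rightarrow> bool"
  where "good R \<longleftrightarrow> (\<forall>m\<in>M. (m, m) \<in> R) \<and>
    (\<forall>a b a' b'. (a, b) \<in> R \<longrightarrow> (a', b') \<in> R \<longrightarrow> (a + a', b + b') \<in> R \<and> (a * a', b * b') \<in> R) \<and>
    (\<forall>a b. (a, b) \<in> R \<longrightarrow> (a = 0 \<longleftrightarrow> b = 0))"

lemma goodD:
  assumes "good R"
  shows "m \<in> M \<Longrightarrow> (m, m) \<in> R" "(a, b) \<in> R \<Longrightarrow> (a', b') \<in> R \<Longrightarrow> (a + a', b + b') \<in> R"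
    "(a, b) \<in> R \<Longrightarrow> (a', b') \<in> R \<Longrightarrow> (a * a', b * b') \<in> R" "(a, b) \<in> R \<Longrightarrow> a = 0 \<longleftrightarrow> b = 0"
    "(a, b) \<in> R \<Longrightarrow> (- a, - b) \<in> R" "(a, b) \<in> R \<Longrightarrow> (a', b') \<in> R \<Longrightarrow> (a - a', b - b') \<in> R"
    "(0, 0) \<in> R" "(1, 1) \<in> R"
proof -
  show 1: "m \<in> M \<Longrightarrow> (m, m) \<in> R" "(a, b) \<in> R \<Longrightarrow> (a', b') \<in> R \<Longrightarrow> (a + a', b + b') \<in> R"
    "(a, b) \<in> R \<Longrightarrow> (a', b') \<in> R \<Longrightarrow> (a * a', b * b') \<in> R" "(a, b) \<in> R \<Longrightarrow> a = 0 \<longleftrightarrow> b = 0"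
    for a b a' b' m
    using assms unfolding good_def by blast+
  have "(-1, -1) \<in> R" using 1(1) M(1,5) by blast
  from 1(3)[OF this] show 2: "(a, b) \<in> R \<Longrightarrow> (- a, - b) \<in> R" for a b by force
  show "(a, b) \<in> R \<Longrightarrow> (a', b') \<in> R \<Longrightarrow> (a - a', b - b') \<in> R"
    using 1(2)[of a b "- a'" "- b'"] 2 by simp
  show "(0, 0) \<in> R" "(1, 1) \<in> R" using 1(1) M by blast+
qed

lemma good_converse: "good R \<Longrightarrow> good (R\<inverse>)"
  unfolding good_def by simp

text \<open>The condition on zeros, applied to a difference of two pairs, makes R single-valued;
  applied to the converse relation it gives injectivity.\<close>

lemma good_unique: "good R \<Longrightarrow> (a, b) \<in> R \<Longrightarrow> (a, b') \<in> R \<Longrightarrow> b = b'"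
  using goodD(6)[of R a b a b'] goodD(4)[of R 0 "b - b'"] by simp

lemma rel_poly_add: "good R \<Longrightarrow> rel_poly R f g \<Longrightarrow> rel_poly R f' g' \<Longrightarrow> rel_poly R (f + f') (g + g')"
  and rel_poly_diff: "good R \<Longrightarrow> rel_poly R f g \<Longrightarrow> rel_poly R f' g' \<Longrightarrow> rel_poly R (f - f') (g - g')"
  by (auto simp: rel_poly_def goodD)

lemma good_sum:
  "good R \<Longrightarrow> (\<And>i. i \<in> I \<Longrightarrow> (f i, g i) \<in> R) \<Longrightarrow> (sum f I, sum g I) \<in> R"
  by (induction I rule: infinite_finite_induct) (auto intro: goodD)

lemma rel_poly_mult:
  "good R \<Longrightarrow> rel_poly R f g \<Longrightarrow> rel_poly R f' g' \<Longrightarrow> rel_poly R (f * f') (g * g')"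
  by (auto simp: rel_poly_def coeff_mult intro!: good_sum goodD)

lemma rel_poly_pCons: "(a, b) \<in> R \<Longrightarrow> rel_poly R f g \<Longrightarrow> rel_poly R (pCons a f) (pCons b g)"
  by (auto simp: rel_poly_def coeff_pCons split: nat.splits)

lemma rel_poly_pConsD:
  assumes "rel_poly R (pCons a f) (pCons b g)"
  shows "(a, b) \<in> R" "rel_poly R f g"
  using assms unfolding rel_poly_def
  by (metis coeff_pCons_0, metis coeff_pCons_Suc)

lemma rel_poly_0: "good R \<Longrightarrow> rel_poly R 0 0"
  and rel_poly_1: "good R \<Longrightarrow> rel_poly R 1 1"
  by (auto simp: rel_poly_def goodD coeff_1)

lemma rel_poly_monom: "good R \<Longrightarrow> (a, b) \<in> R \<Longrightarrow> rel_poly R (monom a n) (monom b n)"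
  by (auto simp: rel_poly_def goodD coeff_monom)

lemma rel_poly_degree: "good R \<Longrightarrow> rel_poly R f g \<Longrightarrow> degree f = degree g"
  using goodD(4) unfolding rel_poly_def degree_def by (metis (mono_tags, lifting))

lemma rel_poly_polys: "good R \<Longrightarrow> q \<in> polys M \<Longrightarrow> rel_poly R q q"
  by (auto simp: rel_poly_def polys_def goodD)

lemma rel_poly_pcompose:
  assumes "good R" "rel_poly R u v"
  shows "q \<in> polys M \<Longrightarrow> rel_poly R (pcompose q u) (pcompose q v)"
proof (induction q)
  case 0
  then show ?case using rel_poly_0[OF assms(1)] by simp
next
  case (pCons a q)
  have "rel_poly R (pCons a q) (pCons a q)" using rel_poly_polys[OF assms(1) pCons.prems] .
  from rel_poly_pConsD(1)[OF this] have "(a, a) \<in> R" .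
  moreover have "q \<in> polys M"
    using pCons.prems by (simp add: polys_pCons_iff)
  ultimately show ?case
    using pCons.IH assms
    by (auto simp: pcompose_pCons intro!: rel_poly_add rel_poly_mult rel_poly_pCons rel_poly_0)
qed

text \<open>After powers of x are removed, a relation over M has a nonzero constant term a, and x
  f(x) = -a can be solved for the inverse. Hence rings between M and the whole field are
  fields.\<close>

lemma inverse_as_poly:
  assumes "x \<noteq> 0"
  shows "\<exists>q \<in> polys M. inverse x = poly q x"
proof -
  obtain f where "f \<in> polys M" "f \<noteq> 0" "poly f x = 0" using algebraic by blast
  then show ?thesis
  proof (induction f)
    case (pCons a f)
    have a: "a \<in> M" and f: "f \<in> polys M"
      using pCons.prems(1) by (auto simp: polys_pCons_iff)
    show ?case
    proof (cases "a = 0")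
      case True
      then have "f \<noteq> 0" "poly f x = 0" using pCons assms by auto
      then show ?thesis using pCons.IH f by blast
    next
      case False
      define q where "q = smult (- inverse a) f"
      have "q \<in> polys M" using f a M by (auto simp: q_def polys_def)
      moreover have "inverse x = poly q x"
      proof -
        have "x * poly f x = - a" using pCons.prems(3) by (simp add: eq_neg_iff_add_eq_0 add.commute)
        then have "x * poly q x = 1" using False by (simp add: q_def field_simps)
        then show ?thesis using assms by (simp add: inverse_unique)
      qed
      ultimately show ?thesis by blast
    qed
  qed simp
qed

definition minimal_at :: "('a \<times> 'a) set \<Rightarrow> 'a \<Rightarrow> 'a poly \<Rightarrow> bool"
  where "minimal_at R \<omega> f \<longleftrightarrow> f \<noteq> 0 \<and> poly f \<omega> = 0 \<and>
    (\<forall>u v. rel_poly R u v \<longrightarrow> u \<noteq> 0 \<longrightarrow> poly u \<omega> = 0 \<longrightarrow> degree f \<le> degree u)"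

text \<open>Pseudo-division carried out in parallel on both sides. As R need not contain inverses,
  leading coefficients are multiplied instead of divided by; that of g is nonzero because it
  corresponds to that of f.\<close>

lemma minimal_vanish:
  assumes R: "good R" and fg: "rel_poly R f g" and min: "minimal_at R \<omega> f" and g: "poly g \<omega>' = 0"
  shows "rel_poly R u v \<Longrightarrow> poly u \<omega> = 0 \<Longrightarrow> poly v \<omega>' = 0"
proof (induction "degree u" arbitrary: u v rule: less_induct)
  case less
  have f: "f \<noteq> 0" "poly f \<omega> = 0" using min by (auto simp: minimal_at_def)
  show ?case
  proof (cases "u = 0")
    case True
    then have "v = 0"
      using less.prems(1) goodD(4)[OF R] by (auto simp: rel_poly_def poly_eq_iff)
    then show ?thesis by simp
  next
    case False
    then have le: "degree f \<le> degree u" using min less.prems by (auto simp: minimal_at_def)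
    define k where "k = degree u - degree f"
    define u1 where "u1 = [:lead_coeff f:] * u - monom (lead_coeff u) k * f"
    define v1 where "v1 = [:lead_coeff g:] * v - monom (lead_coeff v) k * g"
    have deg: "degree f = degree g" "degree u = degree v"
      using rel_poly_degree[OF R] fg less.prems by auto
    have "(lead_coeff f, lead_coeff g) \<in> R" "(lead_coeff u, lead_coeff v) \<in> R"
      using fg less.prems(1) deg unfolding rel_poly_def by metis+
    then have rel: "rel_poly R u1 v1"
      unfolding u1_def v1_def
      by (intro rel_poly_diff rel_poly_mult rel_poly_monom rel_poly_pCons rel_poly_0 R fg less.prems)
    have root: "poly u1 \<omega> = 0" using f less.prems by (simp add: u1_def)
    have "poly v1 \<omega>' = 0"
    proof (cases "u1 = 0")
      case True
      then have "v1 = 0"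
        using rel goodD(4)[OF R] by (auto simp: rel_poly_def poly_eq_iff)
      then show ?thesis by simp
    next
      case u1: False
      have "degree u1 < degree u"
      proof (rule ccontr)
        assume "\<not> degree u1 < degree u"
        moreover have "degree u1 \<le> degree u"
          unfolding u1_def
        proof (rule degree_diff_le)
          show "degree ([:lead_coeff f:] * u) \<le> degree u" by (simp add: degree_smult_le)
          have "degree (monom (lead_coeff u) k * f) \<le> k + degree f"
            using degree_mult_le[of "monom (lead_coeff u) k" f] degree_monom_le[of "lead_coeff u" k]
            by linarith
          then show "degree (monom (lead_coeff u) k * f) \<le> degree u" using le by (simp add: k_def)
        qed
        ultimately have d: "degree u1 = degree u" by simp
        have "coeff (monom (lead_coeff u) k * f) (degree u) = lead_coeff u * lead_coeff f"
          using le by (simp add: coeff_monom_mult k_def)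
        then have "coeff u1 (degree u) = 0" by (simp add: u1_def)
        with d u1 show False by (metis leading_coeff_0_iff)
      qed
      then show ?thesis using less.hyps rel root by blast
    qed
    then have "lead_coeff g * poly v \<omega>' = 0" using g by (simp add: v1_def)
    moreover have "lead_coeff g \<noteq> 0"
    proof -
      have "(lead_coeff f, lead_coeff g) \<in> R" using fg deg unfolding rel_poly_def by metis
      then show ?thesis using goodD(4)[OF R] f(1) by (metis leading_coeff_0_iff)
    qed
    ultimately show ?thesis by simp
  qed
qed

lemma extend_root:
  assumes R: "good R" and fg: "rel_poly R f g" and min: "minimal_at R \<omega> f" and g: "poly g \<omega>' = 0"
  shows "\<exists>R'. good R' \<and> R \<subseteq> R' \<and> (\<omega>, \<omega>') \<in> R'"
proof -
  define R' where "R' = {(poly u \<omega>, poly v \<omega>') | u v. rel_poly R u v}"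
  have I: "rel_poly R u v \<Longrightarrow> a = poly u \<omega> \<Longrightarrow> b = poly v \<omega>' \<Longrightarrow> (a, b) \<in> R'" for u v a b
    by (auto simp: R'_def)
  have sub: "R \<subseteq> R'"
  proof
    fix x assume "x \<in> R"
    then obtain a b where ab: "x = (a, b)" "(a, b) \<in> R" by (cases x) auto
    then show "x \<in> R'"
      unfolding ab(1) by (intro I[OF rel_poly_pCons[OF _ rel_poly_0[OF R]]]) auto
  qed
  have "good R'"
    unfolding good_def
  proof (intro conjI allI ballI impI)
    show "(m, m) \<in> R'" if "m \<in> M" for m using sub goodD(1)[OF R that] by blast
    fix a b assume ab: "(a, b) \<in> R'"
    then obtain u v where uv: "rel_poly R u v" "a = poly u \<omega>" "b = poly v \<omega>'"
      by (auto simp: R'_def)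
    show "(a + a', b + b') \<in> R'" "(a * a', b * b') \<in> R'" if ab': "(a', b') \<in> R'" for a' b'
    proof -
      obtain u' v' where uv': "rel_poly R u' v'" "a' = poly u' \<omega>" "b' = poly v' \<omega>'"
        using ab' by (auto simp: R'_def)
      show "(a + a', b + b') \<in> R'"
        by (rule I[OF rel_poly_add[OF R uv(1) uv'(1)]]) (auto simp: uv uv')
      show "(a * a', b * b') \<in> R'"
        by (rule I[OF rel_poly_mult[OF R uv(1) uv'(1)]]) (auto simp: uv uv')
    qed
    show "a = 0 \<longleftrightarrow> b = 0"
    proof
      assume "a = 0"
      then show "b = 0" using minimal_vanish[OF R fg min g uv(1)] uv by simp
    next
      assume "b = 0"
      show "a = 0"
      proof (rule ccontr)
        assume "a \<noteq> 0"
        then obtain q where q: "q \<in> polys M" "inverse a = poly q a"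
          using inverse_as_poly by blast
        \<comment> \<open>Minimality is known for f only, so this direction goes through the
          inverse: 1/a = q(a) with q over M, and the relation u q(u) = 1 at \<omega> transfers to
          \<omega>', where v vanishes.\<close>
        have "rel_poly R (u * pcompose q u - 1) (v * pcompose q v - 1)"
          by (intro rel_poly_diff rel_poly_mult rel_poly_pcompose rel_poly_1 R uv q)
        moreover have "poly (u * pcompose q u - 1) \<omega> = 0"
          using q(2) \<open>a \<noteq> 0\<close> by (simp add: poly_pcompose flip: uv(2)) (simp flip: q(2))
        ultimately have "poly (v * pcompose q v - 1) \<omega>' = 0"
          by (rule minimal_vanish[OF R fg min g])
        then show False using \<open>b = 0\<close> by (simp flip: uv(3))
      qed
    qed
  qed
  moreover have "(\<omega>, \<omega>') \<in> R'"
    by (rule I[of "[:0, 1:]" "[:0, 1:]"])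
       (auto intro!: rel_poly_pCons rel_poly_0 R goodD(7)[OF R] goodD(8)[OF R])
  ultimately show ?thesis using sub by blast
qed

text \<open>A relation of least degree over the domain of R plays the part of the minimal
  polynomial; its counterpart g has the same positive degree and therefore a root.\<close>

lemma extend_domain:
  assumes R: "good R"
  shows "\<exists>R' \<omega>'. good R' \<and> R \<subseteq> R' \<and> (\<omega>, \<omega>') \<in> R'"
proof -
  obtain f0 where f0: "f0 \<in> polys M" "f0 \<noteq> 0" "poly f0 \<omega> = 0" using algebraic by blast
  define Q where "Q = (\<lambda>f. \<exists>g. rel_poly R f g \<and> f \<noteq> 0 \<and> poly f \<omega> = 0)"
  have "Q f0" using f0 rel_poly_polys[OF R] by (auto simp: Q_def)
  then obtain f where f: "Q f" "\<And>u. Q u \<Longrightarrow> degree f \<le> degree u"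
    using ex_has_least_nat[of Q f0 degree] by blast
  then obtain g where g: "rel_poly R f g" "f \<noteq> 0" "poly f \<omega> = 0" by (auto simp: Q_def)
  have min: "minimal_at R \<omega> f" using f(2) g by (auto simp: minimal_at_def Q_def)
  have "degree f > 0"
    using g by (metis degree_eq_zeroE gr0I pCons_0_0 poly_const_conv)
  then obtain \<omega>' where "poly g \<omega>' = 0"
    using alg_closed_imp_poly_has_root[of g] rel_poly_degree[OF R g(1)] by auto
  then show ?thesis using extend_root[OF R g(1) min] by blast
qed

lemma good_maximal:
  assumes "good R0"
  shows "\<exists>R. good R \<and> R0 \<subseteq> R \<and> (\<forall>R'. good R' \<longrightarrow> R \<subseteq> R' \<longrightarrow> R' = R)"
proof -
  let ?\<A> = "{R. good R \<and> R0 \<subseteq> R}"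
  have "\<exists>R\<in>?\<A>. \<forall>R'\<in>?\<A>. R \<subseteq> R' \<longrightarrow> R' = R"
  proof (rule subset_Zorn_nonempty)
    show "?\<A> \<noteq> {}" using assms by blast
    fix \<C> assume ne: "\<C> \<noteq> {}" and ch: "subset.chain ?\<A> \<C>"
    have mem: "good R" "R0 \<subseteq> R" if "R \<in> \<C>" for R
      using ch that by (auto simp: subset_chain_def)
    have lin: "R \<subseteq> R' \<or> R' \<subseteq> R" if "R \<in> \<C>" "R' \<in> \<C>" for R R'
      using ch that by (auto simp: subset_chain_def)
    have two: "\<exists>R\<in>\<C>. x \<in> R \<and> y \<in> R" if xy: "x \<in> \<Union>\<C>" "y \<in> \<Union>\<C>" for x y
    proof -
      obtain R R' where "R \<in> \<C>" "x \<in> R" "R' \<in> \<C>" "y \<in> R'" using xy by blast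
      then show ?thesis using lin[of R R'] by blast
    qed
    have "good (\<Union>\<C>)"
      unfolding good_def
    proof (intro conjI allI ballI impI)
      show "(m, m) \<in> \<Union>\<C>" if "m \<in> M" for m
        using ne mem(1) goodD(1)[OF _ that] by blast
      show "(a + a', b + b') \<in> \<Union>\<C>" "(a * a', b * b') \<in> \<Union>\<C>"
        if ab: "(a, b) \<in> \<Union>\<C>" "(a', b') \<in> \<Union>\<C>" for a b a' b'
      proof -
        obtain R where R: "R \<in> \<C>" "(a, b) \<in> R" "(a', b') \<in> R" using two[OF ab] by blast
        then show "(a + a', b + b') \<in> \<Union>\<C>" "(a * a', b * b') \<in> \<Union>\<C>"
          using goodD(2,3)[OF mem(1)[OF R(1)] R(2,3)] by blast+
      qed
      show "a = 0 \<longleftrightarrow> b = 0" if ab: "(a, b) \<in> \<Union>\<C>" for a b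
      proof -
        obtain R where "R \<in> \<C>" "(a, b) \<in> R" using ab by blast
        then show ?thesis using goodD(4)[OF mem(1)] by blast
      qed
    qed
    moreover have "R0 \<subseteq> \<Union>\<C>"
    proof -
      obtain R where "R \<in> \<C>" using ne by blast
      with mem(2)[OF this] show ?thesis by blast
    qed
    ultimately show "\<Union>\<C> \<in> ?\<A>" by simp
  qed
  then obtain R where R: "R \<in> ?\<A>" and max: "\<forall>R'\<in>?\<A>. R \<subseteq> R' \<longrightarrow> R' = R"
    by (rule bexE)
  have "R' = R" if "good R'" "R \<subseteq> R'" for R'
    using max[rule_format, of R'] R that by auto
  then show ?thesis using R by (intro exI[of _ R]) auto
qed

text \<open>The minimal polynomial of \<alpha> over M has degree at least 2 and, being separable, a
  root \<beta> other than \<alpha>. A maximal extension of \<alpha> -> \<beta> is total, and so is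
  its converse.\<close>

theorem automorphism_moving:
  assumes "\<alpha> \<notin> M"
  obtains \<sigma> \<sigma>' where "field_hom \<sigma>" "field_hom \<sigma>'" "\<And>x. \<sigma>' (\<sigma> x) = x" "\<And>x. \<sigma> (\<sigma>' x) = x"
    "\<And>m. m \<in> M \<Longrightarrow> \<sigma> m = m" "\<sigma> \<alpha> \<noteq> \<alpha>"
proof -
  define D where "D = {(m, m) | m. m \<in> M}"
  have D: "good D" using M by (auto simp: good_def D_def)
  have relD: "rel_poly D f g \<longleftrightarrow> f = g \<and> f \<in> polys M" for f g
    by (auto simp: rel_poly_def D_def polys_def poly_eq_iff)
  obtain f0 where f0: "f0 \<in> polys M" "f0 \<noteq> 0" "poly f0 \<alpha> = 0" using algebraic by blast
  define Q where "Q = (\<lambda>f. f \<in> polys M \<and> f \<noteq> 0 \<and> poly f \<alpha> = 0)"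
  obtain f where f: "Q f" "\<And>u. Q u \<Longrightarrow> degree f \<le> degree u"
    using ex_has_least_nat[of Q f0 degree] f0 by (auto simp: Q_def)
  then have f': "f \<in> polys M" "f \<noteq> 0" "poly f \<alpha> = 0" by (auto simp: Q_def)
  have min: "minimal_at D \<alpha> f" using f(2) f' by (auto simp: minimal_at_def relD Q_def)
  obtain h where h: "f = [:- \<alpha>, 1:] * h" using f'(3) by (metis dvdE poly_eq_0_iff_dvd)
  with f'(2) have h0: "h \<noteq> 0" by auto
  then have dh: "degree f = Suc (degree h)" unfolding h by (subst degree_mult_eq) auto
  have "degree h > 0"
  proof (rule ccontr)
    assume "\<not> degree h > 0"
    then obtain k where k: "h = [:k:]" by (metis degree_eq_zeroE gr0I)
    then have "f = [:- \<alpha> * k, k:]" using h by simp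
    then have "- \<alpha> * k \<in> M" "k \<in> M" using f'(1) by (auto simp: polys_pCons_iff)
    then have "- (- \<alpha> * k) / k \<in> M" by (intro M(8) M(5))
    moreover have "k \<noteq> 0" using h0 k by auto
    ultimately show False using assms by simp
  qed
  then obtain \<beta> where \<beta>: "poly h \<beta> = 0" using alg_closed_imp_poly_has_root by blast
  \<comment> \<open>Otherwise \<alpha> would be a root of the derivative, a nonzero polynomial over
    M of smaller degree.\<close>
  have "\<beta> \<noteq> \<alpha>"
  proof
    assume "\<beta> = \<alpha>"
    then have "poly (pderiv f) \<alpha> = 0"
      unfolding h pderiv_mult using \<beta> by (simp add: pderiv_pCons)
    moreover have "pderiv f \<noteq> 0" using dh by (simp add: pderiv_eq_0_iff)
    moreover have "pderiv f \<in> polys M"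
    proof -
      have "of_nat n \<in> M" for n using M(1,2,3) by (induction n) auto
      then show ?thesis using f'(1) M(4) by (auto simp: polys_def coeff_pderiv simp del: of_nat_Suc)
    qed
    ultimately have "degree f \<le> degree (pderiv f)" using f(2) by (simp add: Q_def)
    then show False using dh by (simp add: degree_pderiv)
  qed
  have "poly f \<beta> = 0" unfolding h using \<beta> by simp
  then obtain R0 where R0: "good R0" "(\<alpha>, \<beta>) \<in> R0"
    using extend_root[OF D _ min, of f \<beta>] f' relD by blast
  obtain R where R: "good R" "R0 \<subseteq> R" and max: "\<And>R'. good R' \<Longrightarrow> R \<subseteq> R' \<Longrightarrow> R' = R"
    using good_maximal[OF R0(1)] by blast
  have dom: "\<exists>y. (x, y) \<in> R" for x
    using extend_domain[OF R(1), of x] max by blast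
  \<comment> \<open>The notion \<open>good\<close> is symmetric, so extending the domain of the
    converse yields surjectivity.\<close>
  have ran: "\<exists>y. (y, x) \<in> R" for x
  proof -
    obtain R' \<omega>' where R': "good R'" "R\<inverse> \<subseteq> R'" "(x, \<omega>') \<in> R'"
      using extend_domain[OF good_converse[OF R(1)], of x] by blast
    have "R \<subseteq> R'\<inverse>" using R'(2) by auto
    then have "R'\<inverse> = R" by (rule max[OF good_converse[OF R'(1)]])
    then show ?thesis using R'(3) by blast
  qed
  define \<sigma> where "\<sigma> = (\<lambda>x. SOME y. (x, y) \<in> R)"
  define \<sigma>' where "\<sigma>' = (\<lambda>x. SOME y. (y, x) \<in> R)"
  have s: "(x, \<sigma> x) \<in> R" and s': "(\<sigma>' x, x) \<in> R" for x
    using someI_ex[OF dom[of x]] someI_ex[OF ran[of x]] by (auto simp: \<sigma>_def \<sigma>'_def)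
  have u: "(x, y) \<in> R \<Longrightarrow> \<sigma> x = y" for x y using good_unique[OF R(1) s] .
  have u': "(x, y) \<in> R \<Longrightarrow> \<sigma>' y = x" for x y
    using good_unique[OF good_converse[OF R(1)], of y "\<sigma>' y" x] s' by simp
  show thesis
  proof (rule that[of \<sigma> \<sigma>'])
    show "field_hom \<sigma>"
      by unfold_locales (auto intro!: u goodD[OF R(1)] s)
    show "field_hom \<sigma>'"
      by unfold_locales (auto intro!: u' goodD[OF R(1)] s')
    show "\<sigma>' (\<sigma> x) = x" "\<sigma> (\<sigma>' x) = x" for x using u u' s s' by blast+
    show "\<sigma> m = m" if "m \<in> M" for m using u goodD(1)[OF R(1) that] by blast
    show "\<sigma> \<alpha> \<noteq> \<alpha>" using u[of \<alpha> \<beta>] R0(2) R(2) \<open>\<beta> \<noteq> \<alpha>\<close> by blast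
  qed
qed

end

section \<open>Fields generated by torsion points\<close>

interpretation ac: cring "ac_ring :: 'k::field alg_closure ring"
  by (rule cring_from_type_algebra)

lemma ac_ring_simps [simp]:
  "carrier (ac_ring :: 'k::field alg_closure ring) = UNIV"
  "x \<otimes>\<^bsub>ac_ring\<^esub> y = (x * y :: 'k alg_closure)" "x \<oplus>\<^bsub>ac_ring\<^esub> y = (x + y :: 'k alg_closure)"
  "\<one>\<^bsub>ac_ring\<^esub> = (1 :: 'k alg_closure)" "\<zero>\<^bsub>ac_ring\<^esub> = (0 :: 'k alg_closure)"
  by (auto simp: ring_of_type_algebra_def)

lemma ac_ring_uminus [simp]: "\<ominus>\<^bsub>ac_ring\<^esub> x = - (x :: 'k::field alg_closure)"
  by (rule ac.minus_equality) auto

lemma ac_ring_inverse: "x \<noteq> 0 \<Longrightarrow> inv\<^bsub>ac_ring\<^esub> x = inverse (x :: 'k::field alg_closure)"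
  by (rule ac.comm_inv_char) auto

lemma subfld_adjoin: "subfld (adjoin S)"
  unfolding subfld_def
proof (intro conjI ballI)
  note [simp del] = ac_ring_simps
  show "1 \<in> adjoin S"
    using generate_field.one[of ac_ring "range to_ac \<union> S"] by (simp add: adjoin_def ac_ring_simps)
  show "x + y \<in> adjoin S" "x * y \<in> adjoin S" if "x \<in> adjoin S" "y \<in> adjoin S" for x y
    using that generate_field.eng_add[of x ac_ring "range to_ac \<union> S" y]
      generate_field.eng_mult[of x ac_ring "range to_ac \<union> S" y]
    by (simp_all add: adjoin_def ac_ring_simps)
  show "- x \<in> adjoin S" if "x \<in> adjoin S" for x
    using that generate_field.a_inv[of x ac_ring "range to_ac \<union> S"] by (simp add: adjoin_def)
  show "inverse x \<in> adjoin S" if "x \<in> adjoin S" for x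
    using that generate_field.m_inv[of x ac_ring "range to_ac \<union> S"]
    by (cases "x = 0") (simp_all add: adjoin_def ac_ring_simps ac_ring_inverse)
qed

lemma to_ac_in_adjoin: "to_ac x \<in> adjoin S"
  and in_adjoin: "s \<in> S \<Longrightarrow> s \<in> adjoin S"
  by (auto simp: adjoin_def intro: generate_field.incl)

lemma adjoin_min:
  assumes "subfld M" "\<And>x. to_ac x \<in> M" "S \<subseteq> M"
  shows "adjoin S \<subseteq> M"
proof
  fix x assume "x \<in> adjoin S"
  then show "x \<in> M"
    unfolding adjoin_def
  proof (induction rule: generate_field.induct)
    case (incl h)
    then show ?case using assms by auto
  qed (use subfldD[OF assms(1)] in \<open>auto simp: ac_ring_inverse\<close>)
qed

lemma algebraic_over_adjoin:
  fixes S :: "'k::field_char_0 alg_closure set"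
  shows "algebraic_over (adjoin S)"
proof
  fix x :: "'k alg_closure"
  obtain q :: "'k poly" where q: "q \<noteq> 0" "poly (map_poly to_ac q) x = 0"
    by (rule alg_closure_algebraic)
  interpret h: field_hom "to_ac :: 'k \<Rightarrow> 'k alg_closure" by (rule field_hom_to_ac)
  have "map_poly to_ac q \<in> polys (adjoin S)" "map_poly to_ac q \<noteq> 0"
    using q(1) by (auto simp: polys_def coeff_map_poly to_ac_in_adjoin)
  then show "\<exists>f\<in>polys (adjoin S). f \<noteq> 0 \<and> poly f x = 0" using q(2) by blast
qed (rule subfld_adjoin)

section \<open>Automorphisms of the algebraic closure over the base field\<close>

locale ac_aut = s: field_hom \<sigma> + s': field_hom \<sigma>'
  for \<sigma> \<sigma>' :: "'k::field_char_0 alg_closure \<Rightarrow> 'k alg_closure" +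
  assumes inverse_left [simp]: "\<sigma>' (\<sigma> x) = x" and inverse_right [simp]: "\<sigma> (\<sigma>' x) = x"
    and fixed [simp]: "\<sigma> (to_ac k) = to_ac k"
begin

lemma fixed' [simp]: "\<sigma>' (to_ac k) = to_ac k"
  using inverse_left[of "to_ac k"] by simp

lemma flip: "ac_aut \<sigma>' \<sigma>"
  by unfold_locales auto

lemma fixes_adjoin:
  assumes "\<And>s. s \<in> S \<Longrightarrow> \<sigma> s = s" "x \<in> adjoin S"
  shows "\<sigma> x = x"
proof -
  have "adjoin S \<subseteq> {x. \<sigma> x = x}"
    by (rule adjoin_min) (use assms(1) in \<open>auto simp: subfld_def\<close>)
  then show ?thesis using assms(2) by blast
qed

lemma maps_adjoin:
  assumes "\<And>s. s \<in> S \<Longrightarrow> \<sigma> s \<in> adjoin S" "x \<in> adjoin S"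
  shows "\<sigma> x \<in> adjoin S"
proof -
  have "adjoin S \<subseteq> {x. \<sigma> x \<in> adjoin S}"
    by (rule adjoin_min)
       (use assms(1) subfldD[OF subfld_adjoin] to_ac_in_adjoin in \<open>auto simp: subfld_def\<close>)
  then show ?thesis using assms(2) by blast
qed

lemma galois_group_adjoin:
  assumes "\<And>s. s \<in> S \<Longrightarrow> \<sigma> s \<in> adjoin S" "\<And>s. s \<in> S \<Longrightarrow> \<sigma>' s \<in> adjoin S"
  shows "\<sigma> \<in> galois_group (adjoin S)"
proof -
  have m: "\<sigma> x \<in> adjoin S" if "x \<in> adjoin S" for x
    using maps_adjoin assms(1) that by blast
  have m': "\<sigma>' x \<in> adjoin S" if "x \<in> adjoin S" for x
    using ac_aut.maps_adjoin[OF flip] assms(2) that by blast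
  have "bij_betw \<sigma> (adjoin S) (adjoin S)"
    by (rule bij_betw_byWitness[of _ \<sigma>']) (use m m' in auto)
  then show ?thesis
    using m by (auto simp: galois_group_def ring_iso_def ring_hom_def)
qed

lemma map_base_change [simp]: "map_weierstrass \<sigma> (base_change_ac E) = base_change_ac E"
  by (cases E) (simp add: base_change_ac_def)

lemma map_point_pow:
  "map_point \<sigma> (P [^]\<^bsub>geom_group E\<^esub> (n::nat)) = map_point \<sigma> P [^]\<^bsub>geom_group E\<^esub> n"
proof (induction n)
  case (Suc n)
  then show ?case
    using s.map_point_add[of "base_change_ac E" "P [^]\<^bsub>geom_group E\<^esub> n" P]
    by (simp add: curve_group_def)
qed (simp add: curve_group_def)

lemma map_point_mult:
  "map_point \<sigma> (P \<otimes>\<^bsub>geom_group E\<^esub> Q) = map_point \<sigma> P \<otimes>\<^bsub>geom_group E\<^esub> map_point \<sigma> Q"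
  using s.map_point_add[of "base_change_ac E" P Q] by (simp add: curve_group_def)

lemma map_torsion:
  assumes "P \<in> torsion E n"
  shows "map_point \<sigma> P \<in> torsion E n"
proof -
  have "map_point \<sigma> (P [^]\<^bsub>geom_group E\<^esub> n) = \<one>\<^bsub>geom_group E\<^esub>"
    using assms by (simp add: torsion_def curve_group_def)
  moreover have "map_point \<sigma> P \<in> carrier (geom_group E)"
    using assms s.on_curve_map[of "base_change_ac E" P] by (simp add: torsion_def curve_group_def)
  ultimately show ?thesis by (simp add: torsion_def map_point_pow)
qed

text \<open>Torsion points are permuted, so every automorphism of the closure restricts to the
  torsion field and is subject to the matrix hypothesis.\<close>

lemma galois_group_torsion_field: "\<sigma> \<in> galois_group (torsion_field E n)"
  unfolding torsion_field_def
proof (rule galois_group_adjoin)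
  fix s assume "s \<in> (\<Union>P\<in>torsion E n. set_point P)"
  then obtain P where P: "P \<in> torsion E n" "s \<in> set_point P" by blast
  have "\<sigma> s \<in> set_point (map_point \<sigma> P)" "\<sigma>' s \<in> set_point (map_point \<sigma>' P)"
    using P(2) by (auto simp: point.set_map)
  moreover have "map_point \<sigma> P \<in> torsion E n" "map_point \<sigma>' P \<in> torsion E n"
    using map_torsion ac_aut.map_torsion[OF flip] P(1) by auto
  ultimately show "\<sigma> s \<in> adjoin (\<Union>P\<in>torsion E n. set_point P)"
    "\<sigma>' s \<in> adjoin (\<Union>P\<in>torsion E n. set_point P)"
    by (auto intro!: in_adjoin)
qed

end

text \<open>The half of the Galois correspondence that is used: an element fixed by all
  automorphisms fixing S lies in \<open>adjoin S\<close>.\<close>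

lemma ac_aut_moving:
  fixes S :: "'k::field_char_0 alg_closure set"
  assumes "\<alpha> \<notin> adjoin S"
  obtains \<sigma> \<sigma>' where "ac_aut \<sigma> \<sigma>'" "\<And>s. s \<in> S \<Longrightarrow> \<sigma> s = s" "\<sigma> \<alpha> \<noteq> \<alpha>"
proof -
  interpret algebraic_over "adjoin S" by (rule algebraic_over_adjoin)
  obtain \<sigma> \<sigma>' where s: "field_hom \<sigma>" "field_hom \<sigma>'" "\<And>x. \<sigma>' (\<sigma> x) = x" "\<And>x. \<sigma> (\<sigma>' x) = x"
    "\<And>m. m \<in> adjoin S \<Longrightarrow> \<sigma> m = m" "\<sigma> \<alpha> \<noteq> \<alpha>"
    using automorphism_moving[OF assms] by metis
  have "ac_aut \<sigma> \<sigma>'"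
    using s by (intro ac_aut.intro ac_aut_axioms.intro) (auto simp: to_ac_in_adjoin)
  then show thesis using that s(5,6) in_adjoin by metis
qed

section \<open>Roots of unity, horizontal lines and elements of order 3 modulo p\<close>

lemma root_of_unity_power_of_primitive:
  fixes z w :: "'a::field"
  assumes "primitive_root_of_unity n z" "w ^ n = 1" "n > 0"
  shows "\<exists>i<n. w = z ^ i"
proof -
  have z0: "z \<noteq> 0" using primitive_root_nonzero[OF assms(1,3)] .
  define f :: "'a poly" where "f = monom 1 n - 1"
  have "coeff f n = 1" using assms(3) by (simp add: f_def)
  then have f0: "f \<noteq> 0" by auto
  have deg: "degree f \<le> n"
    unfolding f_def by (rule degree_diff_le) (auto simp: degree_monom_le)
  have roots: "{x. poly f x = 0} = {x. x ^ n = 1}"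
    by (auto simp: f_def poly_monom)
  have fin: "finite {x. poly f x = 0}" by (rule poly_roots_finite[OF f0])
  have inj: "inj_on (\<lambda>i. z ^ i) {..<n}"
  proof (rule linorder_inj_onI)
    fix i j assume ij: "i < j" "i \<in> {..<n}" "j \<in> {..<n}"
    show "z ^ i \<noteq> z ^ j"
    proof
      assume "z ^ i = z ^ j"
      moreover have "z ^ j = z ^ i * z ^ (j - i)"
        using ij(1) by (metis le_add_diff_inverse less_imp_le power_add)
      ultimately have "z ^ i * z ^ (j - i) = z ^ i * 1" by simp
      then have "z ^ (j - i) = 1" using z0 by simp
      then show False using assms(1) ij by (auto simp: primitive_root_of_unity_def)
    qed
  qed auto
  have "(\<lambda>i. z ^ i) ` {..<n} = {x. poly f x = 0}"
  proof (rule card_seteq[OF fin])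
    have "z ^ n = 1" using assms(1) by (simp add: primitive_root_of_unity_def)
    then have "(z ^ i) ^ n = 1" for i by (metis mult.commute power_mult power_one)
    then show "(\<lambda>i. z ^ i) ` {..<n} \<subseteq> {x. poly f x = 0}" unfolding roots by auto
    have "card {x. poly f x = 0} \<le> n" using card_poly_roots_bound[OF f0] deg by linarith
    then show "card {x. poly f x = 0} \<le> card ((\<lambda>i. z ^ i) ` {..<n})"
      using card_image[OF inj] by simp
  qed
  then have "w \<in> (\<lambda>i. z ^ i) ` {..<n}" using assms(2) roots by blast
  then show ?thesis by auto
qed

lemma power_eq_1_iff_dvd:
  fixes e :: "'a::field"
  assumes "prime p" "e ^ p = 1" "e \<noteq> 1"
  shows "e ^ n = 1 \<longleftrightarrow> p dvd n"
proof
  assume "p dvd n"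
  then show "e ^ n = 1" using assms(2) by (auto elim!: dvdE simp: power_mult)
next
  assume n: "e ^ n = 1"
  show "p dvd n"
  proof (rule ccontr)
    assume "\<not> p dvd n"
    then have "coprime n p" using assms(1) by (metis coprime_commute prime_imp_coprime)
    then obtain x where x: "[n * x = 1] (mod p)" using cong_solve_coprime_nat by auto
    have "p > 1" using assms(1) prime_gt_1_nat by blast
    then have "(n * x) mod p = 1" using x by (simp add: cong_def)
    then have "n * x = p * ((n * x) div p) + 1" by (metis mult_div_mod_eq)
    then have "e ^ (n * x) = (e ^ p) ^ ((n * x) div p) * e"
      by (metis power_add power_mult power_one_right)
    then show False using assms n by (simp add: power_mult)
  qed
qed

lemma primitive_root_of_prime_order:
  fixes e :: "'a::field"
  assumes "prime p" "e ^ p = 1" "e \<noteq> 1"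
  shows "primitive_root_of_unity p e"
  using assms power_eq_1_iff_dvd[OF assms] unfolding primitive_root_of_unity_def
  by (auto dest: dvd_imp_le)

text \<open>The three points are the complete intersection of the curve with a line of slope
  0.\<close>

lemma horizontal_line_sum:
  fixes u :: "'a::field"
  assumes "on_curve W (Affine u y)" "on_curve W (Affine v y)" "on_curve W (Affine w y)"
    and "u \<noteq> v" "u \<noteq> w" "v \<noteq> w"
  shows "point_add W (point_add W (Affine u y) (Affine v y)) (Affine w y) = Infinity"
proof (cases W)
  case (Weierstrass a1 a2 a3 a4 a6)
  \<comment> \<open>Divided difference of the curve equation at height y; subtracting two instances
    gives Vieta's relation u + v + w + a2 = 0.\<close>
  define q where "q = (\<lambda>s t. s^2 + s * t + t^2 + a2 * (s + t) + a4 - a1 * y)"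
  have diff: "(s - t) * q s t = 0"
    if "on_curve W (Affine s y)" "on_curve W (Affine t y)" for s t
  proof -
    have "(s - t) * q s t = (s^3 + a2 * s^2 + a4 * s + a6 - (y^2 + a1 * s * y + a3 * y))
        - (t^3 + a2 * t^2 + a4 * t + a6 - (y^2 + a1 * t * y + a3 * y))"
      by (simp add: q_def ring_expand)
    moreover have "y^2 + a1 * s * y + a3 * y = s^3 + a2 * s^2 + a4 * s + a6"
      "y^2 + a1 * t * y + a3 * y = t^3 + a2 * t^2 + a4 * t + a6"
      using that by (simp_all add: Weierstrass)
    ultimately show ?thesis by (simp only: diff_self)
  qed
  have "q u v = 0" "q u w = 0" using diff[OF assms(1,2)] diff[OF assms(1,3)] assms by auto
  moreover have "q u v - q u w = (v - w) * (u + v + w + a2)"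
    by (simp add: q_def ring_expand)
  ultimately have 0: "u + v + w + a2 = 0" using assms(6) by simp
  have "- a2 - u - v = w - (u + v + w + a2)" by simp
  then have w: "- a2 - u - v = w" unfolding 0 by simp
  have "point_add W (Affine u y) (Affine v y) = Affine w (- a1 * w - y - a3)"
    using assms(4) w by (simp add: Weierstrass Let_def)
  then show ?thesis by (simp add: Weierstrass)
qed

lemma point_add_eq_InfinityD:
  "point_add W (Affine u y) (Affine v z) = Infinity \<Longrightarrow> u = v"
  by (cases W) (auto simp: Let_def split: if_splits)

text \<open>c has order 3 modulo p: c^2 + c + 1 divides c^3 - 1, and c = 1 would make p divide 3. If
  p were 2 modulo 3, Fermat's theorem would give c = 1.\<close>

lemma prime_dvd_quadratic_imp_cong:
  fixes p c :: nat
  assumes p: "prime p" "p \<ge> 5" and dvd: "p dvd c * c + c + 1"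
  shows "[p = 1] (mod 3)"
proof -
  have nc: "\<not> p dvd c"
  proof
    assume "p dvd c"
    then have "p dvd c * c + c" by simp
    then have "p dvd 1" using dvd_add_right_iff[of p "c * c + c" 1] dvd by blast
    then show False using p by simp
  qed
  have c3: "[c ^ 3 = 1] (mod p)"
  proof -
    have "int p dvd (int c - 1) * int (c * c + c + 1)" using dvd by (metis dvd_mult int_dvd_int_iff)
    also have "(int c - 1) * int (c * c + c + 1) = int (c ^ 3) - int 1"
      by (simp add: algebra_simps power3_eq_cube)
    finally show ?thesis by (simp add: cong_iff_dvd_diff flip: cong_int_iff)
  qed
  have c1: "\<not> [c = 1] (mod p)"
  proof
    assume c: "[c = 1] (mod p)"
    then have "[c * c + c + 1 = 1 * 1 + 1 + 1] (mod p)" by (intro cong_add cong_mult) auto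
    then have "[0 = 3] (mod p)" using dvd by (simp add: cong_def dvd_eq_mod_eq_0 numeral_3_eq_3)
    then have "p dvd 3" by (simp add: cong_def dvd_eq_mod_eq_0)
    then show False using p dvd_imp_le[of p 3] by simp
  qed
  have f: "[c ^ (p - 1) = 1] (mod p)" by (rule fermat_theorem[OF p(1) nc])
  have pow: "[c ^ (3 * k) = 1] (mod p)" for k
    using cong_pow[OF c3, of k] by (simp add: power_mult)
  have "p mod 3 \<noteq> 0"
  proof
    assume "p mod 3 = 0"
    then have "3 dvd p" by auto
    then have "3 = (1::nat) \<or> 3 = p" using p(1) unfolding prime_nat_iff by blast
    then show False using p(2) by auto
  qed
  moreover have "p mod 3 \<noteq> 2"
  proof
    assume "p mod 3 = 2"
    then have "p - 1 = 3 * (p div 3) + 1" by presburger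
    then have "[c ^ (p - 1) = c] (mod p)"
      using cong_mult[OF pow[of "p div 3"] cong_refl[of c]] by (simp add: mult.commute)
    then show False using f c1 by (metis cong_sym cong_trans)
  qed
  ultimately have "p mod 3 = 1" by presburger
  then show ?thesis by (simp add: cong_def)
qed

section \<open>Galois images in the normalizer of a split Cartan subgroup\<close>

locale cartan_torsion =
  fixes E :: "'k::field_char_0 weierstrass"
    and p :: nat
    and x1 y1 x2 y2 \<zeta> :: "'k alg_closure"
  assumes ell: "elliptic_curve E"
    and prime: "prime p" and p5: "p \<ge> 5"
    and basis: "torsion_basis E p (Affine x1 y1) (Affine x2 y2)"
    and cartan: "\<forall>\<sigma> \<in> galois_group (torsion_field E p). \<exists>a c. \<not> p dvd a * c \<and>
           (acts_by_matrix E (Affine x1 y1) (Affine x2 y2) \<sigma> a 0 0 c \<or>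
            acts_by_matrix E (Affine x1 y1) (Affine x2 y2) \<sigma> 0 a c 0)"
    and zeta: "primitive_root_of_unity p \<zeta>"
begin

abbreviation W where "W \<equiv> base_change_ac E"
abbreviation G where "G \<equiv> geom_group E"
abbreviation P1 where "P1 \<equiv> Affine x1 y1"
abbreviation P2 where "P2 \<equiv> Affine x2 y2"
abbreviation pw (infixr "\<^bold>^" 75) where "P \<^bold>^ (n::nat) \<equiv> P [^]\<^bsub>G\<^esub> n"
abbreviation ml (infixl "\<^bold>*" 70) where "P \<^bold>* Q \<equiv> P \<otimes>\<^bsub>G\<^esub> Q"

lemma ellW: "elliptic_curve W"
proof -
  interpret h: field_hom "to_ac :: 'k \<Rightarrow> 'k alg_closure" by (rule field_hom_to_ac)
  show ?thesis
    using ell h.weierstrass_disc_map[of E] h.hom_eq_zero_iff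
    unfolding elliptic_curve_def base_change_ac_def by metis
qed

sublocale G: comm_group G
  by (rule comm_group_curve_group[OF ellW])

lemma one_G [simp]: "\<one>\<^bsub>G\<^esub> = Infinity"
  and carrier_G: "P \<in> carrier G \<longleftrightarrow> on_curve W P"
  and mult_G: "P \<^bold>* Q = point_add W P Q"
  by (auto simp: curve_group_def)

lemma torsion_iff: "Q \<in> torsion E p \<longleftrightarrow> Q \<in> carrier G \<and> Q \<^bold>^ p = \<one>\<^bsub>G\<^esub>"
  by (simp add: torsion_def)

lemma P_torsion: "P1 \<in> torsion E p" "P2 \<in> torsion E p"
  using basis by (auto simp: torsion_basis_def)

lemma P_carrier [simp]: "P1 \<in> carrier G" "P2 \<in> carrier G"
  and P_pow: "P1 \<^bold>^ p = \<one>\<^bsub>G\<^esub>" "P2 \<^bold>^ p = \<one>\<^bsub>G\<^esub>"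
  using P_torsion by (auto simp: torsion_iff)

lemma P1_pow_1: "P1 \<^bold>^ (1::nat) = P1" and P2_pow_1: "P2 \<^bold>^ (1::nat) = P2"
  using G.nat_pow_eone[OF P_carrier(1)] G.nat_pow_eone[OF P_carrier(2)] by auto

lemma p0: "p > 0" and p1: "p > 1"
  using p5 by auto

lemma pow_mod:
  assumes "Q \<in> carrier G" "Q \<^bold>^ p = \<one>\<^bsub>G\<^esub>"
  shows "Q \<^bold>^ (n mod p) = Q \<^bold>^ n"
proof -
  have "Q \<^bold>^ n = Q \<^bold>^ (p * (n div p) + n mod p)" by simp
  also have "\<dots> = (Q \<^bold>^ p) \<^bold>^ (n div p) \<^bold>* Q \<^bold>^ (n mod p)"
    using assms(1) by (simp only: G.nat_pow_mult[symmetric] G.nat_pow_pow G.nat_pow_closed)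
  also have "\<dots> = Q \<^bold>^ (n mod p)"
    using assms by (simp only: G.nat_pow_one G.l_one G.nat_pow_closed)
  finally show ?thesis ..
qed

lemma comb_torsion: "P1 \<^bold>^ a \<^bold>* P2 \<^bold>^ b \<in> torsion E p"
proof -
  have "(P1 \<^bold>^ a \<^bold>* P2 \<^bold>^ b) \<^bold>^ p = (P1 \<^bold>^ p) \<^bold>^ a \<^bold>* (P2 \<^bold>^ p) \<^bold>^ b"
    by (simp add: G.nat_pow_distrib G.nat_pow_pow mult.commute)
  also have "\<dots> = \<one>\<^bsub>G\<^esub>" unfolding P_pow by (simp only: G.nat_pow_one G.l_one G.one_closed)
  finally show ?thesis by (simp add: torsion_iff)
qed

lemma comb_eq:
  assumes "P1 \<^bold>^ a \<^bold>* P2 \<^bold>^ b = P1 \<^bold>^ a' \<^bold>* P2 \<^bold>^ b'"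
  shows "[a = a'] (mod p)" "[b = b'] (mod p)"
proof -
  let ?Q = "P1 \<^bold>^ a \<^bold>* P2 \<^bold>^ b"
  have "\<exists>!(m, n). m < p \<and> n < p \<and> ?Q = P1 \<^bold>^ m \<^bold>* P2 \<^bold>^ n"
    using basis comb_torsion unfolding torsion_basis_def by blast
  then have "\<exists>!mn. fst mn < p \<and> snd mn < p \<and> ?Q = P1 \<^bold>^ fst mn \<^bold>* P2 \<^bold>^ snd mn"
    by (simp add: case_prod_beta')
  moreover have "?Q = P1 \<^bold>^ (a mod p) \<^bold>* P2 \<^bold>^ (b mod p)" "?Q = P1 \<^bold>^ (a' mod p) \<^bold>* P2 \<^bold>^ (b' mod p)"
    using assms by (simp_all add: pow_mod P_pow[simplified])
  moreover have "a mod p < p" "b mod p < p" "a' mod p < p" "b' mod p < p" using p0 by auto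
  ultimately have "(a mod p, b mod p) = (a' mod p, b' mod p)"
    by (metis fst_conv snd_conv)
  then show "[a = a'] (mod p)" "[b = b'] (mod p)" by (auto simp: cong_def)
qed

lemma torsion_comb:
  assumes "Q \<in> torsion E p"
  shows "\<exists>(i::nat) (j::nat). Q = P1 \<^bold>^ i \<^bold>* P2 \<^bold>^ j"
proof -
  have "\<exists>!(m, n). m < p \<and> n < p \<and> Q = P1 \<^bold>^ m \<^bold>* P2 \<^bold>^ n"
    using basis assms unfolding torsion_basis_def by blast
  then show ?thesis by auto
qed

text \<open>Uniqueness of coordinates gives the count on which nondegeneracy of the pairing
  rests.\<close>

lemma card_torsion: "card (torsion E p) = p^2"
proof -
  let ?f = "\<lambda>(i, j). P1 \<^bold>^ i \<^bold>* P2 \<^bold>^ j"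
  have "inj_on ?f ({..<p} \<times> {..<p})"
  proof (rule inj_onI)
    fix s t assume st: "s \<in> {..<p} \<times> {..<p}" "t \<in> {..<p} \<times> {..<p}" "?f s = ?f t"
    obtain a b a' b' where eq: "s = (a, b)" "t = (a', b')" by (cases s, cases t) auto
    have "[a = a'] (mod p)" "[b = b'] (mod p)" using comb_eq[of a b a' b'] st(3) eq by auto
    then show "s = t" using st eq by (simp add: cong_def)
  qed
  moreover have "?f ` ({..<p} \<times> {..<p}) = torsion E p"
  proof (intro equalityI subsetI)
    fix Q assume "Q \<in> torsion E p"
    then have "\<exists>!(m, n). m < p \<and> n < p \<and> Q = P1 \<^bold>^ m \<^bold>* P2 \<^bold>^ n"
      using basis unfolding torsion_basis_def by blast
    then obtain m n where "m < p" "n < p" "Q = P1 \<^bold>^ m \<^bold>* P2 \<^bold>^ n" by auto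
    then show "Q \<in> ?f ` ({..<p} \<times> {..<p})" by (intro image_eqI[of _ _ "(m, n)"]) auto
  qed (auto simp: comb_torsion)
  ultimately have "card (torsion E p) = card ({..<p} \<times> {..<p})" by (metis card_image)
  then show ?thesis by (simp add: power2_eq_square)
qed

lemma pairing_exists:
  "\<exists>e. e ^ p = 1 \<and> e \<noteq> 1 \<and> (\<forall>\<sigma> \<sigma>' a b. ac_aut \<sigma> \<sigma>' \<longrightarrow>
    (map_point \<sigma> P1 = P1 \<^bold>^ a \<longrightarrow> map_point \<sigma> P2 = P2 \<^bold>^ b \<longrightarrow> \<sigma> e = e ^ (a * b)) \<and>
    (map_point \<sigma> P1 = P2 \<^bold>^ a \<longrightarrow> map_point \<sigma> P2 = P1 \<^bold>^ b \<longrightarrow> \<sigma> e * e ^ (a * b) = 1))"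
proof (rule weil_pairing_value_exists[OF ellW _ zeta P_carrier(1) P_pow(1) P_carrier(2) P_pow(2)])
  show "2 \<le> p" using p5 by simp
  show "\<exists>(i::nat) (j::nat). Q = P1 \<^bold>^ i \<^bold>* P2 \<^bold>^ j" if "Q \<in> carrier G" "Q \<^bold>^ p = \<one>\<^bsub>G\<^esub>" for Q
    using torsion_comb that torsion_iff by blast
  have "{Q \<in> carrier G. Q \<^bold>^ p = \<one>\<^bsub>G\<^esub>} = torsion E p" by (auto simp: torsion_iff)
  then show "card {Q \<in> carrier G. Q \<^bold>^ p = \<one>\<^bsub>G\<^esub>} = p^2" using card_torsion by simp
next
  fix e :: "'k alg_closure"
  assume e: "e ^ p = 1" "e \<noteq> 1"
    and diag: "\<And>\<sigma> \<sigma>' a b. field_hom \<sigma> \<Longrightarrow> field_hom \<sigma>' \<Longrightarrow> (\<And>x. \<sigma>' (\<sigma> x) = x) \<Longrightarrow> (\<And>x. \<sigma> (\<sigma>' x) = x) \<Longrightarrow>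
      map_weierstrass \<sigma> W = W \<Longrightarrow> map_point \<sigma> P1 = P1 \<^bold>^ a \<Longrightarrow>
      map_point \<sigma> P2 = P2 \<^bold>^ b \<Longrightarrow> \<sigma> e = e ^ (a * b)"
    and anti: "\<And>\<sigma> \<sigma>' a b. field_hom \<sigma> \<Longrightarrow> field_hom \<sigma>' \<Longrightarrow> (\<And>x. \<sigma>' (\<sigma> x) = x) \<Longrightarrow> (\<And>x. \<sigma> (\<sigma>' x) = x) \<Longrightarrow>
      map_weierstrass \<sigma> W = W \<Longrightarrow> map_point \<sigma> P1 = P2 \<^bold>^ a \<Longrightarrow>
      map_point \<sigma> P2 = P1 \<^bold>^ b \<Longrightarrow> \<sigma> e * e ^ (a * b) = 1"
  show ?thesis
  proof (intro exI[of _ e] conjI allI impI e)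
    fix \<sigma> \<sigma>' :: "'k alg_closure \<Rightarrow> 'k alg_closure" and a b
    assume "ac_aut \<sigma> \<sigma>'"
    then interpret ac_aut \<sigma> \<sigma>' .
    show "\<sigma> e = e ^ (a * b)" if "map_point \<sigma> P1 = P1 \<^bold>^ a" "map_point \<sigma> P2 = P2 \<^bold>^ b"
      by (rule diag[OF s.field_hom_axioms s'.field_hom_axioms inverse_left inverse_right
            map_base_change that])
    show "\<sigma> e * e ^ (a * b) = 1" if "map_point \<sigma> P1 = P2 \<^bold>^ a" "map_point \<sigma> P2 = P1 \<^bold>^ b"
      by (rule anti[OF s.field_hom_axioms s'.field_hom_axioms inverse_left inverse_right
            map_base_change that])
  qed
qed

text \<open>The Weil pairing of P1 and P2, fixed once for all automorphisms and accessed through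
  \<open>e_root\<close>, \<open>e_diag\<close> and \<open>e_anti\<close>.\<close>

definition e :: "'k alg_closure"
  where "e = (SOME e. e ^ p = 1 \<and> e \<noteq> 1 \<and> (\<forall>\<sigma> \<sigma>' a b. ac_aut \<sigma> \<sigma>' \<longrightarrow>
    (map_point \<sigma> P1 = P1 \<^bold>^ a \<longrightarrow> map_point \<sigma> P2 = P2 \<^bold>^ b \<longrightarrow> \<sigma> e = e ^ (a * b)) \<and>
    (map_point \<sigma> P1 = P2 \<^bold>^ a \<longrightarrow> map_point \<sigma> P2 = P1 \<^bold>^ b \<longrightarrow> \<sigma> e * e ^ (a * b) = 1)))"

lemma e_root: "e ^ p = 1" "e \<noteq> 1"
  and e_diag: "ac_aut \<sigma> \<sigma>' \<Longrightarrow> map_point \<sigma> P1 = P1 \<^bold>^ a \<Longrightarrow> map_point \<sigma> P2 = P2 \<^bold>^ b \<Longrightarrow> \<sigma> e = e ^ (a * b)"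
  and e_anti: "ac_aut \<sigma> \<sigma>' \<Longrightarrow> map_point \<sigma> P1 = P2 \<^bold>^ a \<Longrightarrow> map_point \<sigma> P2 = P1 \<^bold>^ b \<Longrightarrow> \<sigma> e * e ^ (a * b) = 1"
  using someI_ex[OF pairing_exists] unfolding e_def by blast+

lemma e_nonzero: "e \<noteq> 0"
  using e_root(1) p0 by (auto simp: power_0_left)

lemma aut_cases:
  assumes "ac_aut \<sigma> \<sigma>'"
  obtains (diag) a c where "map_point \<sigma> P1 = P1 \<^bold>^ a" "map_point \<sigma> P2 = P2 \<^bold>^ c"
      "\<not> p dvd a" "\<not> p dvd c"
    | (anti) a c where "map_point \<sigma> P1 = P2 \<^bold>^ c" "map_point \<sigma> P2 = P1 \<^bold>^ a"
      "\<not> p dvd a" "\<not> p dvd c"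
proof -
  interpret ac_aut \<sigma> \<sigma>' by fact
  obtain a c where ac: "\<not> p dvd a * c"
    "acts_by_matrix E P1 P2 \<sigma> a 0 0 c \<or> acts_by_matrix E P1 P2 \<sigma> 0 a c 0"
    using cartan galois_group_torsion_field[of E p] by blast
  have nd: "\<not> p dvd a" "\<not> p dvd c" using ac(1) by auto
  from ac(2) show thesis
  proof
    assume "acts_by_matrix E P1 P2 \<sigma> a 0 0 c"
    then show thesis
      using nd by (intro diag[of a c]) (simp_all add: acts_by_matrix_def mult_G)
  next
    assume "acts_by_matrix E P1 P2 \<sigma> 0 a c 0"
    then show thesis
      using nd by (intro anti[of c a]) (simp_all add: acts_by_matrix_def mult_G)
  qed
qed

lemma aut_fixes_torsion_field:
  assumes "ac_aut \<sigma> \<sigma>'" "map_point \<sigma> P1 = P1" "map_point \<sigma> P2 = P2" "x \<in> torsion_field E p"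
  shows "\<sigma> x = x"
proof -
  interpret ac_aut \<sigma> \<sigma>' by fact
  have "map_point \<sigma> Q = Q" if "Q \<in> torsion E p" for Q
  proof -
    obtain i j :: nat where Q: "Q = P1 \<^bold>^ i \<^bold>* P2 \<^bold>^ j" using torsion_comb \<open>Q \<in> torsion E p\<close> by blast
    show ?thesis unfolding Q map_point_mult map_point_pow assms(2,3) ..
  qed
  then have "\<sigma> s = s" if "s \<in> set_point Q" "Q \<in> torsion E p" for s Q
    using that by (cases Q) force+
  then show ?thesis
    using fixes_adjoin[of _ x] assms(4) unfolding torsion_field_def by blast
qed

text \<open>An automorphism fixing all torsion coordinates fixes e, so e lies in the torsion field;
  having exact order p, it has \<zeta> among its powers.\<close>

lemma zeta_in_torsion_field: "\<zeta> \<in> torsion_field E p"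
proof -
  have "e \<in> torsion_field E p"
  proof (rule ccontr)
    assume "e \<notin> torsion_field E p"
    then obtain \<sigma> \<sigma>' where s: "ac_aut \<sigma> \<sigma>'"
      "\<And>s. s \<in> (\<Union>P\<in>torsion E p. set_point P) \<Longrightarrow> \<sigma> s = s" "\<sigma> e \<noteq> e"
      unfolding torsion_field_def by (metis ac_aut_moving)
    have "\<sigma> x1 = x1" "\<sigma> y1 = y1" "\<sigma> x2 = x2" "\<sigma> y2 = y2"
      by (rule s(2), rule UN_I[OF P_torsion(1)] UN_I[OF P_torsion(2)], simp)+
    then have "map_point \<sigma> P1 = P1 \<^bold>^ 1" "map_point \<sigma> P2 = P2 \<^bold>^ 1"
      unfolding P1_pow_1 P2_pow_1 by simp_all
    from e_diag[OF s(1) this] s(3) show False by simp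
  qed
  moreover obtain i where "\<zeta> = e ^ i"
    using root_of_unity_power_of_primitive[OF primitive_root_of_prime_order[OF prime e_root] _ p0] zeta
    by (auto simp: primitive_root_of_unity_def)
  ultimately show ?thesis
    unfolding torsion_field_def using subfldD(9)[OF subfld_adjoin] by blast
qed

lemma aut_fixes_e:
  assumes "ac_aut \<sigma> \<sigma>'" "\<sigma> \<zeta> = \<zeta>"
  shows "\<sigma> e = e"
proof -
  interpret ac_aut \<sigma> \<sigma>' by fact
  obtain i where "e = \<zeta> ^ i"
    using root_of_unity_power_of_primitive[OF zeta e_root(1) p0] by blast
  then show ?thesis using assms(2) by simp
qed

text \<open>As a power of \<zeta>, e is fixed; so the determinant, as an exponent of e, is 1 modulo
  the order p.\<close>

lemma det_diag:
  assumes "ac_aut \<sigma> \<sigma>'" "\<sigma> \<zeta> = \<zeta>" "map_point \<sigma> P1 = P1 \<^bold>^ a" "map_point \<sigma> P2 = P2 \<^bold>^ c"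
  shows "[a * c = 1] (mod p)"
proof -
  have e: "e ^ (a * c) = e" using e_diag[OF assms(1,3,4)] aut_fixes_e[OF assms(1,2)] by simp
  have "a * c \<noteq> 0"
  proof
    assume 0: "a * c = 0"
    show False using e e_root(2) unfolding 0 by simp
  qed
  then obtain k where k: "a * c = Suc k" using not0_implies_Suc by blast
  then have "e ^ k = 1" using e e_nonzero by simp
  then have "p dvd k" using power_eq_1_iff_dvd[OF prime e_root] by blast
  then show ?thesis unfolding k by (metis One_nat_def add_0 cong_0_iff cong_add_rcancel_0_nat plus_1_eq_Suc add.commute)
qed

text \<open>Here the determinant is -ca.\<close>

lemma det_anti:
  assumes "ac_aut \<sigma> \<sigma>'" "\<sigma> \<zeta> = \<zeta>" "map_point \<sigma> P1 = P2 \<^bold>^ c" "map_point \<sigma> P2 = P1 \<^bold>^ a"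
  shows "p dvd c * a + 1"
proof -
  have "e * e ^ (c * a) = 1" using e_anti[OF assms(1,3,4)] aut_fixes_e[OF assms(1,2)] by simp
  then have "e ^ (c * a + 1) = 1" by simp
  then show ?thesis using power_eq_1_iff_dvd[OF prime e_root] by blast
qed

lemma pow_cong:
  assumes "Q \<in> carrier G" "Q \<^bold>^ p = \<one>\<^bsub>G\<^esub>" "[a = b] (mod p)"
  shows "Q \<^bold>^ a = Q \<^bold>^ b"
  using pow_mod[OF assms(1,2), of a] pow_mod[OF assms(1,2), of b] assms(3) by (simp add: cong_def)

lemma comb_left: "P1 \<^bold>^ a = P1 \<^bold>^ a \<^bold>* P2 \<^bold>^ (0::nat)" and comb_right: "P2 \<^bold>^ a = P1 \<^bold>^ (0::nat) \<^bold>* P2 \<^bold>^ a"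
  by (simp_all add: mult_G)

lemma P2_pow_eq: "P2 \<^bold>^ a = P2 \<^bold>^ b \<Longrightarrow> [a = b] (mod p)"
  using comb_eq(2)[of 0 a 0 b] by (metis comb_right)

lemma P1_pow_eq: "P1 \<^bold>^ a = P1 \<^bold>^ b \<Longrightarrow> [a = b] (mod p)"
  using comb_eq(1)[of a 0 b 0] by (metis comb_left)

lemma P1_pow_eq_P2_pow: "P1 \<^bold>^ a = P2 \<^bold>^ b \<Longrightarrow> [a = 0] (mod p)"
  using comb_eq(1)[of a 0 0 b] by (metis comb_left comb_right)

text \<open>In the diagonal case c = 1 and determinant 1 give a = 1; in the antidiagonal case P2
  would be a multiple of P1.\<close>

lemma fixes_P2_imp:
  assumes "ac_aut \<sigma> \<sigma>'" "\<sigma> \<zeta> = \<zeta>" "map_point \<sigma> P2 = P2"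
  shows "map_point \<sigma> P1 = P1"
  using assms(1)
proof (cases rule: aut_cases)
  case (diag a c)
  have "P2 \<^bold>^ c = P2 \<^bold>^ 1" using diag(2) assms(3) unfolding P2_pow_1 by simp
  then have "[a * 1 = a * c] (mod p)" by (intro cong_mult cong_refl cong_sym[OF P2_pow_eq])
  also have "[a * c = 1] (mod p)" by (rule det_diag[OF assms(1,2) diag(1,2)])
  finally have "[a = 1] (mod p)" by simp
  then show ?thesis using diag(1) pow_cong[OF P_carrier(1) P_pow(1)] P1_pow_1 by simp
next
  case (anti a c)
  have "P1 \<^bold>^ a = P2 \<^bold>^ 1" using anti(2) assms(3) unfolding P2_pow_1 by simp
  then have "p dvd a" using P1_pow_eq_P2_pow[of a 1] by (simp add: cong_0_iff)
  then show ?thesis using anti(3) by simp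
qed

lemma fixes_P1_imp:
  assumes "ac_aut \<sigma> \<sigma>'" "\<sigma> \<zeta> = \<zeta>" "map_point \<sigma> P1 = P1"
  shows "map_point \<sigma> P2 = P2"
  using assms(1)
proof (cases rule: aut_cases)
  case (diag a c)
  have "P1 \<^bold>^ a = P1 \<^bold>^ 1" using diag(1) assms(3) unfolding P1_pow_1 by simp
  then have "[1 * c = a * c] (mod p)" by (intro cong_mult cong_refl cong_sym[OF P1_pow_eq])
  also have "[a * c = 1] (mod p)" by (rule det_diag[OF assms(1,2) diag(1,2)])
  finally have "[c = 1] (mod p)" by simp
  then show ?thesis using diag(2) pow_cong[OF P_carrier(2) P_pow(2)] P2_pow_1 by simp
next
  case (anti a c)
  have "P1 \<^bold>^ 1 = P2 \<^bold>^ c" using anti(1) assms(3) unfolding P1_pow_1 by simp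
  then have "p dvd 1" using P1_pow_eq_P2_pow[of 1 c] by (simp only: cong_0_iff)
  then show ?thesis using p1 by simp
qed

text \<open>An element of the torsion field outside K(S) would be moved by an automorphism fixing S,
  but such an automorphism fixes the basis and with it all torsion.\<close>

lemma torsion_field_eqI:
  assumes "S \<subseteq> torsion_field E p"
    and "\<And>\<sigma> \<sigma>'. ac_aut \<sigma> \<sigma>' \<Longrightarrow> (\<And>s. s \<in> S \<Longrightarrow> \<sigma> s = s) \<Longrightarrow> map_point \<sigma> P1 = P1 \<and> map_point \<sigma> P2 = P2"
  shows "torsion_field E p = adjoin S"
proof
  show "adjoin S \<subseteq> torsion_field E p"
    using adjoin_min[OF _ _ assms(1)] unfolding torsion_field_def
    using subfld_adjoin to_ac_in_adjoin by blast
  show "torsion_field E p \<subseteq> adjoin S"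
  proof
    fix \<alpha> assume \<alpha>: "\<alpha> \<in> torsion_field E p"
    show "\<alpha> \<in> adjoin S"
    proof (rule ccontr)
      assume "\<alpha> \<notin> adjoin S"
      then obtain \<sigma> \<sigma>' where s: "ac_aut \<sigma> \<sigma>'" "\<And>s. s \<in> S \<Longrightarrow> \<sigma> s = s" "\<sigma> \<alpha> \<noteq> \<alpha>"
        by (metis ac_aut_moving)
      then show False using aut_fixes_torsion_field[OF s(1) _ _ \<alpha>] assms(2)[OF s(1,2)] by blast
    qed
  qed
qed

section \<open>Fields generated by coordinates of the basis points\<close>

lemma coords_in_torsion_field:
  "x1 \<in> torsion_field E p" "y1 \<in> torsion_field E p" "x2 \<in> torsion_field E p" "y2 \<in> torsion_field E p"
  unfolding torsion_field_def
  by (rule in_adjoin, rule UN_I[OF P_torsion(1)] UN_I[OF P_torsion(2)], simp)+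

lemma torsion_field_eq1: "torsion_field E p = adjoin {x1, y1, \<zeta>}"
  by (rule torsion_field_eqI)
     (use coords_in_torsion_field zeta_in_torsion_field fixes_P1_imp in auto)

lemma torsion_field_eq2: "torsion_field E p = adjoin {x2, y2, \<zeta>}"
  by (rule torsion_field_eqI)
     (use coords_in_torsion_field zeta_in_torsion_field fixes_P2_imp in auto)

lemma inverse_P2_abscissa:
  assumes "Affine u v \<in> carrier G" "Affine u v \<^bold>* P2 = Infinity"
  shows "u = x2"
  using point_add_eq_InfinityD[of W u v x2 y2] assms(2) by (simp add: mult_G)

lemma P2_order: "P2 \<^bold>^ n = Infinity \<Longrightarrow> p dvd n"
  using P2_pow_eq[of n 0] by (simp add: cong_0_iff)

text \<open>A negative of P2 with the same ordinate would be P2 itself, so p would divide 2.\<close>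

lemma inverse_P2_ordinate:
  assumes "Affine u y2 \<in> carrier G" "Affine u y2 \<^bold>* P2 = Infinity"
  shows False
proof -
  have "u = x2" by (rule inverse_P2_abscissa[OF assms])
  then have "P2 \<^bold>^ (2::nat) = Infinity" using assms(2) by (simp add: numeral_2_eq_2 mult_G)
  then have "p dvd 2" by (rule P2_order)
  then show False using p5 dvd_imp_le[of p 2] by simp
qed

lemma fixes_ordinate_cases:
  assumes aut: "ac_aut \<sigma> \<sigma>'" and fx: "\<sigma> \<zeta> = \<zeta>" "\<sigma> y2 = y2"
  shows "map_point \<sigma> P2 = P2 \<or>
    (\<exists>c. p dvd c * c + c + 1) \<and> x2 \<noteq> \<sigma> x2 \<and> x2 \<noteq> \<sigma> (\<sigma> x2) \<and> \<sigma> x2 \<noteq> \<sigma> (\<sigma> x2)"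
proof -
  interpret ac_aut \<sigma> \<sigma>' by fact
  have m1: "map_point \<sigma> P2 = Affine (\<sigma> x2) y2" and m2: "map_point \<sigma> (map_point \<sigma> P2) = Affine (\<sigma> (\<sigma> x2)) y2"
    using fx by auto
  have "map_point \<sigma> P2 \<in> torsion E p" "map_point \<sigma> (map_point \<sigma> P2) \<in> torsion E p"
    using map_torsion P_torsion by blast+
  then have c1: "Affine (\<sigma> x2) y2 \<in> carrier G" and c2: "Affine (\<sigma> (\<sigma> x2)) y2 \<in> carrier G"
    by (auto simp: torsion_iff fx)
  from aut show ?thesis
  proof (cases rule: aut_cases)
    case (diag a c)
    have s1: "Affine (\<sigma> x2) y2 = P2 \<^bold>^ c" using diag(2) m1 by simp
    have s2: "Affine (\<sigma> (\<sigma> x2)) y2 = P2 \<^bold>^ (c * c)"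
      unfolding m2[symmetric] diag(2) map_point_pow by (simp add: G.nat_pow_pow)
    show ?thesis
    proof (cases "\<sigma> x2 = x2")
      case True
      then show ?thesis using m1 by simp
    next
      case ne: False
      then have ne': "\<sigma> x2 \<noteq> \<sigma> (\<sigma> x2)" by simp
      \<comment> \<open>A return to x2 after two steps means c^2 = 1. For c = 1 the abscissa x2 is
        not moved at all, and for c = -1 the image is -P2, which has the same abscissa as
        P2.\<close>
      have ne'': "x2 \<noteq> \<sigma> (\<sigma> x2)"
      proof
        assume "x2 = \<sigma> (\<sigma> x2)"
        then have "P2 \<^bold>^ (c * c) = P2 \<^bold>^ 1" using s2 P2_pow_1 by simp
        then have "[c * c = 1] (mod p)" by (rule P2_pow_eq)
        then have "[int c * int c = 1] (mod int p)"
          by (metis cong_int_iff of_nat_1 of_nat_mult)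
        moreover have "int c > 0" using diag(4) by (cases c) auto
        ultimately have "[int c = 1] (mod int p) \<or> [int c = - 1] (mod int p)"
          using cong_square[of "int p" "int c"] prime by simp
        then show False
        proof
          assume "[int c = 1] (mod int p)"
          then have "[c = 1] (mod p)" by (metis cong_int_iff of_nat_1)
          then have "P2 \<^bold>^ c = P2 \<^bold>^ 1" by (rule pow_cong[OF P_carrier(2) P_pow(2)])
          then show False using s1 ne P2_pow_1 by simp
        next
          assume "[int c = - 1] (mod int p)"
          then have "int p dvd int (Suc c)" by (simp add: cong_iff_dvd_diff add.commute)
          then have "[Suc c = 0] (mod p)" by (simp only: cong_0_iff int_dvd_int_iff)
          then have "P2 \<^bold>^ Suc c = P2 \<^bold>^ (0::nat)" by (rule pow_cong[OF P_carrier(2) P_pow(2)])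
          then have "Affine (\<sigma> x2) y2 \<^bold>* P2 = Infinity"
            unfolding s1 by simp
          then show False using inverse_P2_abscissa[OF c1] ne by blast
        qed
      qed
      have "P2 \<^bold>* P2 \<^bold>^ c \<^bold>* P2 \<^bold>^ (c * c) = Infinity"
        unfolding s1[symmetric] s2[symmetric] mult_G
        by (rule horizontal_line_sum)
           (use c1 c2 P_carrier(2) carrier_G ne ne' ne'' in auto)
      moreover have "P2 \<^bold>* P2 \<^bold>^ c \<^bold>* P2 \<^bold>^ (c * c) = P2 \<^bold>^ (c * c + c + 1)"
      proof -
        have "P2 \<^bold>^ (1 + c + c * c) = P2 \<^bold>^ (1::nat) \<^bold>* P2 \<^bold>^ c \<^bold>* P2 \<^bold>^ (c * c)"
          by (simp only: G.nat_pow_mult[OF P_carrier(2), symmetric])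
        then show ?thesis unfolding P2_pow_1 by (simp add: add.commute add.left_commute)
      qed
      ultimately have "p dvd c * c + c + 1" using P2_order by simp
      then show ?thesis using ne[symmetric] ne' ne'' by blast
    qed
  next
    case (anti a c)
    \<comment> \<open>Determinant 1 makes ca = -1, so applying \<sigma> twice gives -P2; but the
      ordinate is still y2.\<close>
    have "map_point \<sigma> (map_point \<sigma> P2) = P2 \<^bold>^ (c * a)"
      unfolding anti(2) map_point_pow unfolding anti(1) by (simp add: G.nat_pow_pow)
    then have "Affine (\<sigma> (\<sigma> x2)) y2 \<^bold>* P2 = P2 \<^bold>^ (c * a + 1)"
      unfolding m2 by simp
    also have "\<dots> = P2 \<^bold>^ (0::nat)"
      by (rule pow_cong[OF P_carrier(2) P_pow(2)])
         (use det_anti[OF aut fx(1) anti(1,2)] in \<open>simp only: cong_0_iff\<close>)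
    finally have False using inverse_P2_ordinate[OF c2] by simp
    then show ?thesis ..
  qed
qed

lemma torsion_field_eq3:
  assumes "\<not> [p = 1] (mod 3)"
  shows "torsion_field E p = adjoin {\<zeta>, y2}"
proof (rule torsion_field_eqI)
  show "{\<zeta>, y2} \<subseteq> torsion_field E p"
    using coords_in_torsion_field zeta_in_torsion_field by simp
  fix \<sigma> \<sigma>' assume s: "ac_aut \<sigma> \<sigma>'" "\<And>s. s \<in> {\<zeta>, y2} \<Longrightarrow> \<sigma> s = s"
  have fx: "\<sigma> \<zeta> = \<zeta>" "\<sigma> y2 = y2" using s(2) by auto
  have "map_point \<sigma> P2 = P2"
    using fixes_ordinate_cases[OF s(1) fx] prime_dvd_quadratic_imp_cong[OF prime p5] assms by blast
  then show "map_point \<sigma> P1 = P1 \<and> map_point \<sigma> P2 = P2"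
    using fixes_P2_imp[OF s(1) fx(1)] by blast
qed

section \<open>The degree of the torsion field over the field of \<zeta> and y2\<close>

lemma x2_cubic:
  obtains b0 b1 b2 where "b0 \<in> adjoin {\<zeta>, y2}" "b1 \<in> adjoin {\<zeta>, y2}" "b2 \<in> adjoin {\<zeta>, y2}"
    "x2 * x2^2 = b0 + b1 * x2 + b2 * x2^2"
proof (cases E)
  case (Weierstrass a1 a2 a3 a4 a6)
  note A = subfldD[OF subfld_adjoin[of "{\<zeta>, y2}"]] to_ac_in_adjoin
  have y2: "y2 \<in> adjoin {\<zeta>, y2}" by (rule in_adjoin) simp
  define b0 where "b0 = y2^2 + to_ac a3 * y2 - to_ac a6"
  define b1 where "b1 = to_ac a1 * y2 - to_ac a4"
  define b2 where "b2 = - to_ac a2"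
  show thesis
  proof (rule that)
    show "b0 \<in> adjoin {\<zeta>, y2}" "b1 \<in> adjoin {\<zeta>, y2}" "b2 \<in> adjoin {\<zeta>, y2}"
      unfolding b0_def b1_def b2_def by (intro A y2)+
    have "y2^2 + to_ac a1 * x2 * y2 + to_ac a3 * y2 =
        x2^3 + to_ac a2 * x2^2 + to_ac a4 * x2 + to_ac a6"
      using P_carrier(2) unfolding carrier_G by (simp add: Weierstrass base_change_ac_def)
    then have "x2^3 = y2^2 + to_ac a1 * x2 * y2 + to_ac a3 * y2
        - (to_ac a2 * x2^2 + to_ac a4 * x2 + to_ac a6)"
      by (simp add: algebra_simps)
    then show "x2 * x2^2 = b0 + b1 * x2 + b2 * x2^2"
      by (simp add: b0_def b1_def b2_def algebra_simps power3_eq_cube power2_eq_square)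
  qed
qed

text \<open>By \<open>torsion_field_eq2\<close> the torsion field is M(x2), where M is generated by
  \<zeta> and y2, and x2 is a root of a cubic over M. If x2 is not in M, three distinct conjugates
  exclude quadratic relations, leaving degree 3.\<close>

lemma torsion_field_dimension:
  "ring.dimension ac_ring 1 (adjoin {\<zeta>, y2}) (torsion_field E p) \<or>
   ring.dimension ac_ring 3 (adjoin {\<zeta>, y2}) (torsion_field E p)"
proof -
  define M where "M = adjoin {\<zeta>, y2}"
  define L where "L = torsion_field E p"
  have M: "subfld M" unfolding M_def by (rule subfld_adjoin)
  note A = subfldD[OF M]
  have dim1: "ac.dimension 1 M M"
  proof -
    \<comment> \<open>Dimension is built from successive line extensions, so M is first exhibited as
      the line spanned by 1.\<close>
    have "ac.line_extension M 1 {0} = M"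
      by (auto simp: ac.line_extension_mem_iff)
    then show ?thesis
      using ac.Suc_dim[of 1 "{0}" 0 M] ac.zero_dim[of M] by simp
  qed
  show ?thesis
  proof (cases "x2 \<in> M")
    case True
    have "L = M"
      unfolding L_def torsion_field_eq2
    proof
      show "adjoin {x2, y2, \<zeta>} \<subseteq> M"
        by (rule adjoin_min[OF M])
           (use True in \<open>auto simp: M_def to_ac_in_adjoin intro: in_adjoin\<close>)
      show "M \<subseteq> adjoin {x2, y2, \<zeta>}"
        unfolding M_def by (rule adjoin_min[OF subfld_adjoin]) (auto simp: to_ac_in_adjoin intro: in_adjoin)
    qed
    then show ?thesis using dim1 by (simp add: M_def L_def)
  next
    case x2: False
    obtain \<sigma> \<sigma>' where s: "ac_aut \<sigma> \<sigma>'" "\<And>s. s \<in> {\<zeta>, y2} \<Longrightarrow> \<sigma> s = s" "\<sigma> x2 \<noteq> x2"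
      using ac_aut_moving[OF x2[unfolded M_def]] by metis
    interpret ac_aut \<sigma> \<sigma>' by (rule s(1))
    have fx: "\<sigma> \<zeta> = \<zeta>" "\<sigma> y2 = y2" using s(2) by auto
    have fxM: "\<sigma> m = m" if "m \<in> M" for m
      using fixes_adjoin[of "{\<zeta>, y2}" m] s(2) that unfolding M_def by blast
    have ne: "x2 \<noteq> \<sigma> x2" "x2 \<noteq> \<sigma> (\<sigma> x2)" "\<sigma> x2 \<noteq> \<sigma> (\<sigma> x2)"
      using fixes_ordinate_cases[OF s(1) fx] s(3) by auto
    define T where "T = {k * x2^2 + (l * x2 + m) | k l m. k \<in> M \<and> l \<in> M \<and> m \<in> M}"
    \<comment> \<open>The polynomial k x^2 + l x + m is fixed by \<sigma>, so with x2 it would have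
      two further conjugates as roots: three roots in degree 2.\<close>
    have indep: "k = 0" if "k \<in> M" "l \<in> M" "m \<in> M" "k * x2^2 + (l * x2 + m) = 0" for k l m
    proof (rule ccontr)
      assume "k \<noteq> 0"
      define f where "f = [:m, l, k:]"
      have f: "f \<noteq> 0" "degree f = 2" using \<open>k \<noteq> 0\<close> by (auto simp: f_def)
      have "map_poly \<sigma> f = f" using that by (simp add: f_def map_poly_pCons fxM)
      then have step: "poly f (\<sigma> x) = \<sigma> (poly f x)" for x
        using s.hom_poly[of f x] by simp
      have "poly f x2 = 0" using that(4) by (simp add: f_def algebra_simps power2_eq_square)
      then have "{x2, \<sigma> x2, \<sigma> (\<sigma> x2)} \<subseteq> {x. poly f x = 0}" using step by simp
      then have "card {x2, \<sigma> x2, \<sigma> (\<sigma> x2)} \<le> card {x. poly f x = 0}"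
        by (rule card_mono[OF poly_roots_finite[OF f(1)]])
      also have "\<dots> \<le> 2" using card_poly_roots_bound[OF f(1)] f(2) by simp
      finally have "card {x2, \<sigma> x2, \<sigma> (\<sigma> x2)} \<le> 2" .
      then show False using ne by simp
    qed
    have T_eq: "T = ac.line_extension M (x2^2) (ac.line_extension M x2 M)"
      unfolding T_def
      by (rule Set.set_eqI)
         (simp only: mem_Collect_eq ac.line_extension_mem_iff Bex_def ac_ring_simps, blast)
    have "x2^2 \<notin> ac.line_extension M x2 M"
    proof
      assume "x2^2 \<in> ac.line_extension M x2 M"
      then obtain l m where lm: "l \<in> M" "m \<in> M" "x2^2 = l * x2 + m"
        by (auto simp: ac.line_extension_mem_iff)
      then have "1 * x2^2 + ((- l) * x2 + (- m)) = 0" by simp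
      from indep[OF A(1) A(5)[OF lm(1)] A(5)[OF lm(2)] this] show False by simp
    qed
    then have dim3: "ac.dimension 3 M T"
      unfolding T_eq numeral_3_eq_3 using dim1 x2
      by (intro ac.Suc_dim) auto
    have TI: "k * x2^2 + (l * x2 + m) \<in> T" if "k \<in> M" "l \<in> M" "m \<in> M" for k l m
      using that by (auto simp: T_def)
    have MT: "m \<in> T" if "m \<in> M" for m using TI[OF A(2) A(2) that] by simp
    have x2T: "x2 \<in> T" using TI[OF A(2) A(1) A(2)] by simp
    have add: "s + t \<in> T" if "s \<in> T" "t \<in> T" for s t
    proof -
      obtain k l m k' l' m' where
        *: "k \<in> M" "l \<in> M" "m \<in> M" "s = k * x2^2 + (l * x2 + m)"
        "k' \<in> M" "l' \<in> M" "m' \<in> M" "t = k' * x2^2 + (l' * x2 + m')"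
        using \<open>s \<in> T\<close> \<open>t \<in> T\<close> unfolding T_def by blast
      have "s + t = (k + k') * x2^2 + ((l + l') * x2 + (m + m'))"
        unfolding * by (simp add: algebra_simps)
      then show ?thesis using TI[OF A(3)[OF *(1,5)] A(3)[OF *(2,6)] A(3)[OF *(3,7)]] by simp
    qed
    obtain b0 b1 b2 where b: "b0 \<in> M" "b1 \<in> M" "b2 \<in> M" "x2 * x2^2 = b0 + b1 * x2 + b2 * x2^2"
      unfolding M_def by (rule x2_cubic)
    have scale: "m * t \<in> T" if "m \<in> M" "t \<in> T" for m t
    proof -
      obtain k l n where *: "k \<in> M" "l \<in> M" "n \<in> M" "t = k * x2^2 + (l * x2 + n)"
        using \<open>t \<in> T\<close> unfolding T_def by blast
      have "m * t = (m * k) * x2^2 + ((m * l) * x2 + (m * n))"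
        unfolding * by (simp add: algebra_simps)
      then show ?thesis using TI[OF A(4)[OF that(1) *(1)] A(4)[OF that(1) *(2)] A(4)[OF that(1) *(3)]] by simp
    qed
    have x2_mult: "x2 * t \<in> T" if "t \<in> T" for t
    proof -
      obtain k l n where *: "k \<in> M" "l \<in> M" "n \<in> M" "t = k * x2^2 + (l * x2 + n)"
        using \<open>t \<in> T\<close> unfolding T_def by blast
      have "x2 * t = k * (x2 * x2^2) + (l * x2^2 + (n * x2 + 0))"
        unfolding * by (simp add: algebra_simps power2_eq_square)
      also have "\<dots> = (k * b2 + l) * x2^2 + ((k * b1 + n) * x2 + k * b0)"
        unfolding b(4) by (simp add: algebra_simps)
      also have "\<dots> \<in> T" by (intro TI A * b)
      finally show ?thesis .
    qed
    have mult: "s * t \<in> T" if "s \<in> T" "t \<in> T" for s t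
    proof -
      obtain k l n where *: "k \<in> M" "l \<in> M" "n \<in> M" "s = k * x2^2 + (l * x2 + n)"
        using \<open>s \<in> T\<close> unfolding T_def by blast
      have "s * t = k * (x2 * (x2 * t)) + (l * (x2 * t) + n * t)"
        unfolding * by (simp add: algebra_simps power2_eq_square)
      also have "\<dots> \<in> T" by (intro add scale x2_mult that *)
      finally show ?thesis .
    qed
    have "subfld T"
      unfolding subfld_def
    proof (intro conjI ballI add mult)
      show "1 \<in> T" by (rule MT[OF A(1)])
      fix t assume t: "t \<in> T"
      show "- t \<in> T" using scale[OF A(5)[OF A(1)] t] by simp
      show "inverse t \<in> T"
      proof (cases "t = 0")
        case True
        then show ?thesis using t by simp
      next
        case False
        \<comment> \<open>Inverses are polynomial expressions over M, and T is closed under these as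
          a ring containing M.\<close>
        interpret algebraic_over M unfolding M_def by (rule algebraic_over_adjoin)
        obtain q where q: "q \<in> polys M" "inverse t = poly q t"
          using inverse_as_poly[OF False] by blast
        have "poly q t \<in> T"
          using q(1)
        proof (induction q)
          case 0
          then show ?case using MT[OF A(2)] by simp
        next
          case (pCons a q)
          then show ?case using add[OF MT mult[OF t]] by (simp add: polys_pCons_iff)
        qed
        then show ?thesis using q(2) by simp
      qed
    qed
    have "L = T"
    proof
      show "L \<subseteq> T"
        unfolding L_def torsion_field_eq2
        by (rule adjoin_min[OF \<open>subfld T\<close>])
           (use x2T MT in \<open>auto simp: M_def to_ac_in_adjoin in_adjoin\<close>)
      have "M \<subseteq> L"
        unfolding M_def L_def torsion_field_eq2
        by (rule adjoin_min[OF subfld_adjoin]) (auto simp: to_ac_in_adjoin intro: in_adjoin)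
      moreover have "subfld L" unfolding L_def torsion_field_def by (rule subfld_adjoin)
      moreover have "x2 \<in> L" unfolding L_def by (rule coords_in_torsion_field)
      ultimately show "T \<subseteq> L"
        by (auto simp: T_def intro!: subfldD(3,4,9)[of L])
    qed
    then show ?thesis using dim3 by (simp add: M_def L_def)
  qed
qed

end

theorem theorem4p10:
  fixes E :: "'k::field_char_0 weierstrass"
    and p :: nat
    and x1 y1 x2 y2 \<zeta> :: "'k alg_closure"
  assumes "number_field TYPE('k)"
    and "elliptic_curve E"
    and "prime p" and "p \<ge> 5"
    and "torsion_basis E p (Affine x1 y1) (Affine x2 y2)"
    and "\<forall>\<sigma> \<in> galois_group (torsion_field E p). \<exists>a c. \<not> p dvd a * c \<and>
           (acts_by_matrix E (Affine x1 y1) (Affine x2 y2) \<sigma> a 0 0 c \<or>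
            acts_by_matrix E (Affine x1 y1) (Affine x2 y2) \<sigma> 0 a c 0)"
    and "primitive_root_of_unity p \<zeta>"
  shows "(torsion_field E p = adjoin {x1, \<zeta>} \<or> torsion_field E p = adjoin {x1, y1, \<zeta>}) \<and>
    (\<not> [p = 1] (mod 3) \<longrightarrow> torsion_field E p = adjoin {\<zeta>, y2}) \<and>
    ([p = 1] (mod 3) \<longrightarrow>
       ring.dimension ac_ring 1 (adjoin {\<zeta>, y2}) (torsion_field E p) \<or>
       ring.dimension ac_ring 3 (adjoin {\<zeta>, y2}) (torsion_field E p))"
proof -
  interpret cartan_torsion E p x1 y1 x2 y2 \<zeta>
    using assms(2-) by (rule cartan_torsion.intro)
  \<comment> \<open>\<open>torsion_field_eq1\<close> gives the second alternative of the first
    claim.\<close>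
  show ?thesis
    using torsion_field_eq1 torsion_field_eq3 torsion_field_dimension by blast
qed

end
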